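(* Let $\mathbb{K}$ be an algebraically closed field, let $d\ge 3$, and let $\mathcal{I}=\langle u_1,u_2,u_3,u_4\rangle\subset\mathbb{K}[\underline{t}]=\mathbb{K}[t_1,t_2,t_3]$ be an ideal generated by four nonzero homogeneous polynomials of degree $d$ with $\gcd(u_1,u_2,u_3,u_4)=1$. Assume that $\mathcal{I}$ is saturated with respect to $\langle t_1,t_2,t_3\rangle$, that it is a local complete intersection in $\mathbb{P}^2$, and that it has a $\mu$-basis given by three forms $p_1(\underline{t},\underline{X}),p_2(\underline{t},\underline{X}),p_3(\underline{t},\underline{X})$ of respective $\underline{t}$-degrees $1,1,d-2$. Let $\mathcal{K}$ be the kernel of the morphism of $\mathbb{K}[\underline{t}]$-algebras $\mathfrak{h}:\mathbb{K}[\underline{t},\underline{X}]\to\mathbb{K}[\underline{t}][Z]$, $X_i\mapsto u_iZ$ ($i=1,\dots,4$), and let $F_{d-2},F_{d-3},\dots,F_0$ be any sequence of polynomials obtained by the recursive construction described in the context. Then $$\{p_1,\ p_2,\ F_0,\ F_1,\ \dots,\ F_{d-2}\}$$ is a minimal set of generators of $\mathcal{K}$.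
   Context: Notation: $\underline{X}=(X_1,X_2,X_3,X_4)$, and $Z$ is a new variable. $\mathbb{K}[\underline{t},\underline{X}]$ is bigraded by total degrees in $\underline{t}$ and $\underline{X}$; $\mathcal{K}_{i,j}$ is the bidegree $(i,j)$ piece of the bigraded ideal $\mathcal{K}$. A syzygy $(a,b,c,e)\in\mathbb{K}[\underline{t}]^4$ of $(u_1,u_2,u_3,u_4)$ is identified with the form $aX_1+bX_2+cX_3+eX_4\in\mathcal{K}$. Since $\mathcal{I}$ is saturated, its syzygy module is a free graded $\mathbb{K}[\underline{t}]$-module of rank 3; a $\mu$-basis is a homogeneous $\mathbb{K}[\underline{t}]$-basis $p_1,p_2,p_3$ of it (regarded as forms linear in $\underline{X}$), whose $\underline{t}$-degrees $\mu_1,\mu_2,\mu_3$ satisfy $\mu_1+\mu_2+\mu_3=d$. "Local complete intersection in $\mathbb{P}^2$" means that at every point of $V(\mathcal{I})\subset\mathbb{P}^2$ the localization of $\mathcal{I}$ is generated by two elements (a regular sequence). Write $p_i=L_{i1}(\underline{X})t_1+L_{i2}(\underline{X})t_2+L_{i3}(\underline{X})t_3$ for $i=1,2$, with $L_{ij}$ linear forms over $\mathbb{K}$, and let $M_j(\underline{X})$ ($j=1,2,3$) be the signed maximal minors of the $2\times3$ matrix $(L_{ik})$: $M_1=L_{12}L_{23}-L_{13}L_{22}$, $M_2=L_{13}L_{21}-L_{11}L_{23}$, $M_3=L_{11}L_{22}-L_{12}L_{21}$. Construction of the $F_j$: set $F_{d-2}:=p_3\in\mathcal{K}_{d-2,1}$.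 For $j$ from $d-2$ down to $1$: write $F_j\in\mathcal{K}_{j,1+2(d-2-j)}$ as $F_j=A_jt_1+B_jt_2+C_jt_3$ with $A_j,B_j,C_j\in\mathbb{K}[\underline{t},\underline{X}]$ bihomogeneous of bidegree $(j-1,1+2(d-2-j))$ (any choice), and set $F_{j-1}:=A_jM_1(\underline{X})+B_jM_2(\underline{X})+C_jM_3(\underline{X})$. Then $F_j\in\mathcal{K}_{j,1+2(d-2-j)}$ for all $0\le j\le d-2$. A minimal set of generators is a generating set in which no element belongs to the ideal generated by the others. *)

theory Defs
  imports
    "HOL-Library.Poly_Mapping"
    "HOL-Library.Numeral_Type"
    "HOL-Computational_Algebra.Polynomial"
    "HOL-Computational_Algebra.Fraction_Field"
begin

section \<open>Polynomials\<close>

text \<open>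
  Multivariate polynomials are the monoid algebras provided by \<^theory>\<open>HOL-Library.Poly_Mapping\<close>.
  The bigraded ring \<open>K[t, X]\<close> is represented as \<open>K[t][X]\<close>, that is, as polynomials in the
  \<open>X\<^sub>i\<close> whose coefficients are polynomials in the \<open>t\<^sub>j\<close>. The variables are indexed by the
  types \<open>3\<close> and \<open>4\<close>, whose elements are \<open>1, 2, 3\<close> (with \<open>3 = 0\<close>) and \<open>1, 2, 3, 4\<close>
  (with \<open>4 = 0\<close>); only the names of the indices matter, not their arithmetic.
\<close>

type_synonym ('i, 'a) mpol = "('i \<Rightarrow>\<^sub>0 nat) \<Rightarrow>\<^sub>0 'a"
type_synonym 'k tpol = "(3, 'k) mpol"
type_synonym 'k txpol = "(4, 'k tpol) mpol"

definition Cst :: "'a::zero \<Rightarrow> ('i, 'a) mpol"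
  where "Cst c = Poly_Mapping.single 0 c"

definition Var :: "'i \<Rightarrow> ('i, 'a::zero_neq_one) mpol"
  where "Var i = Poly_Mapping.single (Poly_Mapping.single i 1) 1"

abbreviation tvar :: "3 \<Rightarrow> 'k::zero_neq_one txpol"
  where "tvar j \<equiv> Cst (Var j)"

abbreviation Xvar :: "4 \<Rightarrow> 'k::comm_ring_1 txpol"
  where "Xvar i \<equiv> Var i"

text \<open>Evaluation at \<open>v\<close>, with the coefficients mapped by \<open>\<phi>\<close>.\<close>

definition mpol_eval ::
    "('a::zero \<Rightarrow> 'b::comm_semiring_1) \<Rightarrow> ('i::finite \<Rightarrow> 'b) \<Rightarrow> ('i, 'a) mpol \<Rightarrow> 'b"
  where "mpol_eval \<phi> v f =
    (\<Sum>m\<in>Poly_Mapping.keys f. \<phi> (Poly_Mapping.lookup f m) *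
       (\<Prod>i\<in>UNIV. v i ^ Poly_Mapping.lookup m i))"

definition mon_degree :: "('i::finite \<Rightarrow>\<^sub>0 nat) \<Rightarrow> nat"
  where "mon_degree m = (\<Sum>i\<in>UNIV. Poly_Mapping.lookup m i)"

text \<open>The zero polynomial is homogeneous of every degree.\<close>

definition homogeneous :: "nat \<Rightarrow> ('i::finite, 'a::zero) mpol \<Rightarrow> bool"
  where "homogeneous n f \<longleftrightarrow> (\<forall>m\<in>Poly_Mapping.keys f. mon_degree m = n)"

text \<open>Bidegree \<open>(i, j)\<close>: degree \<open>i\<close> in the \<open>t\<close> variables and degree \<open>j\<close> in the \<open>X\<close> variables.\<close>

definition bihomogeneous :: "nat \<Rightarrow> nat \<Rightarrow> 'k::zero txpol \<Rightarrow> bool"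
  where "bihomogeneous i j f \<longleftrightarrow>
    homogeneous j f \<and> (\<forall>m. homogeneous i (Poly_Mapping.lookup f m))"


section \<open>Ideals\<close>

global_interpretation ideal: module "(*) :: 'a::comm_ring_1 \<Rightarrow> 'a \<Rightarrow> 'a"
  by unfold_locales (simp_all add: algebra_simps)

fun ideal_power :: "'a::comm_ring_1 set \<Rightarrow> nat \<Rightarrow> 'a set"
  where
    "ideal_power J 0 = UNIV"
  | "ideal_power J (Suc n) = ideal.span {a * b | a b. a \<in> J \<and> b \<in> ideal_power J n}"

text \<open>\<open>I\<close> equals the union over \<open>n\<close> of the ideal quotients \<open>I : J\<^sup>n\<close>.\<close>

definition saturated_wrt :: "'a::comm_ring_1 set \<Rightarrow> 'a set \<Rightarrow> bool"
  where "saturated_wrt J I \<longleftrightarrow> {f. \<exists>n. \<forall>g\<in>ideal_power J n. g * f \<in> I} = I"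

definition minimal_generators :: "'a::comm_ring_1 set \<Rightarrow> 'a set \<Rightarrow> bool"
  where "minimal_generators S I \<longleftrightarrow> ideal.span S = I \<and> (\<forall>s\<in>S. s \<notin> ideal.span (S - {s}))"


section \<open>Local complete intersections in the projective plane\<close>

text \<open>
  A point of the projective plane is given by homogeneous coordinates \<open>a \<noteq> 0\<close>. Its local ring
  is the ring of fractions of forms of equal degree whose denominator does not vanish at \<open>a\<close>;
  the localization of a homogeneous ideal at the point consists of those fractions whose
  numerator can be taken in the ideal.
\<close>

definition proj_zeros :: "'k::idom tpol set \<Rightarrow> (3 \<Rightarrow> 'k) set"
  where "proj_zeros I = {a. a \<noteq> (\<lambda>_. 0) \<and> (\<forall>f\<in>I. mpol_eval (\<lambda>c. c) a f = 0)}"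

definition ideal_at :: "'k::idom tpol set \<Rightarrow> (3 \<Rightarrow> 'k) \<Rightarrow> 'k tpol fract set"
  where "ideal_at I a =
    {Fract f g | f g n. f \<in> I \<and> homogeneous n f \<and> homogeneous n g \<and> mpol_eval (\<lambda>c. c) a g \<noteq> 0}"

abbreviation local_ring :: "(3 \<Rightarrow> 'k::idom) \<Rightarrow> 'k tpol fract set"
  where "local_ring a \<equiv> ideal_at UNIV a"

definition two_generated :: "'a::comm_ring_1 set \<Rightarrow> 'a \<Rightarrow> 'a \<Rightarrow> 'a set"
  where "two_generated R x y = {r * x + s * y | r s. r \<in> R \<and> s \<in> R}"

definition regular_pair :: "'a::comm_ring_1 set \<Rightarrow> 'a \<Rightarrow> 'a \<Rightarrow> bool"
  where "regular_pair R x y \<longleftrightarrow>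
    x \<in> R \<and> y \<in> R \<and>
    (\<forall>r\<in>R. r * x = 0 \<longrightarrow> r = 0) \<and>
    (\<forall>r\<in>R. (\<exists>s\<in>R. r * y = s * x) \<longrightarrow> (\<exists>s\<in>R. r = s * x)) \<and>
    two_generated R x y \<noteq> R"

definition local_complete_intersection :: "'k::idom tpol set \<Rightarrow> bool"
  where "local_complete_intersection I \<longleftrightarrow>
    (\<forall>a\<in>proj_zeros I. \<exists>x y. regular_pair (local_ring a) x y \<and>
       ideal_at I a = two_generated (local_ring a) x y)"


section \<open>Syzygies and the kernel\<close>

definition scale_t :: "'k::comm_ring_1 tpol \<Rightarrow> 'k txpol \<Rightarrow> 'k txpol"
  where "scale_t c f = Cst c * f"

global_interpretation tmod: module "scale_t :: 'k::comm_ring_1 tpol \<Rightarrow> _"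
proof
  show "scale_t a (x + y) = scale_t a x + scale_t a y" for a :: "'k tpol" and x y
    by (simp add: scale_t_def distrib_left)
  show "scale_t (a + b) x = scale_t a x + scale_t b x" for a b :: "'k tpol" and x
    by (simp add: scale_t_def Cst_def single_add distrib_right)
  show "scale_t a (scale_t b x) = scale_t (a * b) x" for a b :: "'k tpol" and x
    by (simp add: scale_t_def Cst_def mult_single flip: mult.assoc)
  show "scale_t 1 x = x" for x :: "'k txpol"
    by (simp add: scale_t_def Cst_def)
qed

text \<open>The syzygies \<open>(a\<^sub>1, \<dots>, a\<^sub>4)\<close> of \<open>u\<close>, as forms \<open>a\<^sub>1 X\<^sub>1 + \<dots> + a\<^sub>4 X\<^sub>4\<close>.\<close>

definition syzygies :: "(4 \<Rightarrow> 'k::comm_ring_1 tpol) \<Rightarrow> 'k txpol set"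
  where "syzygies u =
    {(\<Sum>i\<in>UNIV. scale_t (a i) (Xvar i)) | a. (\<Sum>i\<in>UNIV. a i * u i) = 0}"

text \<open>
  \<open>inj p\<close> makes linear independence of the set \<open>range p\<close> that of the family \<open>p\<close>.
\<close>

definition mu_basis ::
    "(4 \<Rightarrow> 'k::comm_ring_1 tpol) \<Rightarrow> (3 \<Rightarrow> 'k txpol) \<Rightarrow> (3 \<Rightarrow> nat) \<Rightarrow> bool"
  where "mu_basis u p \<mu> \<longleftrightarrow>
    (\<forall>i. bihomogeneous (\<mu> i) 1 (p i)) \<and>
    inj p \<and> tmod.independent (range p) \<and> tmod.span (range p) = syzygies u"

text \<open>The morphism of \<open>K[t]\<close>-algebras \<open>K[t, X] \<rightarrow> K[t][Z]\<close> mapping \<open>X\<^sub>i\<close> to \<open>u\<^sub>i Z\<close>.\<close>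

definition hmap :: "(4 \<Rightarrow> 'k::comm_ring_1 tpol) \<Rightarrow> 'k txpol \<Rightarrow> 'k tpol poly"
  where "hmap u = mpol_eval (\<lambda>c. [:c:]) (\<lambda>i. monom (u i) 1)"

definition rees_kernel :: "(4 \<Rightarrow> 'k::comm_ring_1 tpol) \<Rightarrow> 'k txpol set"
  where "rees_kernel u = {f. hmap u f = 0}"


section \<open>The forms \<open>F\<^sub>j\<close>\<close>

text \<open>The signed maximal minors of the matrix with rows \<open>L1\<close> and \<open>L2\<close>.\<close>

definition signed_minor :: "(3 \<Rightarrow> 'a::comm_ring_1) \<Rightarrow> (3 \<Rightarrow> 'a) \<Rightarrow> 3 \<Rightarrow> 'a"
  where "signed_minor L1 L2 j =
    (if j = 1 then L1 2 * L2 3 - L1 3 * L2 2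
     else if j = 2 then L1 3 * L2 1 - L1 1 * L2 3
     else L1 1 * L2 2 - L1 2 * L2 1)"

text \<open>
  \<open>F\<close> restricted to \<open>{0..d-2}\<close> is a possible outcome of the recursive construction: the
  decomposition of each \<open>F j\<close> is an arbitrary choice. The other values of \<open>F\<close> are irrelevant.
\<close>

definition F_construction ::
    "nat \<Rightarrow> 'k::comm_ring_1 txpol \<Rightarrow> (3 \<Rightarrow> 'k txpol) \<Rightarrow> (nat \<Rightarrow> 'k txpol) \<Rightarrow> bool"
  where "F_construction d p3 M F \<longleftrightarrow>
    F (d - 2) = p3 \<and>
    (\<forall>j\<in>{1..d - 2}. \<exists>A B C.
       bihomogeneous (j - 1) (1 + 2 * (d - 2 - j)) A \<and>
       bihomogeneous (j - 1) (1 + 2 * (d - 2 - j)) B \<and>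
       bihomogeneous (j - 1) (1 + 2 * (d - 2 - j)) C \<and>
       F j = A * tvar 1 + B * tvar 2 + C * tvar 3 \<and>
       F (j - 1) = A * M 1 + B * M 2 + C * M 3)"

end

theory Submission
  imports Defs "HOL-Analysis.Determinants"
begin

text \<open>
  Let \<open>J = (p\<^sub>1, p\<^sub>2)\<close> and \<open>M\<close> the vector of minors. Since \<open>p\<^sub>1 = p\<^sub>2 = 0\<close> forces \<open>t\<close> to be
  proportional to \<open>M\<close>, one has \<open>t\<^sub>k F\<^sub>j \<equiv> M\<^sub>k F\<^bsub>j+1\<^esub>\<close> modulo \<open>J\<close>, so all \<open>F\<^sub>j\<close> lie in the kernel.

  Conversely, the local complete intersection hypothesis makes the kernel locally generated by
  syzygies: where \<open>\<I> = (x, y)\<close> with \<open>x, y\<close> regular, the only relation between \<open>x Z\<close> and \<open>y Z\<close> is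
  the Koszul one. By the Nullstellensatz each element \<open>h\<close> of the kernel is multiplied into
  \<open>(p\<^sub>1, p\<^sub>2, p\<^sub>3)\<close> by a power of \<open>(t\<^sub>1, t\<^sub>2, t\<^sub>3)\<close>. Peeling off one factor \<open>t\<^sub>k\<close> at a time, write
  \<open>t\<^sub>k h \<equiv> c\<^sub>k F\<^sub>m\<close> modulo \<open>J\<close>. As \<open>J\<close> is prime, \<open>t\<^sub>j c\<^sub>k \<equiv> t\<^sub>k c\<^sub>j\<close>, and the Koszul complex of \<open>t\<close> yields
  \<open>c\<^sub>k \<equiv> f M\<^sub>k + e t\<^sub>k\<close> with \<open>f\<close> free of \<open>t\<close>, whence \<open>h \<equiv> f F\<^bsub>m-1\<^esub> + e F\<^sub>m\<close>.

  Primality of \<open>J\<close> comes from solving \<open>p\<^sub>1 = p\<^sub>2 = 0\<close> for two of the \<open>X\<^sub>i\<close>: this is possible after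
  inverting a \<open>2 \<times> 2\<close> minor \<open>\<Delta>\<close> of the coefficients, and \<open>\<Delta>\<close> is a nonzerodivisor modulo \<open>J\<close> because
  the minors have grade at least two and the coefficients of \<open>p\<^sub>1, p\<^sub>2\<close> have no common zero in the plane.
\<close>

text \<open>
  As a simplification rule, this consequence of the interpretation \<open>ideal\<close> is
  \<open>a * (b * x) = a * b * x\<close>, which loops together with \<open>mult.assoc\<close>.
\<close>

declare ideal.scale_scale [simp del]

section \<open>Ring homomorphisms and polynomial rings\<close>

text \<open>The kernel is the saturation of (p_1, p_2, p_3) with respect to the t_k, and modulo J
  only p_3 is left to saturate. The F_j are what this saturation produces: up to the multiples of t,
  the vectors proportional to t modulo J are the multiples of M by polynomials free of t. So
  dividing by a t_k costs one factor M, that is, one degree in t is traded for two in X. Hence the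
  bidegrees (j, 1 + 2 (d - 2 - j)), no two of which are comparable; this is what makes the F_j
  irredundant.

  Neither quotient rings nor localizations are formed. Congruences modulo an ideal, and
  multiplication by a polynomial that does not vanish at a given point, take their place. Solving a
  linear equation for X_i needs a denominator l; it becomes a polynomial substitution that agrees
  modulo the ideal with scaling all X variables by l, and homogeneity turns the scaling into a power
  of l.\<close>

definition rhom :: "('a::comm_ring_1 \<Rightarrow> 'b::comm_ring_1) \<Rightarrow> bool"
  where "rhom f \<longleftrightarrow> f 1 = 1 \<and> (\<forall>a b. f (a + b) = f a + f b) \<and> (\<forall>a b. f (a * b) = f a * f b)"

lemma rhomI:
  assumes "f 1 = 1" "\<And>a b. f (a + b) = f a + f b" "\<And>a b. f (a * b) = f a * f b"
  shows "rhom f"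
  using assms by (simp add: rhom_def)

lemma rhom_one: "rhom f \<Longrightarrow> f 1 = 1"
  and rhom_add: "rhom f \<Longrightarrow> f (a + b) = f a + f b"
  and rhom_mult: "rhom f \<Longrightarrow> f (a * b) = f a * f b"
  by (simp_all add: rhom_def)

lemma rhom_zero: "rhom f \<Longrightarrow> f 0 = 0"
  using rhom_add[of f 0 0] by simp

lemma rhom_uminus: "rhom f \<Longrightarrow> f (- a) = - f a"
  using rhom_add[of f a "- a"] rhom_zero[of f] by (simp add: eq_neg_iff_add_eq_0 add.commute)

lemma rhom_diff: "rhom f \<Longrightarrow> f (a - b) = f a - f b"
  using rhom_add[of f a "- b"] by (simp add: rhom_uminus)

lemma rhom_power: "rhom f \<Longrightarrow> f (a ^ n) = f a ^ n"
  by (induction n) (simp_all add: rhom_one rhom_mult)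

lemma rhom_sum: "rhom f \<Longrightarrow> f (sum g A) = (\<Sum>x\<in>A. f (g x))"
  by (induction A rule: infinite_finite_induct) (simp_all add: rhom_zero rhom_add)

lemma rhom_prod: "rhom f \<Longrightarrow> f (prod g A) = (\<Prod>x\<in>A. f (g x))"
  by (induction A rule: infinite_finite_induct) (simp_all add: rhom_one rhom_mult)

lemmas rhom_simps = rhom_one rhom_add rhom_mult rhom_zero rhom_uminus rhom_diff rhom_power
  rhom_sum rhom_prod

lemma rhom_comp: "rhom f \<Longrightarrow> rhom g \<Longrightarrow> rhom (\<lambda>x. g (f x))"
  by (simp add: rhom_def)

lemma rhom_id: "rhom (\<lambda>x. x)"
  by (simp add: rhom_def)

lemma rhom_poly: "rhom (\<lambda>p. poly p x)"
  by (simp add: rhom_def)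

lemma rhom_const_poly: "rhom (\<lambda>c. [:c:])"
  by (simp add: rhom_def one_pCons)

lemma rhom_map_poly:
  assumes "rhom f"
  shows "rhom (map_poly f)"
proof (rule rhomI)
  have f0: "f 0 = 0" using assms by (rule rhom_zero)
  show "map_poly f 1 = 1" by (simp add: rhom_one[OF assms])
  show add: "map_poly f (p + q) = map_poly f p + map_poly f q" for p q
    by (rule poly_eqI) (simp add: coeff_map_poly f0 rhom_add[OF assms])
  have smult: "map_poly f (smult c q) = smult (f c) (map_poly f q)" for c q
    by (rule poly_eqI) (simp add: coeff_map_poly f0 rhom_mult[OF assms])
  have shift: "map_poly f (pCons 0 q) = pCons 0 (map_poly f q)" for q
    by (rule poly_eqI) (simp add: coeff_map_poly f0 coeff_pCons split: nat.split)
  have pc: "map_poly f (pCons a q) = pCons (f a) (map_poly f q)" for a q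
    by (rule poly_eqI) (simp add: coeff_map_poly f0 coeff_pCons split: nat.split)
  show "map_poly f (p * q) = map_poly f p * map_poly f q" for p q
    by (induction p) (simp_all add: add smult shift pc f0)
qed

lemma map_poly_const: "rhom f \<Longrightarrow> map_poly f [:c:] = [:f c:]"
  by (rule poly_eqI) (simp add: coeff_map_poly rhom_zero coeff_pCons split: nat.split)

lemma map_poly_X: "rhom f \<Longrightarrow> map_poly f [:0, 1:] = [:0, 1:]"
  by (rule poly_eqI) (simp add: coeff_map_poly rhom_zero rhom_one coeff_pCons split: nat.split)

lemma map_poly_monom: "rhom f \<Longrightarrow> map_poly f (monom c n) = monom (f c) n"
  by (rule poly_eqI) (simp add: coeff_map_poly rhom_zero)

section \<open>Constants, variables, evaluation and substitution\<close>

lemma rhom_Cst: "rhom (Cst :: 'a::comm_ring_1 \<Rightarrow> ('i, 'a) mpol)"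
  by (simp add: rhom_def Cst_def single_add mult_single)

lemmas Cst_simps = rhom_simps[OF rhom_Cst]

lemma lookup_Cst_mult: "Poly_Mapping.lookup (Cst c * f) m = c * Poly_Mapping.lookup f m"
  for c :: "'a::comm_ring_1"
  by (simp add: Cst_def mult_map_scale_conv_mult[symmetric] Poly_Mapping.map.rep_eq when_def)

lemma Cst_eq_0_iff [simp]: "Cst a = 0 \<longleftrightarrow> a = 0"
  by (metis Cst_def lookup_single_eq lookup_zero single_zero)

lemma mpol_as_sum:
  fixes f :: "('i, 'a::comm_ring_1) mpol"
  shows "f = (\<Sum>m\<in>Poly_Mapping.keys f. Poly_Mapping.single m (Poly_Mapping.lookup f m))"
proof (rule poly_mapping_eqI)
  fix k
  have "(\<Sum>m\<in>Poly_Mapping.keys f. Poly_Mapping.lookup (Poly_Mapping.single m (Poly_Mapping.lookup f m)) k)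
      = (\<Sum>m\<in>Poly_Mapping.keys f. if m = k then Poly_Mapping.lookup f m else 0)"
    by (rule sum.cong) (auto simp: lookup_single when_def)
  also have "\<dots> = Poly_Mapping.lookup f k"
    by (auto simp: not_in_keys_iff_lookup_eq_zero)
  finally show "Poly_Mapping.lookup f k =
    Poly_Mapping.lookup (\<Sum>m\<in>Poly_Mapping.keys f. Poly_Mapping.single m (Poly_Mapping.lookup f m)) k"
    by (simp add: lookup_sum)
qed

text \<open>Zero needs no case of its own, being a monomial with coefficient 0.\<close>

lemma mpol_additive_induct [case_names single add]:
  fixes f :: "('i, 'a::comm_ring_1) mpol"
  assumes single: "\<And>m c. P (Poly_Mapping.single m c)"
    and add: "\<And>f g. P f \<Longrightarrow> P g \<Longrightarrow> P (f + g)"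
  shows "P f"
proof -
  have "P (\<Sum>m\<in>A. Poly_Mapping.single m (Poly_Mapping.lookup f m))" for A
  proof (induction A rule: infinite_finite_induct)
    case (infinite A)
    then show ?case using single[of undefined 0] by simp
  next
    case empty
    then show ?case using single[of undefined 0] by simp
  next
    case (insert x F)
    then show ?case by (simp add: single add)
  qed
  then show ?thesis by (subst mpol_as_sum)
qed

lemma Var_power: "Var i ^ n = (Poly_Mapping.single (Poly_Mapping.single i n) 1 :: ('i, 'a::comm_ring_1) mpol)"
  by (induction n) (simp_all add: Var_def mult_single single_add[symmetric])

lemma single_as_prod:
  fixes m :: "'i::finite \<Rightarrow>\<^sub>0 nat" and c :: "'a::comm_ring_1"
  shows "Poly_Mapping.single m c = Cst c * (\<Prod>i\<in>UNIV. Var i ^ Poly_Mapping.lookup m i)"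
proof -
  have "(\<Prod>i\<in>A. Var i ^ Poly_Mapping.lookup m i) =
      (Poly_Mapping.single (\<Sum>i\<in>A. Poly_Mapping.single i (Poly_Mapping.lookup m i)) 1 :: ('i, 'a) mpol)"
    if "finite A" for A
    using that by (induction A) (simp_all add: Var_power mult_single)
  moreover have "(\<Sum>i\<in>UNIV. Poly_Mapping.single i (Poly_Mapping.lookup m i)) = m"
    by (rule poly_mapping_eqI) (simp add: lookup_sum lookup_single when_def)
  ultimately show ?thesis
    by (simp add: Cst_def mult_single)
qed

lemma mpol_induct [case_names Cst Var add mult]:
  fixes f :: "('i::finite, 'a::comm_ring_1) mpol"
  assumes C: "\<And>c. P (Cst c)" and V: "\<And>i. P (Var i)"
    and add: "\<And>f g. P f \<Longrightarrow> P g \<Longrightarrow> P (f + g)"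
    and mult: "\<And>f g. P f \<Longrightarrow> P g \<Longrightarrow> P (f * g)"
  shows "P f"
proof (induction f rule: mpol_additive_induct)
  case (single m c)
  have one: "P 1" using C[of 1] by (simp add: Cst_simps)
  have pow: "P (Var i ^ n)" for i n
    by (induction n) (simp_all add: one mult V)
  have "P (\<Prod>i\<in>A. Var i ^ Poly_Mapping.lookup m i)" if "finite A" for A
    using that by induction (simp_all add: one mult pow)
  then show ?case by (simp add: single_as_prod mult C)
qed (rule add)

lemma rhom_eq:
  fixes f g :: "('i::finite, 'a::comm_ring_1) mpol \<Rightarrow> 'b::comm_ring_1"
  assumes "rhom f" "rhom g" "\<And>c. f (Cst c) = g (Cst c)" "\<And>i. f (Var i) = g (Var i)"
  shows "f x = g x"
  by (induction x rule: mpol_induct) (simp_all add: assms rhom_simps)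

lemma subspace_mult_right: "ideal.subspace Q \<Longrightarrow> x \<in> Q \<Longrightarrow> x * c \<in> Q"
  using ideal.subspace_scale[of Q x c] by (simp add: mult.commute)

text \<open>Stands in for comparing two homomorphisms into the quotient by \<open>Q\<close> on
  generators. The substitution arguments below rest on it.\<close>

lemma rhom_cong_mod:
  fixes f g :: "('i::finite, 'a::comm_ring_1) mpol \<Rightarrow> 'b::comm_ring_1"
  assumes Q: "ideal.subspace Q" and f: "rhom f" and g: "rhom g"
    and "\<And>c. f (Cst c) - g (Cst c) \<in> Q" "\<And>i. f (Var i) - g (Var i) \<in> Q"
  shows "f x - g x \<in> Q"
proof (induction x rule: mpol_induct)
  case (add x y)
  have "f (x + y) - g (x + y) = (f x - g x) + (f y - g y)"
    by (simp add: rhom_add f g)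
  then show ?case using add ideal.subspace_add[OF Q] by metis
next
  case (mult x y)
  have "f (x * y) - g (x * y) = f x * (f y - g y) + g y * (f x - g x)"
    by (simp add: rhom_mult f g algebra_simps)
  then show ?case using mult ideal.subspace_add[OF Q] ideal.subspace_scale[OF Q] by metis
qed (use assms in auto)

lemma mpol_eval_single: "\<phi> 0 = 0 \<Longrightarrow> mpol_eval \<phi> v (Poly_Mapping.single m c) =
    \<phi> c * (\<Prod>i\<in>UNIV. v i ^ Poly_Mapping.lookup m i)"
  by (auto simp: mpol_eval_def)

text \<open>Additivity reduces multiplicativity to monomials, where it is the addition of
  exponents.\<close>

lemma rhom_mpol_eval:
  fixes \<phi> :: "'a::comm_ring_1 \<Rightarrow> 'b::comm_ring_1" and v :: "'i::finite \<Rightarrow> 'b"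
  assumes "rhom \<phi>"
  shows "rhom (mpol_eval \<phi> v)"
proof (rule rhomI)
  have 0: "\<phi> 0 = 0" using assms by (rule rhom_zero)
  show "mpol_eval \<phi> v 1 = 1"
    by (simp add: mpol_eval_def rhom_one[OF assms])
  show add: "mpol_eval \<phi> v (f + g) = mpol_eval \<phi> v f + mpol_eval \<phi> v g" for f g
  proof -
    have "\<phi> (p + q) * c = \<phi> p * c + \<phi> q * c" for p q c
      by (simp add: rhom_add[OF assms] distrib_right)
    then show ?thesis
      using setsum_keys_plus_distrib[of "\<lambda>m c. \<phi> c * (\<Prod>i\<in>UNIV. v i ^ Poly_Mapping.lookup m i)" f g]
      by (simp only: mpol_eval_def 0 mult_zero_left simp_thms)
  qed
  have single: "mpol_eval \<phi> v (Poly_Mapping.single m c * Poly_Mapping.single m' c') =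
      mpol_eval \<phi> v (Poly_Mapping.single m c) * mpol_eval \<phi> v (Poly_Mapping.single m' c')" for m m' c c'
    unfolding mult_single mpol_eval_single[of \<phi>, OF 0] rhom_mult[OF assms] lookup_add power_add prod.distrib
    by (simp only: mult_ac)
  have "mpol_eval \<phi> v (Poly_Mapping.single m c * g) =
      mpol_eval \<phi> v (Poly_Mapping.single m c) * mpol_eval \<phi> v g" for m c g
    by (induction g rule: mpol_additive_induct) (simp_all only: single distrib_left add)
  then show "mpol_eval \<phi> v (f * g) = mpol_eval \<phi> v f * mpol_eval \<phi> v g" for f g
    by (induction f rule: mpol_additive_induct) (simp_all only: distrib_right add)
qed

lemma mpol_eval_Cst: "\<phi> 0 = 0 \<Longrightarrow> mpol_eval \<phi> v (Cst c) = \<phi> c"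
  by (simp add: Cst_def mpol_eval_single)

lemma mpol_eval_Var:
  fixes \<phi> :: "'a::comm_ring_1 \<Rightarrow> 'b::comm_ring_1"
  assumes "rhom \<phi>"
  shows "mpol_eval \<phi> v (Var i) = v i"
proof -
  have "(\<Prod>j\<in>UNIV. v j ^ (1 when i = j)) = (\<Prod>j\<in>UNIV. if j = i then v j else 1)"
    by (rule prod.cong) (auto simp: when_def)
  then show ?thesis
    by (simp add: Var_def mpol_eval_single rhom_zero[OF assms] rhom_one[OF assms] lookup_single)
qed

abbreviation ev :: "('i::finite \<Rightarrow> 'k::comm_ring_1) \<Rightarrow> ('i, 'k) mpol \<Rightarrow> 'k"
  where "ev \<equiv> mpol_eval (\<lambda>c. c)"

lemma rhom_ev: "rhom (ev a)"
  by (rule rhom_mpol_eval[OF rhom_id])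

lemmas ev_simps = rhom_simps[OF rhom_ev] mpol_eval_Var[OF rhom_id]

lemma ev_Cst [simp]: "ev a (Cst c) = c"
  by (simp add: mpol_eval_Cst)

abbreviation subst :: "('i::finite \<Rightarrow> ('i, 'a) mpol) \<Rightarrow> ('i, 'a) mpol \<Rightarrow> ('i, 'a::comm_ring_1) mpol"
  where "subst \<equiv> mpol_eval Cst"

lemma rhom_subst: "rhom (subst s)"
  by (rule rhom_mpol_eval[OF rhom_Cst])

lemmas subst_simps = rhom_simps[OF rhom_subst] mpol_eval_Var[OF rhom_Cst]

lemma subst_Cst [simp]: "subst s (Cst c) = Cst c"
  by (simp add: mpol_eval_Cst Cst_simps)

section \<open>Gradings\<close>

text \<open>
  A grading is encoded by the ring homomorphism sending each homogeneous element \<open>f\<close> of degree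
  \<open>n\<close> to \<open>f s\<^sup>n\<close>; the homogeneous components are the coefficients of its values.
\<close>

locale grading =
  fixes \<sigma> :: "'a::comm_ring_1 \<Rightarrow> 'a poly"
  assumes rhom_\<sigma>: "rhom \<sigma>"
    and poly_\<sigma>_1: "poly (\<sigma> f) 1 = f"
    and \<sigma>_coeff: "\<sigma> (coeff (\<sigma> f) n) = monom (coeff (\<sigma> f) n) n"
begin

definition homog :: "nat \<Rightarrow> 'a \<Rightarrow> bool"
  where "homog n f \<longleftrightarrow> \<sigma> f = monom f n"

definition cmp :: "nat \<Rightarrow> 'a \<Rightarrow> 'a"
  where "cmp n f = coeff (\<sigma> f) n"

lemmas \<sigma>_simps = rhom_simps[OF rhom_\<sigma>]

lemma cmp_add: "cmp n (f + g) = cmp n f + cmp n g"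
  by (simp add: cmp_def \<sigma>_simps)

lemma cmp_diff: "cmp n (f - g) = cmp n f - cmp n g"
  by (simp add: cmp_def \<sigma>_simps)

lemma cmp_0 [simp]: "cmp n 0 = 0"
  by (simp add: cmp_def \<sigma>_simps)

lemma cmp_sum: "cmp n (sum f A) = (\<Sum>x\<in>A. cmp n (f x))"
  by (simp add: cmp_def \<sigma>_simps coeff_sum)

lemma homog_cmp: "homog n (cmp n f)"
  by (simp add: homog_def cmp_def \<sigma>_coeff)

lemma cmp_homog: "homog n f \<Longrightarrow> cmp m f = (if m = n then f else 0)"
  by (auto simp: homog_def cmp_def)

lemma cmp_self: "homog n f \<Longrightarrow> cmp n f = f"
  by (simp add: cmp_homog)

lemma cmp_homog_mult: "homog m f \<Longrightarrow> cmp n (f * g) = (if m \<le> n then f * cmp (n - m) g else 0)"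
  by (simp add: homog_def cmp_def \<sigma>_simps coeff_monom_mult)

lemma homog_0 [simp]: "homog n 0"
  by (simp add: homog_def \<sigma>_simps)

lemma homog_1: "homog 0 1"
  by (simp add: homog_def \<sigma>_simps monom_0 one_pCons)

lemma homog_add: "homog n f \<Longrightarrow> homog n g \<Longrightarrow> homog n (f + g)"
  by (simp add: homog_def \<sigma>_simps add_monom)

lemma homog_diff: "homog n f \<Longrightarrow> homog n g \<Longrightarrow> homog n (f - g)"
  by (simp add: homog_def \<sigma>_simps diff_monom)

lemma homog_sum: "(\<And>x. x \<in> A \<Longrightarrow> homog n (f x)) \<Longrightarrow> homog n (sum f A)"
  by (induction A rule: infinite_finite_induct) (simp_all add: homog_add)

lemma homog_mult: "homog n f \<Longrightarrow> homog m g \<Longrightarrow> homog (n + m) (f * g)"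
  by (simp add: homog_def \<sigma>_simps mult_monom)

lemma homog_power: "homog n f \<Longrightarrow> homog (n * k) (f ^ k)"
  by (induction k) (use homog_mult homog_1 in force)+

lemma homog_prod: "finite A \<Longrightarrow> (\<And>x. x \<in> A \<Longrightarrow> homog (n x) (f x)) \<Longrightarrow> homog (sum n A) (prod f A)"
  by (induction A rule: finite_induct) (simp_all add: homog_1 homog_mult)

lemma cmp_eventually_0: "degree (\<sigma> f) < n \<Longrightarrow> cmp n f = 0"
  by (simp add: cmp_def coeff_eq_0)

lemma sum_cmp: "degree (\<sigma> f) \<le> N \<Longrightarrow> (\<Sum>n\<le>N. cmp n f) = f"
proof -
  assume N: "degree (\<sigma> f) \<le> N"
  have "f = poly (\<sigma> f) 1" by (simp add: poly_\<sigma>_1)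
  also have "\<dots> = (\<Sum>n\<le>degree (\<sigma> f). cmp n f)" by (simp add: poly_altdef cmp_def)
  also have "\<dots> = (\<Sum>n\<le>N. cmp n f)"
    by (rule sum.mono_neutral_left) (use N cmp_eventually_0 in auto)
  finally show ?thesis by simp
qed

definition graded :: "'a set \<Rightarrow> bool"
  where "graded Q \<longleftrightarrow> ideal.subspace Q \<and> (\<forall>f\<in>Q. \<forall>n. cmp n f \<in> Q)"

text \<open>Multiplication by a generator of degree \<open>m\<close> shifts components by
  \<open>m\<close>, so the components of a combination of homogeneous generators are again such
  combinations.\<close>

lemma graded_span:
  assumes "\<And>s. s \<in> B \<Longrightarrow> \<exists>n. homog n s"
  shows "graded (ideal.span B)"
proof -
  have "cmp n f \<in> ideal.span B" if "f \<in> ideal.span B" for f n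
    using that
  proof (induction f rule: ideal.span_induct_alt)
    case (step c x y)
    obtain m where m: "homog m x" using assms step by blast
    have "cmp n (c * x + y) = (if m \<le> n then cmp (n - m) c * x else 0) + cmp n y"
      using cmp_homog_mult[OF m, of n c] by (simp add: cmp_add mult.commute)
    also have "\<dots> \<in> ideal.span B"
      using step by (intro ideal.span_add) (auto intro: ideal.span_scale ideal.span_base ideal.span_zero)
    finally show ?case .
  qed (simp add: ideal.span_zero)
  then show ?thesis by (simp add: graded_def)
qed

lemma graded_subspace: "graded Q \<Longrightarrow> ideal.subspace Q"
  by (simp add: graded_def)

lemma graded_cmp: "graded Q \<Longrightarrow> f \<in> Q \<Longrightarrow> cmp n f \<in> Q"
  by (simp add: graded_def)

lemma gradedI_cmp:
  assumes "ideal.subspace Q" "\<And>n. cmp n f \<in> Q"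
  shows "f \<in> Q"
proof -
  have "(\<Sum>n\<le>degree (\<sigma> f). cmp n f) \<in> Q"
    using assms by (intro ideal.subspace_sum) auto
  then show ?thesis by (simp add: sum_cmp)
qed

end

text \<open>Since the last axiom of a grading passes to sums and products, it only has to be checked
  on constants and variables.\<close>

lemma rhom_grading_closed:
  fixes \<sigma> :: "'a::comm_ring_1 \<Rightarrow> 'a poly"
  assumes \<sigma>: "rhom \<sigma>"
    and f: "\<And>n. \<sigma> (coeff (\<sigma> f) n) = monom (coeff (\<sigma> f) n) n"
    and g: "\<And>n. \<sigma> (coeff (\<sigma> g) n) = monom (coeff (\<sigma> g) n) n"
  shows "\<sigma> (coeff (\<sigma> (f + g)) n) = monom (coeff (\<sigma> (f + g)) n) n"
    and "\<sigma> (coeff (\<sigma> (f * g)) n) = monom (coeff (\<sigma> (f * g)) n) n"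
proof -
  show "\<sigma> (coeff (\<sigma> (f + g)) n) = monom (coeff (\<sigma> (f + g)) n) n"
    by (simp add: rhom_simps[OF \<sigma>] f g add_monom)
  have "\<sigma> (coeff (\<sigma> (f * g)) n) = (\<Sum>i\<le>n. monom (coeff (\<sigma> f) i * coeff (\<sigma> g) (n - i)) n)"
    by (simp add: rhom_simps[OF \<sigma>] coeff_mult f g mult_monom)
  also have "\<dots> = monom (coeff (\<sigma> (f * g)) n) n"
    by (simp add: rhom_simps[OF \<sigma>] coeff_mult monom_sum)
  finally show "\<sigma> (coeff (\<sigma> (f * g)) n) = monom (coeff (\<sigma> (f * g)) n) n" .
qed

section \<open>The grading of a polynomial ring by degree, and of K[t, X] by degree in t\<close>

definition gr :: "('i::finite, 'a::comm_ring_1) mpol \<Rightarrow> ('i, 'a) mpol poly"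
  where "gr = mpol_eval (\<lambda>c. [:Cst c:]) (\<lambda>i. monom (Var i) 1)"

text \<open>The coefficients carry the grading and the X variables have degree 0;
  \<open>map_poly Cst\<close> moves the components of a coefficient into the larger ring.\<close>

definition grt :: "'k::comm_ring_1 txpol \<Rightarrow> 'k txpol poly"
  where "grt = mpol_eval (\<lambda>c. map_poly Cst (gr c)) (\<lambda>i. [:Var i:])"

lemma rhom_gr: "rhom gr"
  unfolding gr_def by (intro rhom_mpol_eval rhom_comp[OF rhom_Cst rhom_const_poly])

lemma gr_Cst: "gr (Cst c) = [:Cst c:]"
  by (simp add: gr_def mpol_eval_Cst Cst_simps)

lemma gr_Var: "gr (Var i) = monom (Var i) 1"
  unfolding gr_def by (intro mpol_eval_Var rhom_comp[OF rhom_Cst rhom_const_poly])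

lemma rhom_grt_coeff: "rhom (\<lambda>c. map_poly Cst (gr c) :: 'k::comm_ring_1 txpol poly)"
  by (rule rhom_comp[OF rhom_gr rhom_map_poly[OF rhom_Cst]])

lemma rhom_grt: "rhom grt"
  unfolding grt_def by (rule rhom_mpol_eval[OF rhom_grt_coeff])

lemma grt_Cst: "grt (Cst c) = map_poly Cst (gr c)"
  by (simp add: grt_def mpol_eval_Cst rhom_zero[OF rhom_grt_coeff])

lemma grt_Var: "grt (Var i) = [:Var i:]"
  unfolding grt_def by (rule mpol_eval_Var[OF rhom_grt_coeff])

global_interpretation X: grading "gr :: ('i::finite, 'a::comm_ring_1) mpol \<Rightarrow> _"
proof
  show "rhom (gr :: ('i, 'a) mpol \<Rightarrow> _)" by (rule rhom_gr)
  show "poly (gr f) 1 = f" for f :: "('i, 'a) mpol"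
    by (rule rhom_eq[OF rhom_comp[OF rhom_gr rhom_poly] rhom_id]) (simp_all add: gr_Cst gr_Var poly_monom)
  show "gr (coeff (gr f) n) = monom (coeff (gr f) n) n" for f :: "('i, 'a) mpol" and n
  proof (induction f arbitrary: n rule: mpol_induct)
    case (Cst c)
    show ?case by (cases n) (simp_all add: gr_Cst coeff_pCons rhom_zero[OF rhom_gr] monom_0)
  next
    case (Var i)
    show ?case by (simp add: gr_Var rhom_zero[OF rhom_gr])
  qed (use rhom_grading_closed[OF rhom_gr] in blast)+
qed

global_interpretation T: grading "grt :: 'k::comm_ring_1 txpol \<Rightarrow> _"
proof
  show "rhom (grt :: 'k txpol \<Rightarrow> _)" by (rule rhom_grt)
  have 1: "poly (grt (Cst c)) 1 = Cst c" for c :: "'k tpol"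
    by (rule rhom_eq[OF rhom_comp[OF rhom_comp[OF rhom_Cst rhom_grt] rhom_poly] rhom_Cst])
      (simp_all add: grt_Cst gr_Cst gr_Var poly_monom map_poly_const map_poly_monom rhom_Cst)
  show "poly (grt f) 1 = f" for f :: "'k txpol"
    by (rule rhom_eq[OF rhom_comp[OF rhom_grt rhom_poly] rhom_id]) (simp_all add: 1 grt_Var)
  have C: "grt (coeff (grt (Cst c)) n) = monom (coeff (grt (Cst c)) n) n" for c :: "'k tpol" and n
    by (simp add: grt_Cst coeff_map_poly Cst_simps X.\<sigma>_coeff map_poly_monom rhom_Cst)
  show "grt (coeff (grt f) n) = monom (coeff (grt f) n) n" for f :: "'k txpol" and n
  proof (induction f arbitrary: n rule: mpol_induct)
    case (Cst c)
    show ?case by (rule C)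
  next
    case (Var i)
    show ?case by (cases n) (simp_all add: grt_Var coeff_pCons rhom_zero[OF rhom_grt] monom_0)
  qed (use rhom_grading_closed[OF rhom_grt] in blast)+
qed

lemma prod_monom:
  "(\<Prod>i\<in>A. monom (a i) (n i)) = (monom (\<Prod>i\<in>A. a i) (\<Sum>i\<in>A. n i) :: 'a::comm_ring_1 poly)"
  by (induction A rule: infinite_finite_induct) (simp_all add: mult_monom monom_0 one_pCons)

lemma gr_single: "gr (Poly_Mapping.single m c) = monom (Poly_Mapping.single m c) (mon_degree m)"
proof -
  have "gr (Poly_Mapping.single m c) =
      [:Cst c:] * (\<Prod>i\<in>UNIV. monom (Var i ^ Poly_Mapping.lookup m i) (Poly_Mapping.lookup m i))"
    by (simp add: single_as_prod X.\<sigma>_simps gr_Cst gr_Var monom_power)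
  also have "\<dots> = monom (Poly_Mapping.single m c) (mon_degree m)"
    by (simp add: prod_monom single_as_prod mon_degree_def smult_monom)
  finally show ?thesis .
qed

text \<open>Links the abstract components to monomial degrees, and so \<open>X.homog\<close> to the
  \<open>homogeneous\<close> of the statement.\<close>

lemma lookup_cmp:
  "Poly_Mapping.lookup (X.cmp n f) m = (if mon_degree m = n then Poly_Mapping.lookup f m else 0)"
proof (induction f rule: mpol_additive_induct)
  case (single m' c)
  show ?case by (auto simp: X.cmp_def gr_single lookup_single when_def)
qed (simp add: X.cmp_add lookup_add)

lemma homogeneous_iff: "homogeneous n f \<longleftrightarrow> X.homog n f"
proof
  assume "homogeneous n f"
  then have *: "mon_degree m = n" if "Poly_Mapping.lookup f m \<noteq> 0" for m
    using that by (simp add: homogeneous_def in_keys_iff)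
  have "X.cmp n f = f"
    by (rule poly_mapping_eqI) (auto simp: lookup_cmp dest: *)
  then show "X.homog n f" using X.homog_cmp by metis
next
  assume "X.homog n f"
  then have "X.cmp n f = f" by (simp add: X.cmp_homog)
  then show "homogeneous n f"
    by (metis homogeneous_def in_keys_iff lookup_cmp)
qed

lemma lookup_cmp_t:
  fixes f :: "'k::comm_ring_1 txpol"
  shows "Poly_Mapping.lookup (T.cmp n f) m = X.cmp n (Poly_Mapping.lookup f m)"
proof (induction f rule: mpol_additive_induct)
  case (single m' c)
  have "(\<Prod>i\<in>UNIV. [:Var i:] ^ Poly_Mapping.lookup m' i) =
      [:\<Prod>i\<in>UNIV. Var i ^ Poly_Mapping.lookup m' i :: 'k txpol:]"
    by (simp only: rhom_prod[OF rhom_const_poly] rhom_power[OF rhom_const_poly])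
  then have "grt (Poly_Mapping.single m' c) =
      map_poly Cst (gr c) * [:\<Prod>i\<in>UNIV. Var i ^ Poly_Mapping.lookup m' i:]"
    by (simp only: single_as_prod T.\<sigma>_simps grt_Cst grt_Var)
  then have "T.cmp n (Poly_Mapping.single m' c) =
      coeff (map_poly Cst (gr c)) n * (\<Prod>i\<in>UNIV. Var i ^ Poly_Mapping.lookup m' i)"
    by (simp add: T.cmp_def mult.commute)
  also have "coeff (map_poly Cst (gr c)) n = (Cst (X.cmp n c) :: 'k txpol)"
    by (simp add: X.cmp_def coeff_map_poly Cst_simps)
  finally have "T.cmp n (Poly_Mapping.single m' c) = Poly_Mapping.single m' (X.cmp n c)"
    by (simp only: single_as_prod)
  then show ?case by (simp add: lookup_single when_def)
qed (simp add: T.cmp_add X.cmp_add lookup_add)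

lemma thomog_iff:
  fixes f :: "'k::comm_ring_1 txpol"
  shows "(\<forall>m. homogeneous n (Poly_Mapping.lookup f m)) \<longleftrightarrow> T.homog n f"
proof
  assume "\<forall>m. homogeneous n (Poly_Mapping.lookup f m)"
  then have "T.cmp n f = f"
    by (subst poly_mapping_eq_iff) (simp add: fun_eq_iff lookup_cmp_t homogeneous_iff X.cmp_self)
  then show "T.homog n f" using T.homog_cmp by metis
next
  assume "T.homog n f"
  then have "T.cmp n f = f" by (simp add: T.cmp_homog)
  then show "\<forall>m. homogeneous n (Poly_Mapping.lookup f m)"
    unfolding homogeneous_iff by (metis lookup_cmp_t X.homog_cmp)
qed

lemma bihomogeneous_iff: "bihomogeneous i j f \<longleftrightarrow> X.homog j f \<and> T.homog i f"
  for f :: "'k::comm_ring_1 txpol"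
  by (simp add: bihomogeneous_def homogeneous_iff flip: thomog_iff)

lemma homog_Cst: "X.homog 0 (Cst c)"
  by (simp add: X.homog_def gr_Cst monom_0)

lemma homog_Var: "X.homog 1 (Var i)"
  by (simp add: X.homog_def gr_Var)

lemma thomog_Cst: "X.homog n c \<Longrightarrow> T.homog n (Cst c)"
  by (simp add: X.homog_def T.homog_def grt_Cst map_poly_monom rhom_Cst)

lemma thomog_tvar: "T.homog 1 (tvar j)"
  by (rule thomog_Cst[OF homog_Var])

lemma thomog_Var: "T.homog 0 (Var i)"
  by (simp add: T.homog_def grt_Var monom_0)

lemma X_homog_0_Cst:
  fixes f :: "('i::finite, 'a::comm_ring_1) mpol"
  assumes "X.homog 0 f"
  shows "\<exists>c. f = Cst c"
proof -
  have "X.cmp 0 f = f" using assms by (simp add: X.cmp_homog)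
  moreover have "X.cmp 0 f = Cst (Poly_Mapping.lookup f 0)"
  proof (rule poly_mapping_eqI)
    fix m :: "'i \<Rightarrow>\<^sub>0 nat"
    have "mon_degree m = 0 \<longleftrightarrow> m = 0"
      by (auto simp: mon_degree_def poly_mapping_eq_iff fun_eq_iff)
    then show "Poly_Mapping.lookup (X.cmp 0 f) m = Poly_Mapping.lookup (Cst (Poly_Mapping.lookup f 0)) m"
      by (simp add: lookup_cmp Cst_def lookup_single when_def)
  qed
  ultimately show ?thesis by metis
qed

section \<open>Substitutions that are scalings modulo a graded ideal\<close>

lemma subst_scale: "subst (\<lambda>i. L * Var i) f = poly (gr f) L"
  by (rule rhom_eq[OF rhom_subst rhom_comp[OF rhom_gr rhom_poly]])
    (simp_all add: subst_simps gr_Cst gr_Var poly_monom)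

lemma cmp_poly_gr:
  assumes "X.homog 0 L"
  shows "X.cmp n (poly (gr f) L) = L ^ n * X.cmp n f"
proof -
  have *: "X.homog 0 (L ^ m)" for m using X.homog_power[OF assms, of m] by simp
  have "X.cmp n (poly (gr f) L) = (\<Sum>m\<le>degree (gr f). X.cmp n (L ^ m * X.cmp m f))"
    by (simp add: poly_altdef X.cmp_sum mult.commute flip: X.cmp_def)
  also have "\<dots> = (\<Sum>m\<le>degree (gr f). if m = n then L ^ n * X.cmp n f else 0)"
    by (rule sum.cong) (auto simp: X.cmp_homog_mult[OF *] X.cmp_homog[OF X.homog_cmp])
  also have "\<dots> = L ^ n * X.cmp n f"
    using X.cmp_eventually_0[of f n] by auto
  finally show ?thesis .
qed

text \<open>The components of \<open>poly (gr f) L\<close> are those of \<open>f\<close> times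
  \<open>L ^ n\<close>. Padding each with the missing power of \<open>L\<close>, up to the largest
  degree \<open>N\<close> in \<open>f\<close>, makes them the components of a single multiple of
  \<open>f\<close>.\<close>

lemma graded_power_mem:
  assumes Q: "X.graded Q" and L: "X.homog 0 L" and f: "poly (gr f) L * g \<in> Q" and g: "X.homog 0 g"
  shows "\<exists>N. L ^ N * f * g \<in> Q"
proof -
  define N where "N = degree (gr f)"
  have sub: "ideal.subspace Q" using Q by (rule X.graded_subspace)
  have LN: "X.homog 0 (L ^ N)" using X.homog_power[OF L, of N] by simp
  have gN: "X.homog 0 (L ^ N * g)" using X.homog_mult[OF LN g] by simp
  have "X.cmp n (L ^ N * f * g) \<in> Q" for n
  proof (cases "n \<le> N")
    case True
    have "X.cmp n (g * poly (gr f) L) \<in> Q"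
      using X.graded_cmp[OF Q f] by (simp add: mult.commute)
    then have "L ^ n * X.cmp n f * g \<in> Q"
      by (simp only: X.cmp_homog_mult[OF g] cmp_poly_gr[OF L] le0 if_True diff_zero) (simp only: mult.commute)
    then have "L ^ (N - n) * (L ^ n * X.cmp n f * g) \<in> Q"
      by (rule ideal.subspace_scale[OF sub])
    also have "L ^ (N - n) * (L ^ n * X.cmp n f * g) = L ^ (N - n + n) * g * X.cmp n f"
      unfolding power_add by (simp only: mult_ac)
    also have "\<dots> = X.cmp n (L ^ N * g * f)"
      using X.cmp_homog_mult[OF gN, of n f] True by simp
    also have "L ^ N * g * f = L ^ N * f * g" by (simp only: mult_ac)
    finally show ?thesis .
  next
    case False
    then have "X.cmp n f = 0" by (simp add: X.cmp_eventually_0 N_def)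
    then have "X.cmp n (L ^ N * g * f) = 0"
      using X.cmp_homog_mult[OF gN, of n f] by simp
    also have "L ^ N * g * f = L ^ N * f * g" by (simp only: mult_ac)
    finally show ?thesis using sub by (simp add: ideal.subspace_0)
  qed
  then show ?thesis using X.gradedI_cmp[OF sub] by blast
qed

text \<open>Modulo \<open>Q\<close> the substitution is scaling by \<open>l\<close>. In the
  applications \<open>s\<close> eliminates variables with the denominator \<open>l\<close> cleared,
  and membership is pulled back from the eliminated form to \<open>f\<close> at the price of a power
  of \<open>l\<close>.\<close>

lemma subst_mem_graded:
  assumes Q: "X.graded Q" and s: "\<And>i. s i - Cst l * Var i \<in> Q" and f: "subst s f * Cst g \<in> Q"
  shows "\<exists>N. Cst (l ^ N * g) * f \<in> Q"
proof -
  have sub: "ideal.subspace Q" using Q by (rule X.graded_subspace)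
  have "subst s f - subst (\<lambda>i. Cst l * Var i) f \<in> Q"
    by (rule rhom_cong_mod[OF sub rhom_subst rhom_subst])
      (simp_all add: subst_simps s ideal.subspace_0[OF sub])
  then have "(subst s f - poly (gr f) (Cst l)) * Cst g \<in> Q"
    unfolding subst_scale by (rule subspace_mult_right[OF sub])
  then have "poly (gr f) (Cst l) * Cst g \<in> Q"
    using ideal.subspace_diff[OF sub f] by (fastforce simp: left_diff_distrib)
  then obtain N where "Cst l ^ N * f * Cst g \<in> Q"
    using graded_power_mem[OF Q homog_Cst _ homog_Cst] by blast
  also have "Cst l ^ N * f * Cst g = Cst (l ^ N * g) * f"
    by (simp only: Cst_simps mult_ac)
  finally show ?thesis by blast
qed

section \<open>Koszul complexes\<close>

text \<open>Each application of \<open>step\<close> raises one exponent; eventually some exponent reaches \<open>N\<close>.\<close>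

lemma power_descent:
  fixes v :: "'i::finite \<Rightarrow> 'a::comm_ring_1"
  assumes step: "\<And>h. (\<And>i. Z (v i * h)) \<Longrightarrow> Z h"
    and base: "\<And>f i. Z (f * v i ^ N * h)"
  shows "Z h"
proof -
  have "Z ((\<Prod>i\<in>UNIV. v i ^ e i) * h)" for e :: "'i \<Rightarrow> nat"
  proof (induction "\<Sum>i\<in>UNIV. N - e i" arbitrary: e rule: less_induct)
    case less
    show ?case
    proof (cases "\<exists>i. e i \<ge> N")
      case True
      then obtain i where i: "e i \<ge> N" by blast
      have e: "v i ^ e i = v i ^ (e i - N) * v i ^ N"
        using i by (simp flip: power_add)
      have "(\<Prod>i\<in>UNIV. v i ^ e i) * h =
          (v i ^ (e i - N) * (\<Prod>j\<in>UNIV - {i}. v j ^ e j)) * v i ^ N * h"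
        unfolding prod.remove[OF finite UNIV_I[of i]] e by (simp only: mult_ac)
      then show ?thesis by (simp only: base)
    next
      case False
      show ?thesis
      proof (rule step)
        fix i
        let ?e = "e(i := Suc (e i))"
        have "(\<Sum>j\<in>UNIV. N - ?e j) < (\<Sum>j\<in>UNIV. N - e j)"
        proof (rule sum_strict_mono_ex1)
          show "\<exists>j\<in>UNIV. N - ?e j < N - e j"
            using False by (intro bexI[of _ i]) (auto simp: not_le intro: diff_less_mono2)
        qed auto
        then have Z: "Z ((\<Prod>j\<in>UNIV. v j ^ ?e j) * h)" by (rule less)
        have *: "(\<Prod>j\<in>UNIV. v j ^ ?e j) = v i * (\<Prod>j\<in>UNIV. v j ^ e j)"
        proof -
          have "(\<Prod>j\<in>UNIV - {i}. v j ^ ?e j) = (\<Prod>j\<in>UNIV - {i}. v j ^ e j)"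
            by (rule prod.cong) auto
          then show ?thesis
            unfolding prod.remove[OF finite UNIV_I[of i]] by simp
        qed
        show "Z (v i * ((\<Prod>j\<in>UNIV. v j ^ e j) * h))"
          using Z unfolding * mult.assoc .
      qed
    qed
  qed
  from this[of "\<lambda>_. 0"] show ?thesis by (simp only: power_0 prod.neutral_const mult_1_left)
qed

locale regular_triple =
  fixes t1 t2 t3 :: "'a::idom"
  assumes t1: "t1 \<noteq> 0"
    and reg2: "\<And>y. t1 dvd t2 * y \<Longrightarrow> t1 dvd y"
    and reg3: "\<And>y a b. t3 * y = t1 * a + t2 * b \<Longrightarrow> \<exists>a b. y = t1 * a + t2 * b"
begin

text \<open>Regularity of \<open>t3\<close> resolves \<open>a3\<close>, and regularity of
  \<open>t2\<close> the relation that remains between \<open>t1\<close> and \<open>t2\<close>. In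
  vector language, what is orthogonal to t is a cross product with t.\<close>

lemma koszul2:
  assumes "t1 * a1 + t2 * a2 + t3 * a3 = 0"
  shows "\<exists>x1 x2 x3. a1 = t2 * x3 - t3 * x2 \<and> a2 = t3 * x1 - t1 * x3 \<and> a3 = t1 * x2 - t2 * x1"
proof -
  have "t3 * a3 = t1 * (- a1) + t2 * (- a2)" using assms by (simp add: algebra_simps eq_neg_iff_add_eq_0)
  then obtain x2 y where a3: "a3 = t1 * x2 + t2 * y" using reg3 by blast
  have eq: "t2 * (a2 + t3 * y) = t1 * (- (a1 + t3 * x2))"
    using assms unfolding a3 by algebra
  then have "t1 dvd t2 * (a2 + t3 * y)" by simp
  from reg2[OF this] obtain z where z: "a2 + t3 * y = t1 * z" by (rule dvdE)
  have "t1 * (a1 + t3 * x2 + t2 * z) = 0" using eq z by algebra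
  then have "a1 + t3 * x2 + t2 * z = 0" using t1 by simp
  then have "a1 = t2 * (- z) - t3 * x2" "a2 = t3 * (- y) - t1 * (- z)" "a3 = t1 * x2 - t2 * (- y)"
    using z a3 by algebra+
  then show ?thesis by blast
qed

text \<open>In vector language, what is parallel to t is a multiple of t; the third proportionality
  follows from the given two by cancelling \<open>t1\<close>.\<close>

lemma koszul1:
  assumes "t1 * c2 = t2 * c1" "t1 * c3 = t3 * c1"
  shows "\<exists>e. c1 = t1 * e \<and> c2 = t2 * e \<and> c3 = t3 * e"
proof -
  have "t1 dvd t2 * c1" by (simp flip: assms(1))
  from reg2[OF this] obtain e where e: "c1 = t1 * e" by (rule dvdE)
  have "t1 * (c2 - t2 * e) = 0" "t1 * (c3 - t3 * e) = 0"
    using assms e by algebra+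
  then show ?thesis using t1 e by auto
qed

lemma saturated_q:
  assumes q0: "q \<noteq> 0" and "q dvd t1 * a" "q dvd t2 * a" "q dvd t3 * a"
  shows "q dvd a"
proof -
  obtain x1 x2 x3 where x: "t1 * a = q * x1" "t2 * a = q * x2" "t3 * a = q * x3"
    using assms(2-4) by (meson dvdE)
  have "q * (t1 * x2 - t2 * x1) = 0" "q * (t1 * x3 - t3 * x1) = 0"
    using x by algebra+
  then obtain e where "x1 = t1 * e" using koszul1[of x2 x1 x3] q0 by auto
  then have "t1 * (a - q * e) = 0" using x(1) by algebra
  then show ?thesis using t1 by simp
qed

end

locale koszul_pair = regular_triple +
  fixes l1 l2 l3 k1 k2 k3 :: "'a::idom" and p q :: 'a
  assumes p: "p = l1 * t1 + l2 * t2 + l3 * t3"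
    and q: "q = k1 * t1 + k2 * t2 + k3 * t3"
    and cop: "\<And>a b. a * p = b * q \<Longrightarrow> q dvd a"
    and p0: "p \<noteq> 0" and q0: "q \<noteq> 0"
begin

lemma cop': "a * p + b * q = 0 \<Longrightarrow> \<exists>z. a = z * q \<and> b = - z * p"
proof -
  assume *: "a * p + b * q = 0"
  then have "a * p = (- b) * q" by (simp add: eq_neg_iff_add_eq_0)
  then obtain z where z: "a = q * z" using cop by (meson dvdE)
  have "q * (b + z * p) = 0" using * z by algebra
  then have "b + z * p = 0" using q0 by simp
  then show ?thesis using z by (intro exI[of _ z]) (simp add: mult.commute eq_neg_iff_add_eq_0)
qed

text \<open>A chase in a Koszul double complex. By coprimality the cross products of t with the
  coefficient vectors a and b are z q and - z p. The vector z is orthogonal to t, hence itself a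
  cross product t \<times> x, and then a - x q and b + x p are multiples of t.\<close>

lemma saturated_pq:
  assumes "t1 * h = a1 * p + b1 * q" "t2 * h = a2 * p + b2 * q" "t3 * h = a3 * p + b3 * q"
  shows "\<exists>a b. h = a * p + b * q"
proof -
  have "(t2 * a3 - t3 * a2) * p + (t2 * b3 - t3 * b2) * q = 0"
    "(t3 * a1 - t1 * a3) * p + (t3 * b1 - t1 * b3) * q = 0"
    "(t1 * a2 - t2 * a1) * p + (t1 * b2 - t2 * b1) * q = 0"
    using assms by algebra+
  then obtain z1 z2 z3 where
    a: "t2 * a3 - t3 * a2 = z1 * q" "t3 * a1 - t1 * a3 = z2 * q" "t1 * a2 - t2 * a1 = z3 * q"
    and b: "t2 * b3 - t3 * b2 = - z1 * p" "t3 * b1 - t1 * b3 = - z2 * p" "t1 * b2 - t2 * b1 = - z3 * p"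
    using cop' by metis
  have "q * (t1 * z1 + t2 * z2 + t3 * z3) = 0"
    using a by algebra
  then have "t1 * z1 + t2 * z2 + t3 * z3 = 0" using q0 by simp
  then obtain x1 x2 x3 where x: "z1 = t2 * x3 - t3 * x2" "z2 = t3 * x1 - t1 * x3" "z3 = t1 * x2 - t2 * x1"
    using koszul2 by blast
  have "t1 * (a2 - x2 * q) = t2 * (a1 - x1 * q)" "t1 * (a3 - x3 * q) = t3 * (a1 - x1 * q)"
    using a x by algebra+
  then obtain e where e: "a1 - x1 * q = t1 * e" using koszul1 by blast
  have "t1 * (b2 + x2 * p) = t2 * (b1 + x1 * p)" "t1 * (b3 + x3 * p) = t3 * (b1 + x1 * p)"
    using b x by algebra+
  then obtain f where f: "b1 + x1 * p = t1 * f" using koszul1 by blast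
  have "t1 * (h - (e * p + f * q)) = 0" using assms(1) e f by algebra
  then show ?thesis using t1 by auto
qed

text \<open>The same chase in one degree higher, where \<open>z\<close> is a scalar. Its part in the
  ideal of t is absorbed by the \<open>r\<close> terms. For the rest, \<open>f\<close>, the
  expansions of \<open>p\<close> and \<open>q\<close> in t restore orthogonality, and the resulting
  terms assemble to the cross product of the rows l and k. In the application \<open>H\<close> says
  that \<open>f\<close> is free of t.\<close>

lemma first_cohomology:
  assumes dec: "\<And>f. \<exists>f0 r1 r2 r3. H f0 \<and> f = f0 + t1 * r1 + t2 * r2 + t3 * r3"
    and "t1 * c2 - t2 * c1 = a3 * p + b3 * q"
    and "t2 * c3 - t3 * c2 = a1 * p + b1 * q"
    and "t3 * c1 - t1 * c3 = a2 * p + b2 * q"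
  shows "\<exists>f e x1 y1 x2 y2 x3 y3. H f \<and>
    c1 = f * (l2 * k3 - l3 * k2) + e * t1 + (x1 * p + y1 * q) \<and>
    c2 = f * (l3 * k1 - l1 * k3) + e * t2 + (x2 * p + y2 * q) \<and>
    c3 = f * (l1 * k2 - l2 * k1) + e * t3 + (x3 * p + y3 * q)"
proof -
  have "(t1 * a1 + t2 * a2 + t3 * a3) * p + (t1 * b1 + t2 * b2 + t3 * b3) * q = 0"
    using assms(2-4) by algebra
  then obtain z where z: "t1 * a1 + t2 * a2 + t3 * a3 = z * q" "t1 * b1 + t2 * b2 + t3 * b3 = - z * p"
    using cop' by blast
  obtain f r1 r2 r3 where H: "H f" and f: "- z = f + t1 * r1 + t2 * r2 + t3 * r3" using dec by blast
  have z': "z = - f - t1 * r1 - t2 * r2 - t3 * r3" using f by (simp add: algebra_simps minus_equation_iff[of z])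
  have "t1 * (a1 + f * k1 + r1 * q) + t2 * (a2 + f * k2 + r2 * q) + t3 * (a3 + f * k3 + r3 * q) = 0"
    using z(1) z' q by algebra
  then obtain x1 x2 x3 where x: "a1 + f * k1 + r1 * q = t2 * x3 - t3 * x2"
      "a2 + f * k2 + r2 * q = t3 * x1 - t1 * x3" "a3 + f * k3 + r3 * q = t1 * x2 - t2 * x1"
    using koszul2 by blast
  have "t1 * (b1 - f * l1 - r1 * p) + t2 * (b2 - f * l2 - r2 * p) + t3 * (b3 - f * l3 - r3 * p) = 0"
    using z(2) z' p by algebra
  then obtain y1 y2 y3 where y: "b1 - f * l1 - r1 * p = t2 * y3 - t3 * y2"
      "b2 - f * l2 - r2 * p = t3 * y1 - t1 * y3" "b3 - f * l3 - r3 * p = t1 * y2 - t2 * y1"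
    using koszul2 by blast
  let ?d1 = "c1 - f * (l2 * k3 - l3 * k2) - (x1 * p + y1 * q)"
  let ?d2 = "c2 - f * (l3 * k1 - l1 * k3) - (x2 * p + y2 * q)"
  let ?d3 = "c3 - f * (l1 * k2 - l2 * k1) - (x3 * p + y3 * q)"
  have 1: "t1 * ?d2 = t2 * ?d1"
    using assms(2) x(3) y(3) p q by algebra
  have 2: "t1 * ?d3 = t3 * ?d1"
    using assms(4) x(2) y(2) p q by algebra
  obtain e where e: "?d1 = t1 * e" "?d2 = t2 * e" "?d3 = t3 * e" using koszul1[OF 1 2] by blast
  have "c1 = f * (l2 * k3 - l3 * k2) + e * t1 + (x1 * p + y1 * q)"
    "c2 = f * (l3 * k1 - l1 * k3) + e * t2 + (x2 * p + y2 * q)"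
    "c3 = f * (l1 * k2 - l2 * k1) + e * t3 + (x3 * p + y3 * q)"
    using e by algebra+
  then show ?thesis using H by blast
qed

end

section \<open>The t variables as a regular sequence in K[t, X]\<close>

lemma rhom_cong_mod_tx:
  fixes f g :: "'k::comm_ring_1 txpol \<Rightarrow> 'b::comm_ring_1"
  assumes Q: "ideal.subspace Q" and f: "rhom f" and g: "rhom g"
    and "\<And>c. f (Cst (Cst c)) - g (Cst (Cst c)) \<in> Q" "\<And>j. f (tvar j) - g (tvar j) \<in> Q"
    and "\<And>i. f (Var i) - g (Var i) \<in> Q"
  shows "f x - g x \<in> Q"
proof (rule rhom_cong_mod[OF Q f g])
  show "f (Cst c) - g (Cst c) \<in> Q" for c
    by (rule rhom_cong_mod[OF Q rhom_comp[OF rhom_Cst f] rhom_comp[OF rhom_Cst g]]) fact+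
qed fact

lemma ideal_span_insert:
  "ideal.subspace Q \<Longrightarrow> x \<in> ideal.span (insert a Q) \<longleftrightarrow> (\<exists>k. x - k * a \<in> Q)"
  by (metis ideal.span_breakdown_eq ideal.span_eq_iff)

lemma ideal_span_singleton: "x \<in> ideal.span {a} \<longleftrightarrow> a dvd x"
  by (auto simp: ideal.span_singleton dvd_def mult.commute)

text \<open>The endomorphism setting t_j to 0. Its kernel is the ideal of t_j, so questions of
  regularity become cancellations in a domain.\<close>

definition zero_t :: "3 \<Rightarrow> 'k::comm_ring_1 txpol \<Rightarrow> 'k txpol"
  where "zero_t j = mpol_eval (\<lambda>c. Cst (subst (\<lambda>i. if i = j then 0 else Var i) c)) Var"

lemma rhom_zero_t_coeff:
  "rhom (\<lambda>c. Cst (subst (\<lambda>i. if i = j then 0 else Var i) c) :: 'k::comm_ring_1 txpol)"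
  by (rule rhom_comp[OF rhom_subst rhom_Cst])

lemma rhom_zero_t: "rhom (zero_t j)"
  unfolding zero_t_def by (rule rhom_mpol_eval[OF rhom_zero_t_coeff])

lemma zero_t_Cst: "zero_t j (Cst c) = Cst (subst (\<lambda>i. if i = j then 0 else Var i) c)"
  unfolding zero_t_def by (rule mpol_eval_Cst) (rule rhom_zero[OF rhom_zero_t_coeff])

lemma zero_t_tvar: "zero_t j (tvar i) = (if i = j then 0 else tvar i)"
  by (simp add: zero_t_Cst subst_simps Cst_simps)

lemma zero_t_Var: "zero_t j (Var i) = Var i"
  unfolding zero_t_def by (rule mpol_eval_Var[OF rhom_zero_t_coeff])

lemma dvd_diff_zero_t: "tvar j dvd f - zero_t j f"
proof -
  have sub: "ideal.subspace (ideal.span {tvar j})" by (rule ideal.subspace_span)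
  have "f - zero_t j f \<in> ideal.span {tvar j}"
  proof (rule rhom_cong_mod_tx[OF sub rhom_id rhom_zero_t])
    show "tvar i - zero_t j (tvar i) \<in> ideal.span {tvar j}" for i
      by (simp add: zero_t_tvar ideal.span_zero ideal.span_base)
  qed (simp_all add: zero_t_Cst zero_t_Var ideal.span_zero)
  then show ?thesis by (simp only: ideal_span_singleton)
qed

lemma Var_neq_0 [simp]: "Var i \<noteq> (0 :: ('i, 'a::comm_ring_1) mpol)"
  unfolding Var_def by (metis lookup_single_eq lookup_zero one_neq_zero)

lemma tvar_neq_0: "tvar j \<noteq> (0 :: 'k::comm_ring_1 txpol)"
  by simp

lemma zero_t_cancel:
  fixes y :: "'k::idom txpol"
  assumes "zero_t j (tvar i * y) = 0" "i \<noteq> j"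
  shows "zero_t j y = 0"
  using assms by (simp add: rhom_mult[OF rhom_zero_t] zero_t_tvar tvar_neq_0 split: if_splits)

global_interpretation tvars: regular_triple "tvar 1" "tvar 2" "tvar 3 :: 'k::idom txpol"
proof
  show "tvar 1 \<noteq> (0 :: 'k txpol)" by (rule tvar_neq_0)
  show "tvar 1 dvd y" if d: "tvar 1 dvd tvar 2 * y" for y :: "'k txpol"
  proof -
    obtain k where k: "tvar 2 * y = tvar 1 * k" using d by (rule dvdE)
    have "zero_t 1 (tvar 2 * y) = 0"
      unfolding k by (simp add: rhom_mult[OF rhom_zero_t] zero_t_tvar)
    then have "zero_t 1 y = 0" by (rule zero_t_cancel) simp
    then show ?thesis using dvd_diff_zero_t[of 1 y] by simp
  qed
  show "\<exists>a b. y = tvar 1 * a + tvar 2 * b" if eq: "tvar 3 * y = tvar 1 * a + tvar 2 * b"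
    for y a b :: "'k txpol"
  proof -
    \<comment> \<open>Setting t_1 and t_2 to 0 kills the right side; t_3 is untouched and can be
      cancelled.\<close>
    have "zero_t 2 (zero_t 1 (tvar 3 * y)) = 0"
      unfolding eq by (simp add: rhom_mult[OF rhom_zero_t] rhom_add[OF rhom_zero_t] zero_t_tvar)
    moreover have "zero_t 1 (tvar 3 * y) = tvar 3 * zero_t 1 y"
      by (simp add: rhom_mult[OF rhom_zero_t] zero_t_tvar)
    ultimately have "zero_t 2 (zero_t 1 y) = 0" using zero_t_cancel[of 2 3 "zero_t 1 y"] by simp
    then have "tvar 2 dvd zero_t 1 y" using dvd_diff_zero_t[of 2 "zero_t 1 y"] by simp
    moreover have "tvar 1 dvd y - zero_t 1 y" by (rule dvd_diff_zero_t)
    ultimately obtain a b where "zero_t 1 y = tvar 2 * b" "y - zero_t 1 y = tvar 1 * a"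
      by (meson dvdE)
    then show ?thesis by (metis diff_add_cancel)
  qed
qed

text \<open>Setting the three variables to 0 in turn gives a telescoping sum, each difference being
  divisible by the variable just removed.\<close>

lemma t_decomposition:
  fixes f :: "'k::comm_ring_1 txpol"
  shows "\<exists>f0 r1 r2 r3. T.homog 0 f0 \<and> f = f0 + tvar 1 * r1 + tvar 2 * r2 + tvar 3 * r3"
proof -
  let ?f = "zero_t 3 (zero_t 2 (zero_t 1 f))"
  have "T.homog 0 (zero_t 3 (zero_t 2 (zero_t 1 (Cst c)))) " for c :: "'k tpol"
  proof -
    have "X.homog 0 (subst (\<lambda>i. if i = 3 then 0 else Var i) (subst (\<lambda>i. if i = 2 then 0 else Var i)
        (subst (\<lambda>i. if i = 1 then 0 else Var i) c)))"
    proof (induction c rule: mpol_induct)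
      case (Cst c)
      then show ?case by (simp add: homog_Cst)
    next
      case (Var i)
      then show ?case using exhaust_3[of i] by (auto simp: subst_simps)
    next
      case (mult f g)
      then show ?case using X.homog_mult[of 0 _ 0] by (simp add: subst_simps)
    qed (simp add: subst_simps X.homog_add)
    then show ?thesis by (simp add: zero_t_Cst thomog_Cst)
  qed
  then have "T.homog 0 ?f"
  proof (induction f rule: mpol_induct)
    case (mult f g)
    then show ?case using T.homog_mult[of 0 _ 0] by (simp add: rhom_mult[OF rhom_zero_t])
  qed (simp_all add: zero_t_Var thomog_Var rhom_add[OF rhom_zero_t] T.homog_add)
  moreover obtain r1 r2 r3 where "f - zero_t 1 f = tvar 1 * r1"
    "zero_t 1 f - zero_t 2 (zero_t 1 f) = tvar 2 * r2" "zero_t 2 (zero_t 1 f) - ?f = tvar 3 * r3"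
    using dvd_diff_zero_t by (meson dvdE)
  then have "f = ?f + tvar 1 * r1 + tvar 2 * r2 + tvar 3 * r3"
    by (simp add: algebra_simps)
  ultimately show ?thesis by blast
qed

section \<open>The projective Nullstellensatz\<close>

text \<open>A linear factor of \<open>q\<close> that generates the unit ideal together with
  \<open>b\<close> can be cancelled from \<open>q\<close> modulo \<open>b\<close>. Not every factor
  can be cancelled, since a nonzero constant would then lie in \<open>b\<close>.\<close>

lemma descend_to_root:
  fixes \<kappa> :: "'k::alg_closed_field poly \<Rightarrow> 'b::comm_ring_1"
  assumes \<kappa>: "rhom \<kappa>" and b: "ideal.subspace b" "1 \<notin> b" and q: "q \<noteq> 0" "\<kappa> q \<in> b"
  shows "\<exists>c. 1 \<notin> ideal.span (insert (\<kappa> [:- c, 1:]) b)"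
  using q
proof (induction "degree q" arbitrary: q rule: less_induct)
  case less
  show ?case
  proof (cases "degree q = 0")
    case True
    then obtain a where a: "q = [:a:]" by (rule degree_eq_zeroE)
    then have "[:inverse a:] * q = 1" using less.prems by (simp add: one_pCons)
    then have "\<kappa> [:inverse a:] * \<kappa> q = 1" by (metis \<kappa> rhom_mult rhom_one)
    then show ?thesis using ideal.subspace_scale[OF b(1) less.prems(2)] b(2) by metis
  next
    case False
    then obtain c where "poly q c = 0" using alg_closed_imp_poly_has_root[of q] by auto
    then obtain q' where q': "q = [:- c, 1:] * q'" by (metis dvdE poly_eq_0_iff_dvd)
    show ?thesis
    proof (cases "1 \<in> ideal.span (insert (\<kappa> [:- c, 1:]) b)")
      case True
      then obtain h where h: "1 - h * \<kappa> [:- c, 1:] \<in> b"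
        by (auto simp: ideal_span_insert[OF b(1)])
      have "x = x * (1 - h * a) + h * (a * x)" for x a :: 'b
        by (simp add: algebra_simps)
      then have "\<kappa> q' = \<kappa> q' * (1 - h * \<kappa> [:- c, 1:]) + h * \<kappa> q"
        unfolding q' rhom_mult[OF \<kappa>] .
      then have "\<kappa> q' \<in> b"
        using h less.prems(2) ideal.subspace_add[OF b(1)] ideal.subspace_scale[OF b(1)] by metis
      moreover have "q' \<noteq> 0" using less.prems(1) q' by auto
      moreover have "degree q' < degree q"
        using \<open>q' \<noteq> 0\<close> by (simp add: q' degree_mult_eq del: mult_pCons_left)
      ultimately show ?thesis using less.hyps by blast
    qed blast
  qed
qed

text \<open>At a root c of 1 + x f(x) the value f(c) cannot be 0.\<close>

lemma ex_nonroot: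
  fixes f :: "'k::alg_closed_field poly"
  assumes "f \<noteq> 0"
  shows "\<exists>c. poly f c \<noteq> 0"
proof -
  have "degree (pCons 1 f) > 0" using assms by simp
  then obtain c where "poly (pCons 1 f) c = 0" using alg_closed_imp_poly_has_root by blast
  then show ?thesis by (intro exI[of _ c]) auto
qed

text \<open>Evaluate every coefficient at \<open>c\<close>: modulo the first variable minus
  \<open>c\<close>, only a polynomial in the second variable remains.\<close>

lemma mod_first_variable:
  fixes h :: "'k::comm_ring_1 poly poly"
  shows "\<exists>q w. h = map_poly (\<lambda>a. [:a:]) q + [:[:- c, 1:]:] * w"
proof (induction h)
  case 0
  show ?case by (rule exI[of _ 0], rule exI[of _ 0]) simp
next
  case (pCons a h)
  then obtain q w where h: "h = map_poly (\<lambda>a. [:a:]) q + [:[:- c, 1:]:] * w" by blast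
  have "[:- c, 1:] dvd a - [:poly a c:]"
    by (simp add: poly_eq_0_iff_dvd[symmetric])
  then obtain a' where a': "a - [:poly a c:] = [:- c, 1:] * a'" by (rule dvdE)
  have "a = [:poly a c:] + [:- c, 1:] * a'" using a' by (metis add.commute diff_add_cancel)
  then have "pCons a h = pCons [:poly a c:] (map_poly (\<lambda>a. [:a:]) q) + [:[:- c, 1:]:] * pCons a' w"
    by (simp add: h)
  also have "pCons [:poly a c:] (map_poly (\<lambda>a. [:a:]) q) = map_poly (\<lambda>a. [:a:]) (pCons (poly a c) q)"
    by (rule poly_eqI) (simp add: coeff_map_poly coeff_pCons split: nat.split)
  finally show ?case by blast
qed

text \<open>The weak Nullstellensatz for the plane, which is what a chart of the projective plane
  calls for. The ideal is enlarged by one linear polynomial per variable and stays proper; the value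
  of a member of \<open>b\<close> at the resulting point is a constant in the enlarged ideal, hence
  0.\<close>

lemma ideal_has_zero:
  fixes b :: "'k::alg_closed_field poly poly set"
  assumes b: "ideal.subspace b" "1 \<notin> b"
  shows "\<exists>c c'. \<forall>f\<in>b. poly (poly f [:c':]) c = 0"
proof (cases "\<exists>g\<in>b. g \<noteq> 0")
  case False
  then show ?thesis by (metis poly_0)
next
  case True
  then obtain g0 where "g0 \<in> b \<and> g0 \<noteq> 0" by blast
  from ex_has_least_nat[of "\<lambda>g. g \<in> b \<and> g \<noteq> 0", OF this, of degree]
  obtain g where g: "g \<in> b" "g \<noteq> 0" and min: "\<And>f. f \<in> b \<Longrightarrow> f \<noteq> 0 \<Longrightarrow> degree g \<le> degree f"
    by blast
  let ?x = "\<lambda>c. [:[:- c, 1:]:] :: 'k poly poly"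
  txt \<open>
    Division by \<open>g\<close>, which has minimal degree in the second variable, would turn \<open>1 \<in> b + (x - c)\<close>
    into a relation showing that \<open>c\<close> is a root of the leading coefficient of \<open>g\<close>.
  \<close>
  have "\<exists>c. 1 \<notin> ideal.span (insert (?x c) b)"
  proof (cases "degree g = 0")
    case True
    then obtain f0 where "g = [:f0:]" by (rule degree_eq_zeroE)
    then show ?thesis
      using descend_to_root[OF rhom_const_poly b, of f0] g by auto
  next
    case False
    obtain c where c: "poly (lead_coeff g) c \<noteq> 0" using ex_nonroot[of "lead_coeff g"] g by auto
    have "1 \<notin> ideal.span (insert (?x c) b)"
    proof
      assume "1 \<in> ideal.span (insert (?x c) b)"
      then obtain h where h: "1 - h * ?x c \<in> b" by (auto simp: ideal_span_insert[OF b(1)])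
      obtain q r where qr: "pseudo_divmod h g = (q, r)" by fastforce
      define k where "k = Suc (degree h) - degree g"
      have eq: "smult (lead_coeff g ^ k) h = g * q + r" and r: "r = 0 \<or> degree r < degree g"
        using pseudo_divmod[OF g(2) qr] by (auto simp: k_def)
      let ?f = "[:lead_coeff g ^ k:] - r * ?x c"
      have "?f = [:lead_coeff g ^ k:] * (1 - h * ?x c) + (q * ?x c) * g"
      proof -
        have "[:lead_coeff g ^ k:] * h = g * q + r" using eq by simp
        moreover have "l - r * x = l * (1 - h * x) + (q * x) * g" if "l * h = g * q + r"
          for l x :: "'k poly poly" using that by algebra
        ultimately show ?thesis by blast
      qed
      then have "?f \<in> b"
        using h g(1) ideal.subspace_add[OF b(1)] ideal.subspace_scale[OF b(1)] by metis
      moreover have "degree ?f < degree g"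
        using r False by (auto intro!: degree_diff_less simp: mult.commute[of r])
      ultimately have "?f = 0" using min by force
      then have "coeff ?f 0 = 0" by simp
      then have "lead_coeff g ^ k = coeff r 0 * [:- c, 1:]"
        by (simp add: mult.commute[of r] mult.commute[of "coeff r 0"] del: mult_pCons_right mult_pCons_left) (simp add: mult.commute)
      then have "poly (lead_coeff g ^ k) c = 0" by simp
      then show False using c by simp
    qed
    then show ?thesis ..
  qed
  then obtain c where c: "1 \<notin> ideal.span (insert (?x c) b)" ..
  define b' where "b' = ideal.span (insert (?x c) b)"
  have b': "ideal.subspace b'" "1 \<notin> b'" using c by (simp_all add: b'_def)
  have xb': "?x c \<in> b'" by (simp add: b'_def ideal.span_base)
  let ?\<kappa> = "map_poly (\<lambda>a. [:a:]) :: 'k poly \<Rightarrow> 'k poly poly"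
  have \<kappa>: "rhom ?\<kappa>" by (rule rhom_map_poly[OF rhom_const_poly])
  have \<kappa>X: "?\<kappa> [:- a, 1:] = [:[:- a:], 1:]" for a
    by (rule poly_eqI) (simp add: coeff_map_poly coeff_pCons one_pCons split: nat.split)
  have "\<exists>c'. 1 \<notin> ideal.span (insert [:[:- c':], 1:] b')"
  proof (cases "\<exists>q. q \<noteq> 0 \<and> ?\<kappa> q \<in> b'")
    case True
    then show ?thesis using descend_to_root[OF \<kappa> b'] by (metis \<kappa>X)
  next
    case False
    \<comment> \<open>Without such a \<open>q\<close> the second variable is transcendental modulo
      \<open>b'\<close>, so any value would do for \<open>c'\<close>; 0 is taken.\<close>
    have "1 \<notin> ideal.span (insert [:[:- 0:], 1:] b')"
    proof
      assume "1 \<in> ideal.span (insert [:[:- 0:], 1:] b')"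
      then obtain h where h: "1 - h * [:[:- 0:], 1:] \<in> b'" by (auto simp: ideal_span_insert[OF b'(1)])
      obtain q w where hq: "h = ?\<kappa> q + ?x c * w" using mod_first_variable by blast
      have "?\<kappa> (1 - q * [:- 0, 1:]) = 1 - ?\<kappa> q * [:[:- 0:], 1:]"
        by (simp only: rhom_diff[OF \<kappa>] rhom_mult[OF \<kappa>] rhom_one[OF \<kappa>] \<kappa>X)
      also have "\<dots> = (1 - h * [:[:- 0:], 1:]) + (w * [:[:- 0:], 1:]) * ?x c"
        unfolding hq by (simp only: algebra_simps)
      also have "\<dots> \<in> b'"
        using h xb' ideal.subspace_add[OF b'(1)] ideal.subspace_scale[OF b'(1)] by metis
      finally have "1 - q * [:- 0, 1:] = 0" using False by blast
      then have "poly (1 - q * [:- 0, 1:]) 0 = 0" by simp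
      then show False by simp
    qed
    then show ?thesis by metis
  qed
  then obtain c' where c': "1 \<notin> ideal.span (insert [:[:- c':], 1:] b')" ..
  have "poly (poly f [:c':]) c = 0" if f: "f \<in> b" for f
  proof (rule ccontr)
    assume nz: "poly (poly f [:c':]) c \<noteq> 0"
    obtain q w where fq: "f = ?\<kappa> q + ?x c * w" using mod_first_variable by blast
    have "[:- c', 1:] dvd q - [:poly q c':]"
      by (simp add: poly_eq_0_iff_dvd[symmetric])
    then obtain q' where q': "q - [:poly q c':] = [:- c', 1:] * q'" by (rule dvdE)
    have "?\<kappa> q - ?\<kappa> [:poly q c':] = [:[:- c':], 1:] * ?\<kappa> q'"
      by (simp only: rhom_diff[OF \<kappa>, symmetric] q' rhom_mult[OF \<kappa>] \<kappa>X)
    then have v: "f - ?\<kappa> q' * [:[:- c':], 1:] - w * ?x c = [:[:poly q c':]:]"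
      unfolding fq by (simp add: map_poly_const[OF rhom_const_poly] algebra_simps)
    have "poly (poly (f - ?\<kappa> q' * [:[:- c':], 1:] - w * ?x c) [:c':]) c = poly (poly f [:c':]) c"
      by simp
    then have val: "poly q c' = poly (poly f [:c':]) c" unfolding v by simp
    let ?B = "ideal.span (insert [:[:- c':], 1:] b')"
    have "b' \<subseteq> ?B" by (simp add: ideal.span_superset subset_insertI2 order_trans[OF _ ideal.span_superset])
    moreover have "f \<in> b'" using f by (simp add: b'_def ideal.span_base)
    ultimately have "f \<in> ?B" "?x c \<in> ?B" using xb' by blast+
    moreover have "[:[:- c':], 1:] \<in> ?B" by (rule ideal.span_base) simp
    ultimately have "[:[:poly q c':]:] \<in> ?B"
      unfolding v[symmetric] by (intro ideal.span_diff ideal.span_scale)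
    then have "[:[:inverse (poly q c'):]:] * [:[:poly q c':]:] \<in> ?B" by (rule ideal.span_scale)
    then show False using c' nz by (simp add: val one_pCons)
  qed
  then show ?thesis by blast
qed

section \<open>Passing between the projective plane and an affine chart\<close>

definition lift_xy :: "3 \<Rightarrow> 3 \<Rightarrow> 'k::comm_ring_1 poly poly \<Rightarrow> 'k txpol"
  where "lift_xy i j f =
    poly (map_poly (\<lambda>q. poly (map_poly (\<lambda>c. Cst (Cst c)) q) (tvar i)) f) (tvar j)"

lemma rhom_lift_x: "rhom (\<lambda>q. poly (map_poly (\<lambda>c. Cst (Cst c)) q) (tvar i :: 'k::comm_ring_1 txpol))"
  by (rule rhom_comp[OF rhom_map_poly[OF rhom_comp[OF rhom_Cst rhom_Cst]] rhom_poly])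

lemma rhom_lift_xy: "rhom (lift_xy i j)"
  unfolding lift_xy_def by (rule rhom_comp[OF rhom_map_poly[OF rhom_lift_x] rhom_poly])

lemma lift_xy_simps:
  "lift_xy i j [:[:c:]:] = Cst (Cst c)" "lift_xy i j [:[:0, 1:]:] = tvar i" "lift_xy i j [:0, 1:] = tvar j"
  by (simp_all add: lift_xy_def map_poly_const[OF rhom_lift_x] map_poly_X[OF rhom_lift_x]
      map_poly_const[OF rhom_comp[OF rhom_Cst rhom_Cst]] map_poly_X[OF rhom_comp[OF rhom_Cst rhom_Cst]])

definition dehom_xy :: "3 \<Rightarrow> 3 \<Rightarrow> 'k::comm_ring_1 tpol \<Rightarrow> 'k poly poly"
  where "dehom_xy i j = mpol_eval (\<lambda>c. [:[:c:]:])
    (\<lambda>x. if x = i then [:[:0, 1:]:] else if x = j then [:0, 1:] else 1)"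

lemma rhom_const_const: "rhom (\<lambda>c. [:[:c:]:])"
  by (rule rhom_comp[OF rhom_const_poly rhom_const_poly])

lemma rhom_dehom_xy: "rhom (dehom_xy i j)"
  unfolding dehom_xy_def by (rule rhom_mpol_eval[OF rhom_const_const])

lemma dehom_xy_Cst: "dehom_xy i j (Cst c) = [:[:c:]:]"
  unfolding dehom_xy_def by (rule mpol_eval_Cst) simp

lemma dehom_xy_Var: "dehom_xy i j (Var x) =
    (if x = i then [:[:0, 1:]:] else if x = j then [:0, 1:] else 1)"
  unfolding dehom_xy_def by (rule mpol_eval_Var[OF rhom_const_const])

text \<open>Comparing components of h - z (t_k - 1) degree by degree shows that, from degree
  \<open>i\<close> on, the component of \<open>z\<close> in degree n is - t_k^(n-i) h modulo
  \<open>Q\<close>. The components of \<open>z\<close> in high degrees are 0.\<close>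

lemma homogenize_membership:
  assumes Q: "T.graded Q" and h: "T.homog i h" and w: "h - z * (tvar k - 1) \<in> Q"
  shows "\<exists>N. tvar k ^ N * h \<in> Q"
proof -
  have sub: "ideal.subspace Q" using Q by (rule T.graded_subspace)
  define w where "w = h - z * (tvar k - 1)"
  have wQ: "T.cmp n w \<in> Q" for n
    unfolding w_def by (rule T.graded_cmp[OF Q w])
  have w0: "T.cmp 0 w = T.cmp 0 h + T.cmp 0 z"
    and wS: "T.cmp (Suc n) w = T.cmp (Suc n) h - tvar k * T.cmp n z + T.cmp (Suc n) z" for n
  proof -
    have "w = h - (tvar k * z - z)" by (simp add: w_def algebra_simps)
    then show "T.cmp 0 w = T.cmp 0 h + T.cmp 0 z"
      "T.cmp (Suc n) w = T.cmp (Suc n) h - tvar k * T.cmp n z + T.cmp (Suc n) z"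
      by (simp_all add: T.cmp_diff T.cmp_homog_mult[OF thomog_tvar])
  qed
  define s where "s n = (if i \<le> n then tvar k ^ (n - i) * h else 0)" for n
  have cmph: "T.cmp n h = (if n = i then h else 0)" for n
    using T.cmp_homog[OF h, of n] by auto
  have "s n + T.cmp n z \<in> Q" for n
  proof (induction n)
    case 0
    show ?case using wQ[of 0] by (auto simp: w0 cmph s_def)
  next
    case (Suc n)
    have "s (Suc n) = tvar k * s n + T.cmp (Suc n) h"
      by (auto simp: s_def cmph Suc_diff_le mult.assoc)
    then have "s (Suc n) + T.cmp (Suc n) z = tvar k * (s n + T.cmp n z) + T.cmp (Suc n) w"
      by (simp add: wS algebra_simps)
    then show ?case
      using Suc wQ ideal.subspace_add[OF sub] ideal.subspace_scale[OF sub] by metis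
  qed
  from this[of "i + Suc (degree (grt z))"] have "tvar k ^ Suc (degree (grt z)) * h \<in> Q"
    by (simp add: s_def T.cmp_eventually_0)
  then show ?thesis ..
qed

text \<open>On the chart t_k = 1, the polynomials that multiply \<open>h\<close> into
  \<open>Q\<close> + (t_k - 1) form an ideal of the plane. A common zero would be a point with k-th
  coordinate 1, at which \<open>loc\<close> provides a member of that ideal that does not
  vanish.\<close>

lemma projective_nullstellensatz_chart:
  fixes Q :: "'k::alg_closed_field txpol set"
  assumes Q: "T.graded Q" and h: "T.homog n h"
    and ijk: "i \<noteq> j" "k \<noteq> i" "k \<noteq> j" "\<And>x. x = i \<or> x = j \<or> x = k"
    and loc: "\<And>a. a \<noteq> (\<lambda>_. 0) \<Longrightarrow> \<exists>g. ev a g \<noteq> 0 \<and> Cst g * h \<in> Q"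
  shows "\<exists>N. tvar k ^ N * h \<in> Q"
proof -
  have sub: "ideal.subspace Q" using Q by (rule T.graded_subspace)
  let ?W = "ideal.span (insert (tvar k - 1) Q)"
  have W: "ideal.subspace ?W" by (rule ideal.subspace_span)
  define b where "b = {f. lift_xy i j f * h \<in> ?W}"
  have b: "ideal.subspace b"
    by (rule ideal.subspaceI)
      (auto simp: b_def rhom_simps[OF rhom_lift_xy] distrib_right mult.assoc
        intro: ideal.subspace_add[OF W] ideal.subspace_scale[OF W] ideal.span_zero)
  have "1 \<in> b"
  proof (rule ccontr)
    assume "1 \<notin> b"
    then obtain c c' where zero: "\<And>f. f \<in> b \<Longrightarrow> poly (poly f [:c':]) c = 0"
      using ideal_has_zero[OF b] by blast
    define a where "a = (\<lambda>x. if x = i then c else if x = j then c' else 1)"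
    have "a k \<noteq> 0" using ijk by (simp add: a_def)
    then have "a \<noteq> (\<lambda>_. 0)" by auto
    then obtain g where g: "ev a g \<noteq> 0" "Cst g * h \<in> Q" using loc by blast
    have "lift_xy i j (dehom_xy i j g) - Cst g \<in> ?W"
    proof (rule rhom_cong_mod[OF W rhom_comp[OF rhom_dehom_xy rhom_lift_xy] rhom_Cst])
      show "lift_xy i j (dehom_xy i j (Cst c)) - Cst (Cst c) \<in> ?W" for c
        by (simp add: dehom_xy_Cst lift_xy_simps ideal.span_zero)
      have "tvar k - 1 \<in> ?W" by (simp add: ideal.span_base)
      then have "1 - tvar k \<in> ?W" using ideal.span_neg by fastforce
      then show "lift_xy i j (dehom_xy i j (Var x)) - Cst (Var x) \<in> ?W" for x
        using ijk(4)[of x] ijk(1-3)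
        by (auto simp: dehom_xy_Var lift_xy_simps ideal.span_zero rhom_one[OF rhom_lift_xy])
    qed
    then have "(lift_xy i j (dehom_xy i j g) - Cst g) * h \<in> ?W"
      by (rule subspace_mult_right[OF W])
    moreover have "Cst g * h \<in> ?W" using g(2) by (simp add: ideal.span_base)
    ultimately have "dehom_xy i j g \<in> b"
      using ideal.span_add by (fastforce simp: b_def left_diff_distrib)
    then have "poly (poly (dehom_xy i j g) [:c':]) c = 0" by (rule zero)
    moreover have "poly (poly (dehom_xy i j g) [:c':]) c = ev a g"
      by (rule rhom_eq[OF rhom_comp[OF rhom_dehom_xy rhom_comp[OF rhom_poly rhom_poly]] rhom_ev])
        (use ijk in \<open>auto simp: dehom_xy_Cst dehom_xy_Var ev_simps a_def\<close>)
    ultimately show False using g by simp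
  qed
  then have "h \<in> ?W" by (simp add: b_def rhom_one[OF rhom_lift_xy])
  then obtain z where "h - z * (tvar k - 1) \<in> Q" using ideal_span_insert[OF sub] by blast
  then show ?thesis by (rule homogenize_membership[OF Q h])
qed

lemma projective_nullstellensatz:
  fixes Q :: "'k::alg_closed_field txpol set"
  assumes Q: "T.graded Q" and h: "T.homog n h"
    and loc: "\<And>a. a \<noteq> (\<lambda>_. 0) \<Longrightarrow> \<exists>g. ev a g \<noteq> 0 \<and> Cst g * h \<in> Q"
  obtains N where "\<And>k. tvar k ^ N * h \<in> Q"
proof -
  have sub: "ideal.subspace Q" using Q by (rule T.graded_subspace)
  have "\<exists>N. tvar k ^ N * h \<in> Q" for k
  proof -
    have "\<exists>i j. i \<noteq> j \<and> k \<noteq> i \<and> k \<noteq> j \<and> (\<forall>x. x = i \<or> x = j \<or> x = k)"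
    proof (cases "k = 1")
      case True
      then show ?thesis using exhaust_3 by (intro exI[of _ 2] exI[of _ 3]) auto
    next
      case False
      show ?thesis
      proof (cases "k = 2")
        case True
        then show ?thesis using exhaust_3 by (intro exI[of _ 1] exI[of _ 3]) auto
      next
        case False
        then have "k = 3" using exhaust_3[of k] \<open>k \<noteq> 1\<close> by blast
        then show ?thesis using exhaust_3 by (intro exI[of _ 1] exI[of _ 2]) auto
      qed
    qed
    then show ?thesis using projective_nullstellensatz_chart[OF Q h _ _ _ _ loc] by blast
  qed
  then obtain N where N: "\<And>k. tvar k ^ N k * h \<in> Q" by metis
  have "tvar k ^ (\<Sum>k\<in>UNIV. N k) * h \<in> Q" for k
  proof -
    have "N k \<le> (\<Sum>k\<in>UNIV. N k)" by (simp add: member_le_sum)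
    then have "tvar k ^ (\<Sum>k\<in>UNIV. N k) * h =
        tvar k ^ ((\<Sum>k\<in>UNIV. N k) - N k) * (tvar k ^ N k * h)"
      by (simp flip: mult.assoc power_add)
    then show ?thesis using N ideal.subspace_scale[OF sub] by metis
  qed
  then show thesis by (rule that)
qed

section \<open>Linear forms and syzygies\<close>

abbreviation linform :: "('i::finite \<Rightarrow> 'a) \<Rightarrow> ('i, 'a::comm_ring_1) mpol"
  where "linform a \<equiv> \<Sum>i\<in>UNIV. Cst (a i) * Var i"

lemma lookup_linform: "Poly_Mapping.lookup (linform a) (Poly_Mapping.single j 1) = a j"
proof -
  have "Poly_Mapping.lookup (linform a) (Poly_Mapping.single j 1) = (\<Sum>i\<in>UNIV. if i = j then a i else 0)"
    unfolding lookup_sum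
    by (rule sum.cong) (auto simp: lookup_Cst_mult Var_def lookup_single when_def
        dest!: arg_cong[of "Poly_Mapping.single _ _" _ "\<lambda>m. Poly_Mapping.lookup m j"])
  then show ?thesis by simp
qed

lemma linform_eq_iff: "linform a = linform b \<longleftrightarrow> a = b"
proof
  assume eq: "linform a = linform b"
  show "a = b"
  proof
    show "a j = b j" for j
      using lookup_linform[of a j] unfolding eq lookup_linform by simp
  qed
qed simp

lemma linform_eq_0_iff: "linform a = 0 \<longleftrightarrow> a = (\<lambda>_. 0)"
  using linform_eq_iff[of a "\<lambda>_. 0"] by (simp add: Cst_simps)

lemma linform_add: "linform a + linform b = linform (\<lambda>i. a i + b i)"
  by (simp add: Cst_simps distrib_right sum.distrib)

lemma linform_scale: "Cst c * linform a = linform (\<lambda>i. c * a i)"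
  by (simp add: Cst_simps sum_distrib_left mult.assoc)

lemma linform_sum: "(\<Sum>x\<in>A. linform (f x)) = linform (\<lambda>i. \<Sum>x\<in>A. f x i)"
  by (induction A rule: infinite_finite_induct) (simp_all add: Cst_simps distrib_right sum.distrib)

lemma homog_linform: "X.homog 1 (linform a)"
  using X.homog_mult[OF homog_Cst homog_Var] by (auto intro!: X.homog_sum)

lemma homog_1_linform:
  fixes f :: "('i::finite, 'a::comm_ring_1) mpol"
  assumes "X.homog 1 f"
  shows "f = linform (\<lambda>i. Poly_Mapping.lookup f (Poly_Mapping.single i 1))" (is "f = linform ?a")
proof (rule poly_mapping_eqI)
  fix m :: "'i \<Rightarrow>\<^sub>0 nat"
  show "Poly_Mapping.lookup f m = Poly_Mapping.lookup (linform ?a) m"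
  proof (cases "mon_degree m = 1")
    case True
    then obtain i where i: "Poly_Mapping.lookup m i = 1" "\<And>j. i \<noteq> j \<Longrightarrow> Poly_Mapping.lookup m j = 0"
      by (auto simp: mon_degree_def sum_eq_Suc0_iff)
    then have "m = Poly_Mapping.single i 1"
      by (intro poly_mapping_eqI) (auto simp: lookup_single when_def)
    then show ?thesis by (simp only: lookup_linform)
  next
    case False
    have *: "Poly_Mapping.lookup g m = 0" if "X.homog 1 g" for g :: "('i, 'a) mpol"
      using lookup_cmp[of 1 g m] False unfolding X.cmp_self[OF that] by simp
    show ?thesis by (simp only: *[OF assms] *[OF homog_linform])
  qed
qed

lemma subst_linform: "subst s (linform a) = (\<Sum>i\<in>UNIV. Cst (a i) * s i)"
  by (simp add: subst_simps)

lemma syzygies_alt: "syzygies u = {linform a | a. (\<Sum>i\<in>UNIV. a i * u i) = 0}"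
  by (simp add: syzygies_def scale_t_def)

lemma koszul_syzygy: "linform a \<in> syzygies u" if "a = (\<lambda>x. (u i when x = j) - (u j when x = i))"
proof -
  have "(\<Sum>x\<in>UNIV. a x * u x) = (\<Sum>x\<in>UNIV. if x = j then u i * u j else 0) - (\<Sum>x\<in>UNIV. if x = i then u j * u i else 0)"
    unfolding sum_subtractf[symmetric] by (rule sum.cong) (auto simp: that when_def left_diff_distrib)
  also have "\<dots> = 0" by (simp add: mult.commute)
  finally show ?thesis by (auto simp: syzygies_alt)
qed

lemma linform_when: "linform (\<lambda>x. (c when x = j) - (e when x = i)) = Cst c * Var j - Cst e * Var i"
proof -
  have "linform (\<lambda>x. (c when x = j) - (e when x = i)) =
      (\<Sum>x\<in>UNIV. if x = j then Cst c * Var j else 0) - (\<Sum>x\<in>UNIV. if x = i then Cst e * Var i else 0)"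
    unfolding sum_subtractf[symmetric] by (rule sum.cong) (auto simp: when_def Cst_simps left_diff_distrib)
  then show ?thesis by simp
qed

lemma ideal_span_range:
  fixes u :: "'i::finite \<Rightarrow> 'a::comm_ring_1"
  shows "f \<in> ideal.span (range u) \<longleftrightarrow> (\<exists>c. f = (\<Sum>i\<in>UNIV. c i * u i))"
proof
  assume "f \<in> ideal.span (range u)"
  then show "\<exists>c. f = (\<Sum>i\<in>UNIV. c i * u i)"
  proof (induction f rule: ideal.span_induct_alt)
    case base
    show ?case by (rule exI[of _ "\<lambda>_. 0"]) simp
  next
    case (step e x y)
    then obtain i c where x: "x = u i" and y: "y = (\<Sum>i\<in>UNIV. c i * u i)" by blast
    have "e * u i = (\<Sum>j\<in>UNIV. (e when j = i) * u j)"
    proof -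
      have "(\<Sum>j\<in>UNIV. (e when j = i) * u j) = (\<Sum>j\<in>UNIV. if j = i then e * u i else 0)"
        by (rule sum.cong) auto
      then show ?thesis by simp
    qed
    then have "e * x + y = (\<Sum>j\<in>UNIV. ((e when j = i) + c j) * u j)"
      by (simp add: x y distrib_right sum.distrib)
    then show ?case by (rule exI[where x = "\<lambda>j. (e when j = i) + c j"])
  qed
next
  assume "\<exists>c. f = (\<Sum>i\<in>UNIV. c i * u i)"
  then show "f \<in> ideal.span (range u)"
    by (auto intro!: ideal.span_sum ideal.span_scale intro: ideal.span_base)
qed

section \<open>Local complete intersections\<close>

lemma ev_neq_0D: "ev a g \<noteq> 0 \<Longrightarrow> g \<noteq> 0"
  using rhom_zero[OF rhom_ev] by blast

text \<open>Clearing denominators turns the hypothesis on local rings into statements on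
  polynomials, valid up to factors that do not vanish at \<open>a\<close>. \<open>G\<close> is a
  common denominator for the four \<open>u i\<close>.\<close>

lemma lci_local:
  fixes u :: "4 \<Rightarrow> 'k::field tpol"
  assumes lci: "local_complete_intersection (ideal.span (range u))"
    and u: "\<And>i. homogeneous d (u i)"
    and a: "a \<in> proj_zeros (ideal.span (range u))"
  obtains G \<alpha> \<beta> x y xs ys where
    "ev a G \<noteq> 0" "\<And>i. G * u i = \<alpha> i * x + \<beta> i * y"
    "x = (\<Sum>i\<in>UNIV. xs i * u i)" "y = (\<Sum>i\<in>UNIV. ys i * u i)" "x \<noteq> 0"
    "\<And>r s. r * y = s * x \<Longrightarrow> \<exists>g z. ev a g \<noteq> 0 \<and> g * r = z * x"
proof -
  let ?I = "ideal.span (range u)"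
  obtain X Y where reg: "regular_pair (local_ring a) X Y"
    and two: "ideal_at ?I a = two_generated (local_ring a) X Y"
    using lci a unfolding local_complete_intersection_def by blast
  have reg': "\<exists>s\<in>local_ring a. r = s * X"
    if "r \<in> local_ring a" "\<exists>s\<in>local_ring a. r * Y = s * X" for r
    using reg that by (simp add: regular_pair_def)
  obtain k where k: "a k \<noteq> 0" using a by (auto simp: proj_zeros_def)
  have hom_tk: "homogeneous n (Var k ^ n :: 'k tpol)" for n
  proof -
    have "X.homog (1 * n) (Var k ^ n :: 'k tpol)" by (rule X.homog_power[OF homog_Var])
    then show ?thesis by (simp add: homogeneous_iff)
  qed
  have ev_tk: "ev a (Var k ^ n) \<noteq> 0" for n
    using k by (simp add: ev_simps)
  have hom_mult: "homogeneous (m + n) (f * g)" if "homogeneous m f" "homogeneous n g"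
    for m n and f g :: "'k tpol" using that X.homog_mult by (simp add: homogeneous_iff)
  have in_local: "Fract f g \<in> local_ring a" if "homogeneous n f" "homogeneous n g" "ev a g \<noteq> 0" for f g n
    using that unfolding ideal_at_def by blast
  have local_E: "\<exists>f g. q = Fract f g \<and> ev a g \<noteq> 0" if "q \<in> local_ring a" for q
    using that unfolding ideal_at_def by blast
  have one: "1 \<in> local_ring a" and zero: "0 \<in> local_ring a"
    using in_local[of 0 1 1] in_local[of 0 0 1]
    by (simp_all add: homogeneous_iff X.homog_1 ev_simps One_fract_def Zero_fract_def)
  have "X \<in> ideal_at ?I a" "Y \<in> ideal_at ?I a"
    unfolding two two_generated_def using one zero by force+
  then obtain fx gx m fy gy n where
    X: "X = Fract fx gx" "fx \<in> ?I" "homogeneous m fx" "homogeneous m gx" "ev a gx \<noteq> 0" and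
    Y: "Y = Fract fy gy" "fy \<in> ?I" "homogeneous n fy" "homogeneous n gy" "ev a gy \<noteq> 0"
    unfolding ideal_at_def by auto
  \<comment> \<open>Cross-multiplication gives \<open>x\<close>, \<open>y\<close> and
    \<open>g\<close> the same degree, so that a relation between \<open>x\<close> and
    \<open>y\<close> splits into components with matching degrees.\<close>
  define x y g where "x = fx * gy" "y = fy * gx" "g = gx * gy"
  note xyg = this
  have gx: "gx \<noteq> 0" and gy: "gy \<noteq> 0" using X(5) Y(5) ev_neq_0D by blast+
  have ev_g: "ev a g \<noteq> 0" using X(5) Y(5) by (simp add: xyg ev_simps)
  have g: "g \<noteq> 0" using ev_g by (rule ev_neq_0D)
  have Xg: "X = Fract x g" and Yg: "Y = Fract y g"
    using gx gy by (simp_all add: X(1) Y(1) xyg eq_fract mult_ac)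
  have hx: "homogeneous (m + n) x" and hy: "homogeneous (m + n) y" and hg: "homogeneous (m + n) g"
    using hom_mult X(3,4) Y(3,4) by (simp_all add: xyg) (metis add.commute)
  have "x \<in> ?I" "y \<in> ?I"
    using X(2) Y(2) by (simp_all add: xyg subspace_mult_right)
  then obtain xs ys where xs: "x = (\<Sum>i\<in>UNIV. xs i * u i)" and ys: "y = (\<Sum>i\<in>UNIV. ys i * u i)"
    unfolding ideal_span_range by blast
  have "X \<noteq> 0" using reg one by (auto simp: regular_pair_def)
  then have x0: "x \<noteq> 0" using g by (auto simp: Xg Zero_fract_def eq_fract)
  have "\<exists>G \<alpha> \<beta>. ev a G \<noteq> 0 \<and> G * u i = \<alpha> * x + \<beta> * y" for i
  proof -
    have "Fract (u i) (Var k ^ d) \<in> ideal_at ?I a"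
    proof -
      have "u i \<in> ?I" by (simp add: ideal.span_base)
      then show ?thesis
        unfolding ideal_at_def using u[of i] hom_tk[of d] ev_tk[of d] by blast
    qed
    then obtain r s where "r \<in> local_ring a" "s \<in> local_ring a"
      and eq: "Fract (u i) (Var k ^ d) = r * X + s * Y"
      unfolding two two_generated_def by blast
    then obtain r1 r2 s1 s2 where r: "r = Fract r1 r2" "ev a r2 \<noteq> 0" and s: "s = Fract s1 s2" "ev a s2 \<noteq> 0"
      using local_E by metis
    have nz: "r2 \<noteq> 0" "s2 \<noteq> 0" using r(2) s(2) ev_neq_0D by blast+
    let ?t = "Var k ^ d :: 'k tpol"
    have "Fract (u i) ?t = Fract (r1 * x * (s2 * g) + s1 * y * (r2 * g)) (r2 * g * (s2 * g))"
      using nz g by (simp add: eq r(1) s(1) Xg Yg)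
    then have "u i * (r2 * g * (s2 * g)) = (r1 * x * (s2 * g) + s1 * y * (r2 * g)) * ?t"
      using nz g by (simp add: eq_fract)
    then have "(r2 * g * (s2 * g)) * u i = (r1 * (s2 * g) * ?t) * x + (s1 * (r2 * g) * ?t) * y"
      by (simp add: algebra_simps)
    moreover have "ev a (r2 * g * (s2 * g)) \<noteq> 0" using r(2) s(2) ev_g by (simp add: ev_simps)
    ultimately show ?thesis by blast
  qed
  then obtain G \<alpha> \<beta> where G: "\<And>i. ev a (G i) \<noteq> 0" "\<And>i. G i * u i = \<alpha> i * x + \<beta> i * y" by metis
  have eqG: "(\<Prod>j\<in>UNIV. G j) * u i =
      (\<alpha> i * (\<Prod>j\<in>UNIV - {i}. G j)) * x + (\<beta> i * (\<Prod>j\<in>UNIV - {i}. G j)) * y" for i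
  proof -
    have "(\<Prod>j\<in>UNIV. G j) * u i = (\<Prod>j\<in>UNIV - {i}. G j) * (G i * u i)"
      unfolding prod.remove[OF finite UNIV_I[of i]] by (simp only: mult_ac)
    also have "\<dots> = (\<alpha> i * (\<Prod>j\<in>UNIV - {i}. G j)) * x + (\<beta> i * (\<Prod>j\<in>UNIV - {i}. G j)) * y"
      by (simp add: G(2) algebra_simps)
    finally show ?thesis .
  qed
  have evG: "ev a (\<Prod>j\<in>UNIV. G j) \<noteq> 0" using G(1) by (simp add: ev_simps)
  have "\<exists>h z. ev a h \<noteq> 0 \<and> h * r = z * x" if rs: "r * y = s * x" for r s
  proof -
    \<comment> \<open>\<open>r\<close> and \<open>s\<close> are arbitrary, whereas the local ring
      contains only quotients of forms of equal degree. So the relation is split into components,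
      and each is divided by a power of a coordinate that is nonzero at \<open>a\<close>.\<close>
    have cmp: "X.cmp l r * y = X.cmp l s * x" for l
    proof -
      have "X.cmp (m + n + l) (y * r) = X.cmp (m + n + l) (x * s)" using rs by (simp add: mult.commute)
      then have "y * X.cmp l r = x * X.cmp l s"
        using hx hy by (simp add: homogeneous_iff X.cmp_homog_mult)
      then show ?thesis by (simp only: mult.commute)
    qed
    have piece: "\<exists>h z. ev a h \<noteq> 0 \<and> h * X.cmp l r = z * x" for l
    proof -
      let ?t = "Var k ^ l :: 'k tpol"
      have t: "?t \<noteq> 0" using ev_tk ev_neq_0D by blast
      have R: "Fract (X.cmp l r) ?t \<in> local_ring a" "Fract (X.cmp l s) ?t \<in> local_ring a"
        by (rule in_local[OF _ hom_tk ev_tk]; simp add: homogeneous_iff X.homog_cmp)+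
      have "Fract (X.cmp l r) ?t * Y = Fract (X.cmp l s) ?t * X"
        using t g by (simp add: Xg Yg cmp)
      then have "\<exists>s\<in>local_ring a. Fract (X.cmp l r) ?t * Y = s * X" using R(2) by (rule bexI)
      then have "\<exists>s\<in>local_ring a. Fract (X.cmp l r) ?t = s * X" by (rule reg'[OF R(1)])
      then obtain q where q: "q \<in> local_ring a" "Fract (X.cmp l r) ?t = q * X" ..
      obtain e f where ef: "q = Fract e f" and f: "ev a f \<noteq> 0" using local_E[OF q(1)] by blast
      have "Fract (X.cmp l r) ?t = Fract e f * Fract x g" using q(2) by (simp only: ef Xg)
      moreover have "f \<noteq> 0" using f by (rule ev_neq_0D)
      ultimately have "X.cmp l r * (f * g) = e * x * ?t"
        using t g by (simp add: eq_fract)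
      then have "(f * g) * X.cmp l r = (e * ?t) * x" by (simp add: mult_ac)
      moreover have "ev a (f * g) \<noteq> 0" using f ev_g by (simp add: ev_simps)
      ultimately show ?thesis by blast
    qed
    have "\<exists>h z. ev a h \<noteq> 0 \<and> h * (\<Sum>l\<le>N. X.cmp l r) = z * x" for N
    proof (induction N)
      case 0
      show ?case using piece[of 0] by simp
    next
      case (Suc N)
      then obtain h z h' z' where "ev a h \<noteq> 0" "h * (\<Sum>l\<le>N. X.cmp l r) = z * x"
        "ev a h' \<noteq> 0" "h' * X.cmp (Suc N) r = z' * x"
        using piece[of "Suc N"] by blast
      moreover from this have "(h * h') * (\<Sum>l\<le>Suc N. X.cmp l r) = (h' * z + h * z') * x"
        by (simp add: algebra_simps)
      ultimately show ?case by (metis ev_simps(3) mult_eq_0_iff)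
    qed
    then show ?thesis using X.sum_cmp[OF order_refl, of r] by metis
  qed
  then show thesis by (rule that[OF evG eqG xs ys x0])
qed

section \<open>Divisibility by constants, and elimination of one X variable\<close>

lemma Cst_dvd_iff: "Cst b dvd f \<longleftrightarrow> (\<forall>m. b dvd Poly_Mapping.lookup f m)"
  for f :: "('i::finite, 'a::comm_ring_1) mpol"
proof
  assume "Cst b dvd f"
  then show "\<forall>m. b dvd Poly_Mapping.lookup f m" by (auto simp: dvd_def lookup_Cst_mult)
next
  assume "\<forall>m. b dvd Poly_Mapping.lookup f m"
  then have "\<forall>m. \<exists>c. Poly_Mapping.lookup f m = b * c" by (simp add: dvd_def)
  then obtain c where c: "\<And>m. Poly_Mapping.lookup f m = b * c m" by metis
  have "f = (\<Sum>m\<in>Poly_Mapping.keys f. Poly_Mapping.single m (b * c m))"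
    by (subst mpol_as_sum) (simp only: c)
  also have "\<dots> = Cst b * (\<Sum>m\<in>Poly_Mapping.keys f. Poly_Mapping.single m (c m))"
    by (simp add: Cst_def sum_distrib_left mult_single)
  finally show "Cst b dvd f" by (rule dvdI)
qed

text \<open>If \<open>l\<close> is the coefficient of X_i in the linear form \<open>q\<close>, this
  substitution is \<open>l\<close> times solving q = 0 for X_i; in particular it maps
  \<open>q\<close> to 0.\<close>

lemma subst_elim:
  "subst (\<lambda>x. Cst l * Var x - (q when x = i)) (linform C) = Cst l * linform C - Cst (C i) * q"
proof -
  have "subst (\<lambda>x. Cst l * Var x - (q when x = i)) (linform C) =
      Cst l * linform C - (\<Sum>x\<in>UNIV. if x = i then Cst (C x) * q else 0)"
    unfolding subst_linform sum_distrib_left sum_subtractf[symmetric]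
    by (rule sum.cong) (auto simp: algebra_simps)
  then show ?thesis by simp
qed

lemma elim_mem: "ideal.subspace Q \<Longrightarrow> q \<in> Q \<Longrightarrow> (Cst l * Var x - (q when x = i)) - Cst l * Var x \<in> Q"
  by (auto simp: when_def ideal.subspace_0 ideal.subspace_neg)

lemma subst_elim_eq_0_imp:
  fixes B :: "4 \<Rightarrow> 'k::idom tpol"
  assumes f: "subst (\<lambda>x. Cst (B i) * Var x - (linform B when x = i)) f = 0"
  shows "\<exists>N. linform B dvd Cst (B i ^ N) * f"
proof -
  have Q: "X.graded (ideal.span {linform B})"
    using homog_linform[of B] by (intro X.graded_span) auto
  have "(Cst (B i) * Var x - (linform B when x = i)) - Cst (B i) * Var x \<in> ideal.span {linform B}" for x
    by (rule elim_mem[OF ideal.subspace_span]) (simp add: ideal.span_base)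
  from subst_mem_graded[OF Q this, of f 1]
  have "\<exists>N. Cst (B i ^ N * 1) * f \<in> ideal.span {linform B}"
    by (simp add: f ideal.span_zero)
  then show ?thesis by (simp add: ideal_span_singleton)
qed

text \<open>Elimination maps \<open>linform B\<close> to 0 and takes place in a domain, so
  \<open>c\<close> can be cancelled there.\<close>

lemma torsion_principal:
  fixes B :: "4 \<Rightarrow> 'k::idom tpol"
  assumes "linform B dvd Cst c * f" "c \<noteq> 0"
  shows "\<exists>N. linform B dvd Cst (B i ^ N) * f"
proof (rule subst_elim_eq_0_imp)
  let ?s = "subst (\<lambda>x. Cst (B i) * Var x - (linform B when x = i))"
  obtain z where "Cst c * f = linform B * z" using assms(1) by (rule dvdE)
  then have "?s (Cst c * f) = ?s (linform B) * ?s z" by (simp only: rhom_mult[OF rhom_subst])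
  then have "Cst c * ?s f = 0" unfolding subst_elim by (simp add: rhom_mult[OF rhom_subst])
  then show "?s f = 0" using assms(2) by simp
qed

lemma ideal_span_pair: "x \<in> ideal.span {p, q} \<longleftrightarrow> (\<exists>a b. x = a * p + b * q)"
  by (auto simp: ideal.span_breakdown_eq ideal_span_singleton dvd_def algebra_simps diff_eq_eq)

section \<open>The mu-basis and the rank of its first two rows\<close>

locale mu_basis_setup =
  fixes u :: "4 \<Rightarrow> 'k::alg_closed_field tpol"
    and p :: "3 \<Rightarrow> 'k txpol"
    and \<mu> :: "3 \<Rightarrow> nat"
    and d :: nat
    and L1 L2 :: "3 \<Rightarrow> 'k txpol"
  assumes u_homogeneous: "\<And>i. homogeneous d (u i)"
    and lci: "local_complete_intersection (ideal.span (range u))"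
    and basis: "mu_basis u p \<mu>"
    and mu_1: "\<mu> 1 = 1" and mu_2: "\<mu> 2 = 1"
    and L1: "\<And>j. bihomogeneous 0 1 (L1 j)" "p 1 = L1 1 * tvar 1 + L1 2 * tvar 2 + L1 3 * tvar 3"
    and L2: "\<And>j. bihomogeneous 0 1 (L2 j)" "p 2 = L2 1 * tvar 1 + L2 2 * tvar 2 + L2 3 * tvar 3"
begin

definition P :: "3 \<Rightarrow> 4 \<Rightarrow> 'k tpol"
  where "P r i = Poly_Mapping.lookup (p r) (Poly_Mapping.single i 1)"

lemma homog_p: "X.homog 1 (p r)" and thomog_p: "T.homog (\<mu> r) (p r)"
  using basis by (simp_all add: mu_basis_def bihomogeneous_iff)

lemma p_eq: "p r = linform (P r)"
  unfolding P_def by (rule homog_1_linform[OF homog_p])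

lemma sum_range_p: "(\<Sum>v\<in>range p. f v) = (\<Sum>r\<in>UNIV. f (p r))"
  using basis by (subst sum.reindex) (auto simp: mu_basis_def)

lemma combination_p: "(\<Sum>r\<in>UNIV. Cst (w r) * p r) = linform (\<lambda>i. \<Sum>r\<in>UNIV. w r * P r i)"
  by (simp only: p_eq linform_scale linform_sum)

lemma independent_p:
  assumes "(\<Sum>r\<in>UNIV. Cst (w r) * p r) = 0"
  shows "w r = 0"
proof -
  have inj: "inj p" and ind: "tmod.independent (range p)" using basis by (simp_all add: mu_basis_def)
  have "(\<Sum>v\<in>range p. scale_t (w (inv p v)) v) = 0"
    unfolding sum_range_p using assms by (simp add: inv_f_f[OF inj] scale_t_def)
  then have "w (inv p (p r)) = 0"
    by (intro tmod.independentD[OF ind, of "range p" "\<lambda>v. w (inv p v)"]) auto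
  then show ?thesis by (simp add: inv_f_f[OF inj])
qed

lemma syzygy_combination:
  assumes "(\<Sum>i\<in>UNIV. a i * u i) = 0"
  shows "\<exists>w. \<forall>i. a i = (\<Sum>r\<in>UNIV. w r * P r i)"
proof -
  have "linform a \<in> tmod.span (range p)"
    using basis assms by (auto simp: mu_basis_def syzygies_alt)
  then obtain w where "linform a = (\<Sum>v\<in>range p. scale_t (w v) v)"
    by (auto simp: tmod.span_finite)
  then have "linform a = linform (\<lambda>i. \<Sum>r\<in>UNIV. w (p r) * P r i)"
    by (simp only: sum_range_p scale_t_def combination_p)
  then have "a = (\<lambda>i. \<Sum>r\<in>UNIV. w (p r) * P r i)" by (simp only: linform_eq_iff)
  then show ?thesis by (intro exI[of _ "\<lambda>r. w (p r)"]) (simp add: fun_eq_iff)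
qed

lemma P_syzygy: "(\<Sum>i\<in>UNIV. P r i * u i) = 0"
proof -
  have "p r \<in> syzygies u" using basis tmod.span_base[OF rangeI, of p r] by (simp add: mu_basis_def)
  then obtain a where "p r = linform a" "(\<Sum>i\<in>UNIV. a i * u i) = 0" by (auto simp: syzygies_alt)
  moreover from this have "P r = a" by (simp only: p_eq linform_eq_iff)
  ultimately show ?thesis by simp
qed

lemma independent_12:
  assumes "\<And>i. v1 * P 1 i + v2 * P 2 i = 0"
  shows "v1 = 0" "v2 = 0"
proof -
  define w where "w r = (if r = 1 then v1 else if r = 2 then v2 else 0)" for r :: 3
  have "(\<Sum>r\<in>UNIV. Cst (w r) * p r) = 0"
    unfolding combination_p using assms by (simp add: sum_3 w_def Cst_simps)
  from independent_p[OF this] have "w 1 = 0" "w 2 = 0" by blast+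
  then show "v1 = 0" "v2 = 0" by (simp_all add: w_def)
qed

lemma independent_12':
  assumes "Cst v1 * p 1 + Cst v2 * p 2 = 0"
  shows "v1 = 0" "v2 = 0"
proof -
  have "linform (\<lambda>i. v1 * P 1 i + v2 * P 2 i) = 0"
    using assms by (simp only: p_eq linform_scale linform_add)
  then have "v1 * P 1 i + v2 * P 2 i = 0" for i by (simp only: linform_eq_0_iff) meson
  then show "v1 = 0" "v2 = 0" using independent_12 by blast+
qed

lemma p_neq_0: "p r \<noteq> 0"
proof
  assume "p r = 0"
  then have "(\<Sum>x\<in>UNIV. Cst (1 when x = r) * p x) = 0"
    by (intro sum.neutral) (auto simp: Cst_simps when_def)
  from independent_p[OF this, of r] show False by simp
qed

text \<open>
  Freeness of the syzygy module makes \<open>p\<^sub>1, p\<^sub>2\<close> independent modulo every \<open>b \<noteq> 0\<close>; hence, by McCoy's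
  argument, no \<open>a\<close> that is nonzero modulo \<open>b\<close> annihilates all the minors modulo \<open>b\<close>.
\<close>

lemma grade_pair:
  assumes b: "b \<noteq> 0" and dvd: "\<And>i. b dvd v1 * P 1 i + v2 * P 2 i"
  shows "b dvd v1" "b dvd v2"
proof -
  have "\<forall>i. \<exists>z. v1 * P 1 i + v2 * P 2 i = b * z" using dvd by (simp add: dvd_def)
  then obtain z where z: "\<And>i. v1 * P 1 i + v2 * P 2 i = b * z i" by metis
  have "b * (\<Sum>i\<in>UNIV. z i * u i) = (\<Sum>i\<in>UNIV. (v1 * P 1 i + v2 * P 2 i) * u i)"
    by (simp add: z sum_distrib_left mult.assoc)
  also have "\<dots> = v1 * (\<Sum>i\<in>UNIV. P 1 i * u i) + v2 * (\<Sum>i\<in>UNIV. P 2 i * u i)"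
    by (simp add: sum_distrib_left distrib_right sum.distrib mult.assoc)
  finally have "(\<Sum>i\<in>UNIV. z i * u i) = 0" using b by (simp add: P_syzygy)
  then obtain w where w: "\<And>i. z i = (\<Sum>r\<in>UNIV. w r * P r i)" using syzygy_combination by blast
  define v where "v r = (if r = 1 then v1 - b * w 1 else if r = 2 then v2 - b * w 2 else - b * w 3)" for r :: 3
  have "(\<Sum>r\<in>UNIV. v r * P r i) = 0" for i
    using z[of i] unfolding w by (simp add: sum_3 v_def algebra_simps)
  then have "(\<Sum>r\<in>UNIV. Cst (v r) * p r) = 0" unfolding combination_p by (simp add: Cst_simps)
  from independent_p[OF this] have "v 1 = 0" "v 2 = 0" by blast+
  then show "b dvd v1" "b dvd v2" by (simp_all add: v_def)
qed

lemma grade_minors: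
  assumes b: "b \<noteq> 0" and dvd: "\<And>i j. b dvd a * (P 1 i * P 2 j - P 1 j * P 2 i)"
  shows "b dvd a"
proof -
  have "b dvd a * P 1 i" for i
  proof (rule grade_pair(2)[OF b])
    show "b dvd (- (a * P 2 i)) * P 1 j + (a * P 1 i) * P 2 j" for j
      using dvd[of i j] by (simp add: algebra_simps)
  qed
  then show ?thesis using grade_pair(1)[OF b, of a 0] by simp
qed

lemma grade_minors_tx:
  fixes f :: "'k txpol"
  assumes b: "b \<noteq> 0" and dvd: "\<And>i j. Cst b dvd Cst (P 1 i * P 2 j - P 1 j * P 2 i) * f"
  shows "Cst b dvd f"
  unfolding Cst_dvd_iff
proof
  fix m
  show "b dvd Poly_Mapping.lookup f m"
  proof (rule grade_minors[OF b])
    fix i j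
    have "b dvd (P 1 i * P 2 j - P 1 j * P 2 i) * Poly_Mapping.lookup f m"
      using dvd[of i j] unfolding Cst_dvd_iff lookup_Cst_mult by blast
    then show "b dvd Poly_Mapping.lookup f m * (P 1 i * P 2 j - P 1 j * P 2 i)"
      by (subst mult.commute)
  qed
qed

text \<open>Where the first two rows vanish, all syzygies specialize into the line spanned by the
  third. \<open>rows_nonvanishing\<close> refutes this by exhibiting syzygies whose values have
  larger rank.\<close>

lemma ev_syzygy:
  assumes "\<And>i. ev a (P 1 i) = 0" "\<And>i. ev a (P 2 i) = 0" and "(\<Sum>i\<in>UNIV. c i * u i) = 0"
  shows "\<exists>s. \<forall>i. ev a (c i) = s * ev a (P 3 i)"
proof -
  obtain w where "\<And>i. c i = (\<Sum>r\<in>UNIV. w r * P r i)" using syzygy_combination[OF assms(3)] by blast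
  then have "\<forall>i. ev a (c i) = ev a (w 3) * ev a (P 3 i)"
    by (simp add: sum_3 ev_simps assms(1,2))
  then show ?thesis ..
qed

text \<open>Away from the zeros of \<open>u\<close>, Koszul syzygies already have independent
  values. At a zero, writing each \<open>u i\<close> through the two local generators gives four
  syzygies; if they specialized into one line, the four unit vectors would lie in the span of
  \<open>xs\<close>, \<open>ys\<close> and the third row.\<close>

lemma rows_nonvanishing:
  assumes a: "a \<noteq> (\<lambda>_. 0)"
  shows "\<exists>r i. (r = 1 \<or> r = 2) \<and> ev a (P r i) \<noteq> 0"
proof (rule ccontr)
  assume "\<not> ?thesis"
  then have P0: "\<And>i. ev a (P 1 i) = 0" "\<And>i. ev a (P 2 i) = 0" by blast+
  have u0: "ev a (u i) = 0" for i
  proof (rule ccontr)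
    assume ui: "ev a (u i) \<noteq> 0"
    have *: "\<exists>s. \<forall>x. ev a ((u i when x = j) - (u j when x = i)) = s * ev a (P 3 x)" for j
    proof (rule ev_syzygy[OF P0])
      show "(\<Sum>x\<in>UNIV. ((u i when x = j) - (u j when x = i)) * u x) = 0"
        using koszul_syzygy[of _ u i j, OF refl] unfolding syzygies_alt
        by (auto simp: linform_eq_iff)
    qed
    \<comment> \<open>Addition on the index type is cyclic modulo 4, so \<open>i\<close>,
      \<open>i + 1\<close> and \<open>i + 2\<close> are distinct.\<close>
    obtain j k where jk: "j \<noteq> i" "k \<noteq> i" "j \<noteq> k"
      by (rule that[of "i + 1" "i + 2"]) simp_all
    obtain s where s: "\<And>x. ev a ((u i when x = j) - (u j when x = i)) = s * ev a (P 3 x)" using * by blast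
    \<comment> \<open>The Koszul syzygy of \<open>i\<close> and \<open>j\<close> has the entry
      \<open>u i\<close> at \<open>j\<close> and 0 at \<open>k\<close>, so the third row must vanish
      at \<open>k\<close>; the syzygy of \<open>i\<close> and \<open>k\<close> contradicts
      this.\<close>
    have "ev a (u i) = s * ev a (P 3 j)" "0 = s * ev a (P 3 k)"
      using s[of j] s[of k] jk by (simp_all add: ev_simps)
    then have "ev a (P 3 k) = 0" using ui by auto
    moreover obtain s' where s': "\<And>x. ev a ((u i when x = k) - (u k when x = i)) = s' * ev a (P 3 x)" using * by blast
    ultimately show False using s'[of k] jk ui by (simp add: ev_simps)
  qed
  have a_zero: "a \<in> proj_zeros (ideal.span (range u))"
    using a by (auto simp: proj_zeros_def ideal_span_range ev_simps u0)
  obtain G \<alpha> \<beta> x y xs ys where G: "ev a G \<noteq> 0" "\<And>i. G * u i = \<alpha> i * x + \<beta> i * y"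
    "x = (\<Sum>i\<in>UNIV. xs i * u i)" "y = (\<Sum>i\<in>UNIV. ys i * u i)"
    by (rule lci_local[OF lci u_homogeneous a_zero]) (rule that)
  have "\<exists>s. \<forall>j. ev a ((G when j = i) - \<alpha> i * xs j - \<beta> i * ys j) = s * ev a (P 3 j)" for i
  proof (rule ev_syzygy[OF P0])
    have "(\<Sum>j\<in>UNIV. ((G when j = i) - \<alpha> i * xs j - \<beta> i * ys j) * u j) =
        (\<Sum>j\<in>UNIV. (if j = i then G * u i else 0)) - (\<alpha> i * x + \<beta> i * y)"
      unfolding G(3,4) sum_distrib_left sum.distrib[symmetric] sum_subtractf[symmetric]
      by (rule sum.cong) (auto simp: algebra_simps)
    then show "(\<Sum>j\<in>UNIV. ((G when j = i) - \<alpha> i * xs j - \<beta> i * ys j) * u j) = 0"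
      by (simp add: G(2))
  qed
  then obtain s where s: "\<And>i j. ev a ((G when j = i) - \<alpha> i * xs j - \<beta> i * ys j) = s i * ev a (P 3 j)" by metis
  txt \<open>Up to the factor \<open>G(a)\<close>, the identity matrix of size \<open>4\<close> would have rank at most \<open>3\<close>.\<close>
  define A :: "'k^4^4" where
    "A = (\<chi> i j. if j = 1 then ev a (\<alpha> i) else if j = 2 then ev a (\<beta> i) else if j = 3 then s i else 0)"
  define B :: "'k^4^4" where
    "B = (\<chi> i j. (if i = 1 then ev a (xs j) else if i = 2 then ev a (ys j) else ev a (P 3 j)) / ev a G)"
  have "(A ** B) $ i $ j = (if i = j then 1 else 0)" for i j
    using s[of j i] G(1)
    by (auto simp: A_def B_def matrix_matrix_mult_def sum_4 ev_simps when_def divide_simps algebra_simps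
        split: if_splits)
  then have "A ** B = mat 1" by (simp add: vec_eq_iff mat_def)
  then have "det A * det B = 1" by (metis det_mul det_I)
  moreover have "column 4 A = 0" by (simp add: vec_eq_iff column_def A_def)
  then have "det A = 0" by (rule det_zero_column(2))
  ultimately show False by simp
qed

end

section \<open>The ideal of the two linear forms\<close>

context mu_basis_setup
begin

text \<open>Eliminating X_i by means of \<open>p r\<close> leaves of the other form one whose
  coefficients are the 2 by 2 minors through column \<open>i\<close>. Independence of the rows keeps
  it nonzero.\<close>

lemma elim_other:
  assumes r: "r = 1 \<and> r' = 2 \<or> r = 2 \<and> r' = (1::3)" and nz: "P r i \<noteq> 0"
  shows "subst (\<lambda>x. Cst (P r i) * Var x - (p r when x = i)) (p r) = 0"
    and "subst (\<lambda>x. Cst (P r i) * Var x - (p r when x = i)) (p r') =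
      linform (\<lambda>j. P r i * P r' j - P r' i * P r j)"
    and "linform (\<lambda>j. P r i * P r' j - P r' i * P r j) \<noteq> 0"
    and "linform (\<lambda>j. P r i * P r' j - P r' i * P r j) = Cst (P r i) * p r' - Cst (P r' i) * p r"
proof -
  let ?q = "linform (\<lambda>j. P r i * P r' j - P r' i * P r j)"
  have s: "subst (\<lambda>x. Cst (P r i) * Var x - (q when x = i)) (p s) = Cst (P r i) * p s - Cst (P s i) * q"
    for q s using subst_elim[of "P r i" q i "P s"] by (simp only: p_eq)
  show "subst (\<lambda>x. Cst (P r i) * Var x - (p r when x = i)) (p r) = 0"
    unfolding s by simp
  show q: "?q = Cst (P r i) * p r' - Cst (P r' i) * p r"
    using linform_add[of "\<lambda>j. P r i * P r' j" "\<lambda>j. - P r' i * P r j"]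
    by (simp only: p_eq linform_scale) (simp add: Cst_simps sum_negf sum_subtractf left_diff_distrib)
  then show "subst (\<lambda>x. Cst (P r i) * Var x - (p r when x = i)) (p r') = ?q"
    unfolding s by simp
  show "?q \<noteq> 0"
  proof
    assume "?q = 0"
    then have eq: "Cst (P r i) * p r' - Cst (P r' i) * p r = 0" unfolding q .
    from r show False
    proof
      assume "r = 1 \<and> r' = 2"
      then have "Cst (- P 2 i) * p 1 + Cst (P 1 i) * p 2 = 0" using eq by (simp add: Cst_simps)
      then show False using independent_12'(2) nz \<open>r = 1 \<and> r' = 2\<close> by blast
    next
      assume "r = 2 \<and> r' = 1"
      then have "Cst (P 2 i) * p 1 + Cst (- P 1 i) * p 2 = 0" using eq by (simp add: Cst_simps)
      then show False using independent_12'(1) nz \<open>r = 2 \<and> r' = 1\<close> by blast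
    qed
  qed
qed

text \<open>At each point some coefficient of a row is nonzero, and elimination with it settles the
  relation up to a power of that coefficient. The Nullstellensatz and the saturation of the ideal of
  \<open>p 2\<close> remove these powers.\<close>

lemma coprime_p1_p2_homog:
  assumes a: "T.homog n a" and eq: "a * p 1 = b * p 2"
  shows "p 2 dvd a"
proof -
  have Q: "T.graded (ideal.span {p 2})"
    using thomog_p[of 2] by (intro T.graded_span) auto
  have "\<exists>g. ev v g \<noteq> 0 \<and> Cst g * a \<in> ideal.span {p 2}" if v: "v \<noteq> (\<lambda>_. 0)" for v
  proof -
    obtain r i where r: "r = 1 \<or> r = 2" and ev: "ev v (P r i) \<noteq> 0"
      using rows_nonvanishing[OF v] by blast
    have nz: "P r i \<noteq> 0" using ev by (rule ev_neq_0D)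
    let ?s = "subst (\<lambda>x. Cst (P r i) * Var x - (p r when x = i))"
    have seq: "?s a * ?s (p 1) = ?s b * ?s (p 2)"
      using eq by (simp only: flip: rhom_mult[OF rhom_subst])
    have "\<exists>N. p 2 dvd Cst (P r i ^ N) * a"
      using r
    proof
      \<comment> \<open>Here elimination kills \<open>p 1\<close>, so it is \<open>b\<close> that
        becomes divisible; the relation transfers this to \<open>a\<close>.\<close>
      assume [simp]: "r = 1"
      have "?s (p 1) = 0" "?s (p 2) \<noteq> 0"
        using elim_other[of 1 2 i] nz by simp_all
      then have "?s b = 0" using seq by simp
      then have "\<exists>N. linform (P r) dvd Cst (P r i ^ N) * b"
        by (intro subst_elim_eq_0_imp) (simp only: p_eq)
      then obtain N z where z: "Cst (P r i ^ N) * b = p 1 * z"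
        by (auto simp flip: p_eq elim: dvdE)
      have "p 1 * (Cst (P r i ^ N) * a) = p 1 * (p 2 * z)"
        using eq z by algebra
      then have "Cst (P r i ^ N) * a = p 2 * z" using p_neq_0[of 1] by simp
      then show ?thesis by (metis dvd_triv_left)
    next
      assume [simp]: "r = 2"
      have "?s (p 2) = 0" "?s (p 1) \<noteq> 0"
        using elim_other[of 2 1 i] nz by simp_all
      then have "?s a = 0" using seq by simp
      then have "\<exists>N. linform (P r) dvd Cst (P r i ^ N) * a"
        by (intro subst_elim_eq_0_imp) (simp only: p_eq)
      then show ?thesis by (simp flip: p_eq)
    qed
    then obtain N where "Cst (P r i ^ N) * a \<in> ideal.span {p 2}" by (auto simp: ideal_span_singleton)
    moreover have "ev v (P r i ^ N) \<noteq> 0" using ev by (simp add: ev_simps)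
    ultimately show ?thesis by blast
  qed
  from projective_nullstellensatz[OF Q a this]
  obtain N where N: "\<And>k. tvar k ^ N * a \<in> ideal.span {p 2}" by blast
  show ?thesis
  proof (rule power_descent[where v = tvar and N = N])
    show "p 2 dvd f * tvar k ^ N * a" for f k
      using N[of k] unfolding ideal_span_singleton mult.assoc by (rule dvd_mult)
  qed (rule tvars.saturated_q[OF p_neq_0])
qed

text \<open>As \<open>p 1\<close> and \<open>p 2\<close> have the same degree in t, the relation
  splits into homogeneous ones.\<close>

lemma coprime_p1_p2:
  assumes eq: "a * p 1 = b * p 2"
  shows "p 2 dvd a"
proof -
  have "T.cmp n a \<in> ideal.span {p 2}" for n
  proof -
    have 1: "T.homog 1 (p 1)" "T.homog 1 (p 2)"
      using thomog_p[of 1] thomog_p[of 2] by (simp_all add: mu_1 mu_2)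
    have "T.cmp (Suc n) (p 1 * a) = T.cmp (Suc n) (p 2 * b)" using eq by (simp add: mult.commute)
    then have "p 1 * T.cmp n a = p 2 * T.cmp n b"
      by (simp add: T.cmp_homog_mult[OF 1(1)] T.cmp_homog_mult[OF 1(2)])
    then have "T.cmp n a * p 1 = T.cmp n b * p 2" by (simp add: mult.commute)
    then show ?thesis unfolding ideal_span_singleton by (rule coprime_p1_p2_homog[OF T.homog_cmp])
  qed
  then have "a \<in> ideal.span {p 2}" by (rule T.gradedI_cmp[OF ideal.subspace_span])
  then show ?thesis by (simp only: ideal_span_singleton)
qed

sublocale K: koszul_pair "tvar 1" "tvar 2" "tvar 3" "L1 1" "L1 2" "L1 3" "L2 1" "L2 2" "L2 3" "p 1" "p 2"
  by unfold_locales (rule L1(2) L2(2) coprime_p1_p2 p_neq_0; assumption?)+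

definition J :: "'k txpol set"
  where "J = ideal.span {p 1, p 2}"

lemma in_J: "x \<in> J \<longleftrightarrow> (\<exists>a b. x = a * p 1 + b * p 2)"
  unfolding J_def by (rule ideal_span_pair)

lemma subspace_J: "ideal.subspace J"
  unfolding J_def by (rule ideal.subspace_span)

lemma J_closed: "0 \<in> J" "x \<in> J \<Longrightarrow> y \<in> J \<Longrightarrow> x + y \<in> J" "x \<in> J \<Longrightarrow> y \<in> J \<Longrightarrow> x - y \<in> J"
  "x \<in> J \<Longrightarrow> c * x \<in> J" "x \<in> J \<Longrightarrow> x * c \<in> J" "x \<in> J \<Longrightarrow> - x \<in> J"
  using subspace_J by (auto simp: ideal.subspace_0 ideal.subspace_add ideal.subspace_diff
      ideal.subspace_scale subspace_mult_right ideal.subspace_neg)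

lemma p_in_J: "p 1 \<in> J" "p 2 \<in> J"
  by (simp_all add: J_def ideal.span_base)

lemma T_graded_J: "T.graded J" and X_graded_J: "X.graded J"
  unfolding J_def using thomog_p homog_p by (auto intro!: T.graded_span X.graded_span)

lemma saturated_J:
  assumes "\<And>k. tvar k * h \<in> J"
  shows "h \<in> J"
proof -
  obtain a1 b1 where "tvar 1 * h = a1 * p 1 + b1 * p 2" using assms unfolding in_J by blast
  moreover obtain a2 b2 where "tvar 2 * h = a2 * p 1 + b2 * p 2" using assms unfolding in_J by blast
  moreover obtain a3 b3 where "tvar 3 * h = a3 * p 1 + b3 * p 2" using assms unfolding in_J by blast
  ultimately show ?thesis unfolding in_J by (rule K.saturated_pq)
qed

lemma power_saturated_J:
  assumes "\<And>k. tvar k ^ N * h \<in> J"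
  shows "h \<in> J"
proof (rule power_descent[where v = tvar and N = N])
  show "f * tvar k ^ N * h \<in> J" for f k
    using assms J_closed(4) by (simp only: mult.assoc)
qed (rule saturated_J)

text \<open>Elimination turns the relation into \<open>Cst c * f = \<eta> * q\<close> with one
  linear form \<open>q\<close>. It remains to divide \<open>\<eta>\<close> by \<open>c\<close>. By
  \<open>torsion_principal\<close> this is possible after multiplication by a power of any
  coefficient \<open>C j\<close> of \<open>q\<close>, and these coefficients, being minors, can be
  stripped off again by \<open>grade_minors_tx\<close>.\<close>

lemma torsion_free_J_local:
  assumes r: "r = 1 \<and> r' = 2 \<or> r = 2 \<and> r' = (1::3)" and nz: "P r i \<noteq> 0"
    and c: "c \<noteq> 0" and mem: "Cst c * x = \<alpha> * p r + \<beta> * p r'"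
  shows "\<exists>N. Cst (P r i ^ N) * x \<in> J"
proof -
  let ?l = "P r i"
  let ?sv = "\<lambda>x. Cst ?l * Var x - (p r when x = i)"
  define C where "C j = P r i * P r' j - P r' i * P r j" for j
  define q where "q = linform C"
  note elim = elim_other[OF r nz, folded C_def, folded q_def]
  define f where "f = subst ?sv x"
  define \<eta> where "\<eta> = subst ?sv \<beta>"
  have "subst ?sv (Cst c * x) = subst ?sv (\<alpha> * p r + \<beta> * p r')" by (simp only: mem)
  then have cf: "Cst c * f = \<eta> * q"
    by (simp add: subst_simps elim f_def \<eta>_def del: subst_Cst) simp
  have "\<exists>N. Cst c dvd Cst (C j ^ N) * \<eta>" for j
  proof -
    have "linform C dvd Cst c * f" unfolding cf q_def by simp
    from torsion_principal[OF this c] obtain N where "linform C dvd Cst (C j ^ N) * f" by blast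
    then obtain z where z: "Cst (C j ^ N) * f = q * z" unfolding q_def by (rule dvdE)
    have "q * (Cst (C j ^ N) * \<eta>) = q * (Cst c * z)" using z cf by algebra
    then have "Cst (C j ^ N) * \<eta> = Cst c * z" using elim(3) by simp
    then show ?thesis by (metis dvd_triv_left)
  qed
  then obtain N where N: "\<And>j. Cst c dvd Cst (C j ^ N j) * \<eta>" by metis
  let ?Z = "\<lambda>g :: 'k txpol. \<exists>M. Cst c dvd Cst (?l ^ M) * g"
  have "?Z \<eta>"
  proof (rule power_descent[where v = "\<lambda>j. Cst (C j)" and N = "sum N UNIV" and Z = ?Z])
    fix g j
    have "N j \<le> sum N UNIV" by (simp add: member_le_sum)
    then have e: "Cst (C j) ^ sum N UNIV = Cst (C j) ^ (sum N UNIV - N j) * Cst (C j ^ N j)"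
      by (simp add: Cst_simps flip: power_add)
    have "Cst (?l ^ 0) * (g * Cst (C j) ^ sum N UNIV * \<eta>) =
        (g * Cst (C j) ^ (sum N UNIV - N j)) * (Cst (C j ^ N j) * \<eta>)"
      unfolding e by (simp add: Cst_simps mult_ac)
    also have "Cst c dvd \<dots>" by (rule dvd_mult[OF N])
    finally show "?Z (g * Cst (C j) ^ sum N UNIV * \<eta>)" by (rule exI)
  next
    fix g :: "'k txpol" assume "\<And>j. ?Z (Cst (C j) * g)"
    then obtain M where M: "\<And>j. Cst c dvd Cst (?l ^ M j) * (Cst (C j) * g)" by metis
    define m where "m = sum M UNIV"
    have Cj: "Cst c dvd Cst (?l ^ m) * (Cst (C j) * g)" for j
    proof -
      have "M j \<le> m" by (simp add: member_le_sum m_def)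
      then have e: "Cst (?l ^ m) = (Cst (?l ^ (m - M j)) * Cst (?l ^ M j) :: 'k txpol)"
        by (simp add: Cst_simps flip: power_add)
      have "Cst (?l ^ m) * (Cst (C j) * g) = Cst (?l ^ (m - M j)) * (Cst (?l ^ M j) * (Cst (C j) * g))"
        unfolding e by (simp only: mult.assoc)
      also have "Cst c dvd \<dots>" by (rule dvd_mult[OF M])
      finally show ?thesis .
    qed
    \<comment> \<open>\<open>?l\<close> times any minor is a combination of the minors
      \<open>C j\<close> through column \<open>i\<close>; this costs the extra power in
      \<open>Suc m\<close>.\<close>
    have minor: "Cst c dvd Cst (P r j * P r' k - P r k * P r' j) * (Cst (?l ^ Suc m) * g)" for j k
    proof -
      have "Cst (P r j * P r' k - P r k * P r' j) * (Cst (?l ^ Suc m) * g) =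
          Cst (P r j) * (Cst (?l ^ m) * (Cst (C k) * g)) - Cst (P r k) * (Cst (?l ^ m) * (Cst (C j) * g))"
        by (simp add: C_def Cst_simps algebra_simps)
      also have "Cst c dvd \<dots>" by (rule dvd_diff[OF dvd_mult[OF Cj] dvd_mult[OF Cj]])
      finally show ?thesis .
    qed
    have "Cst c dvd Cst (?l ^ Suc m) * g"
    proof (rule grade_minors_tx[OF c])
      fix j k
      from r show "Cst c dvd Cst (P 1 j * P 2 k - P 1 k * P 2 j) * (Cst (?l ^ Suc m) * g)"
      proof
        assume "r = 1 \<and> r' = 2"
        then show ?thesis using minor[of j k] by simp
      next
        assume "r = 2 \<and> r' = 1"
        then show ?thesis using minor[of k j] by (simp add: mult.commute)
      qed
    qed
    then show "?Z g" by blast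
  qed
  then obtain M \<gamma> where \<gamma>: "Cst (?l ^ M) * \<eta> = Cst c * \<gamma>" by (auto elim: dvdE)
  have "Cst c * (Cst (?l ^ M) * f) = Cst c * (\<gamma> * q)" using cf \<gamma> by algebra
  then have fM: "f * Cst (?l ^ M) = \<gamma> * q" using c by (simp add: mult.commute)
  have pJ: "p r \<in> J" "p r' \<in> J" using r p_in_J by auto
  then have "q \<in> J" unfolding elim(4) by (intro J_closed)
  then have "f * Cst (?l ^ M) \<in> J" unfolding fM by (rule J_closed)
  then have "\<exists>N. Cst (?l ^ N * ?l ^ M) * x \<in> J"
    unfolding f_def by (rule subst_mem_graded[OF X_graded_J elim_mem[OF subspace_J pJ(1)]])
  then show ?thesis by (auto simp flip: power_add)
qed

lemma torsion_free_J_homog: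
  assumes x: "T.homog n x" and c: "c \<noteq> 0" and mem: "Cst c * x \<in> J"
  shows "x \<in> J"
proof -
  obtain \<alpha> \<beta> where ab: "Cst c * x = \<alpha> * p 1 + \<beta> * p 2" using mem unfolding in_J by blast
  have "\<exists>g. ev v g \<noteq> 0 \<and> Cst g * x \<in> J" if v: "v \<noteq> (\<lambda>_. 0)" for v
  proof -
    obtain r i where r: "r = 1 \<or> r = 2" and ev: "ev v (P r i) \<noteq> 0"
      using rows_nonvanishing[OF v] by blast
    have nz: "P r i \<noteq> 0" using ev by (rule ev_neq_0D)
    from r obtain N where "Cst (P r i ^ N) * x \<in> J"
    proof
      assume "r = 1"
      then show thesis using torsion_free_J_local[of 1 2 i, OF _ _ c ab] nz that by blast
    next
      assume "r = 2"
      moreover have "Cst c * x = \<beta> * p 2 + \<alpha> * p 1" using ab by (simp only: add.commute)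
      ultimately show thesis using torsion_free_J_local[of 2 1 i, OF _ _ c] nz that by blast
    qed
    moreover have "ev v (P r i ^ N) \<noteq> 0" using ev by (simp add: ev_simps)
    ultimately show ?thesis by blast
  qed
  from projective_nullstellensatz[OF T_graded_J x this]
  obtain N where "\<And>k. tvar k ^ N * x \<in> J" by blast
  then show ?thesis by (rule power_saturated_J)
qed

lemma torsion_free_J:
  assumes c: "X.homog m c" "c \<noteq> 0" and mem: "Cst c * x \<in> J"
  shows "x \<in> J"
proof (rule T.gradedI_cmp[OF subspace_J])
  fix n
  have "T.cmp (m + n) (Cst c * x) \<in> J" by (rule T.graded_cmp[OF T_graded_J mem])
  then have "Cst c * T.cmp n x \<in> J" by (simp add: T.cmp_homog_mult[OF thomog_Cst[OF c(1)]])
  then show "T.cmp n x \<in> J" by (rule torsion_free_J_homog[OF T.homog_cmp c(2)])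
qed

lemma homog_P: "X.homog (\<mu> r) (P r i)"
  using thomog_p[of r] by (simp add: P_def flip: thomog_iff homogeneous_iff)

text \<open>\<open>J\<close> contains the kernel of a homomorphism \<open>subst s\<close> into a
  domain that kills both generators.\<close>

lemma prime_J:
  assumes "x * y \<in> J"
  shows "x \<in> J \<or> y \<in> J"
proof -
  obtain i j where D: "P 1 i * P 2 j - P 1 j * P 2 i \<noteq> 0"
  proof (rule ccontr)
    assume "\<not> thesis"
    then have *: "P 1 i * P 2 j - P 1 j * P 2 i = 0" for i j using that by blast
    \<comment> \<open>The rows weighted by \<open>P 2 i\<close> and \<open>- P 1 i\<close> add up to
      a vector of minors, here zero.\<close>
    have "P 2 i = 0" for i
      by (rule independent_12(1)[of _ "- P 1 i"]) (use * in \<open>simp add: algebra_simps\<close>)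
    then show False using p_neq_0[of 2] by (simp add: p_eq Cst_simps)
  qed
  define \<Delta> where "\<Delta> = P 1 i * P 2 j - P 1 j * P 2 i"
  have ij: "i \<noteq> j" using D by auto
  \<comment> \<open>Cramer's rule with the denominator \<open>\<Delta>\<close>: each subtracted form
    has coefficient \<open>\<Delta>\<close> at its own variable and 0 at the other one, so neither
    X_i nor X_j survives.\<close>
  define s where "s x = Cst \<Delta> * Var x - (Cst (P 2 j) * p 1 - Cst (P 1 j) * p 2 when x = i)
      - (Cst (P 1 i) * p 2 - Cst (P 2 i) * p 1 when x = j)" for x
  have sJ: "s x - Cst \<Delta> * Var x \<in> J" for x
  proof -
    have "s x - Cst \<Delta> * Var x = - (Cst (P 2 j) * p 1 - Cst (P 1 j) * p 2 when x = i)
      - (Cst (P 1 i) * p 2 - Cst (P 2 i) * p 1 when x = j)" by (simp add: s_def)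
    also have "\<dots> \<in> J" unfolding when_def by (auto intro!: J_closed(1,2,3,4,6) p_in_J)
    finally show ?thesis .
  qed
  have s_lin: "subst s (linform C) = Cst \<Delta> * linform C - Cst (C i) * (Cst (P 2 j) * p 1 - Cst (P 1 j) * p 2)
      - Cst (C j) * (Cst (P 1 i) * p 2 - Cst (P 2 i) * p 1)" for C
  proof -
    have "subst s (linform C) = Cst \<Delta> * linform C
        - (\<Sum>x\<in>UNIV. if x = i then Cst (C x) * (Cst (P 2 j) * p 1 - Cst (P 1 j) * p 2) else 0)
        - (\<Sum>x\<in>UNIV. if x = j then Cst (C x) * (Cst (P 1 i) * p 2 - Cst (P 2 i) * p 1) else 0)"
      unfolding subst_linform sum_distrib_left sum_subtractf[symmetric] s_def
      by (rule sum.cong) (use ij in \<open>auto simp: algebra_simps\<close>)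
    then show ?thesis by simp
  qed
  have s1: "subst s (p 1) = 0"
    using s_lin[of "P 1", folded p_eq] by (simp add: \<Delta>_def Cst_simps algebra_simps)
  have s2: "subst s (p 2) = 0"
    using s_lin[of "P 2", folded p_eq] by (simp add: \<Delta>_def Cst_simps algebra_simps)
  have hD: "X.homog (m) (\<Delta> ^ N)" if "m = (1 + 1) * N" for m N
    unfolding that \<Delta>_def using homog_P[of 1] homog_P[of 2]
    by (intro X.homog_power X.homog_diff X.homog_mult) (simp_all add: mu_1 mu_2)
  have main: "z \<in> J" if "subst s z = 0" for z
  proof -
    have "\<exists>N. Cst (\<Delta> ^ N * 1) * z \<in> J"
      by (rule subst_mem_graded[OF X_graded_J sJ]) (simp add: that J_closed)
    then obtain N where "Cst (\<Delta> ^ N) * z \<in> J" by auto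
    moreover have "\<Delta> ^ N \<noteq> 0" using D by (simp add: \<Delta>_def)
    ultimately show ?thesis using torsion_free_J[OF hD[OF refl]] by blast
  qed
  obtain a b where "x * y = a * p 1 + b * p 2" using assms unfolding in_J by blast
  then have "subst s (x * y) = subst s (a * p 1 + b * p 2)" by (rule arg_cong)
  then have "subst s x * subst s y = 0" by (simp add: rhom_add[OF rhom_subst] rhom_mult[OF rhom_subst] s1 s2)
  then show ?thesis using main by auto
qed

end

section \<open>The kernel of the Rees map\<close>

lemma rhom_hmap: "rhom (hmap u)"
  unfolding hmap_def by (rule rhom_mpol_eval[OF rhom_const_poly])

lemma hmap_Cst: "hmap u (Cst c) = [:c:]"
  by (simp add: hmap_def mpol_eval_Cst)

lemma hmap_Var: "hmap u (Var i) = monom (u i) 1"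
  unfolding hmap_def by (rule mpol_eval_Var[OF rhom_const_poly])

text \<open>Z records the degree in X, so membership in the kernel can be tested on the values at
  \<open>u\<close> of the components.\<close>

lemma coeff_hmap: "coeff (hmap u h) n = ev u (X.cmp n h)"
proof -
  have "hmap u h = map_poly (ev u) (gr h)"
    by (rule rhom_eq[OF rhom_hmap rhom_comp[OF rhom_gr rhom_map_poly[OF rhom_ev]]])
      (simp_all add: hmap_Cst hmap_Var gr_Cst gr_Var map_poly_const[OF rhom_ev]
        map_poly_monom[OF rhom_ev] ev_simps)
  then show ?thesis by (simp add: coeff_map_poly X.cmp_def rhom_zero[OF rhom_ev])
qed

lemma rees_kernel_iff: "h \<in> rees_kernel u \<longleftrightarrow> (\<forall>n. ev u (X.cmp n h) = 0)"
  by (simp add: rees_kernel_def poly_eq_iff coeff_hmap)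

lemma rees_kernel_homog_iff:
  assumes "X.homog j h"
  shows "h \<in> rees_kernel u \<longleftrightarrow> ev u h = 0"
  by (auto simp: rees_kernel_iff X.cmp_homog[OF assms] rhom_zero[OF rhom_ev] split: if_splits)

lemma subspace_rees_kernel: "ideal.subspace (rees_kernel u)"
  by (rule ideal.subspaceI) (simp_all add: rees_kernel_def rhom_simps[OF rhom_hmap])

lemma rees_kernel_cancel:
  fixes u :: "4 \<Rightarrow> 'k::idom tpol"
  assumes "Cst c * h \<in> rees_kernel u" "c \<noteq> 0"
  shows "h \<in> rees_kernel u"
  using assms by (simp add: rees_kernel_def rhom_mult[OF rhom_hmap] hmap_Cst)

lemma homog_cmp_t:
  fixes h :: "'k::comm_ring_1 txpol"
  assumes "X.homog j h"
  shows "X.homog j (T.cmp n h)"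
  unfolding homogeneous_iff[symmetric] homogeneous_def
proof
  fix m assume "m \<in> Poly_Mapping.keys (T.cmp n h)"
  then have "X.cmp n (Poly_Mapping.lookup h m) \<noteq> 0"
    by (simp add: in_keys_iff lookup_cmp_t)
  then have "Poly_Mapping.lookup h m \<noteq> 0" by auto
  then show "mon_degree m = j"
    using assms by (simp add: homogeneous_def in_keys_iff flip: homogeneous_iff)
qed

lemma homog_ev:
  fixes u :: "4 \<Rightarrow> 'k::comm_ring_1 tpol"
  assumes u: "\<And>i. X.homog d (u i)" and h: "X.homog j h" "T.homog n h"
  shows "X.homog (n + d * j) (ev u h)"
  unfolding mpol_eval_def
proof (rule X.homog_sum)
  fix m assume m: "m \<in> Poly_Mapping.keys h"
  have "mon_degree m = j" using h(1) m by (simp add: homogeneous_def flip: homogeneous_iff)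
  then have "(\<Sum>i\<in>UNIV. d * Poly_Mapping.lookup m i) = d * j"
    by (simp add: mon_degree_def sum_distrib_left[symmetric])
  moreover have "X.homog (\<Sum>i\<in>UNIV. d * Poly_Mapping.lookup m i) (\<Prod>i\<in>UNIV. u i ^ Poly_Mapping.lookup m i)"
    by (rule X.homog_prod) (simp_all add: X.homog_power u)
  moreover have "X.homog n (Poly_Mapping.lookup h m)"
    using h(2) by (simp flip: thomog_iff homogeneous_iff)
  ultimately show "X.homog (n + d * j) (Poly_Mapping.lookup h m * (\<Prod>i\<in>UNIV. u i ^ Poly_Mapping.lookup m i))"
    by (simp add: X.homog_mult)
qed

text \<open>For fixed \<open>j\<close>, the parts of different degree m in t have values at
  \<open>u\<close> of different degrees m + d j, so they cannot cancel.\<close>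

lemma rees_kernel_cmp:
  fixes u :: "4 \<Rightarrow> 'k::comm_ring_1 tpol"
  assumes u: "\<And>i. X.homog d (u i)" and h: "h \<in> rees_kernel u"
  shows "T.cmp n (X.cmp j h) \<in> rees_kernel u"
proof -
  let ?h = "X.cmp j h"
  \<comment> \<open>The maximum makes sure that the index \<open>n\<close> occurs in the
    sum.\<close>
  let ?N = "max n (degree (grt ?h))"
  have hom: "X.homog (m + d * j) (ev u (T.cmp m ?h))" for m
    by (rule homog_ev[OF u homog_cmp_t[OF X.homog_cmp] T.homog_cmp])
  have "0 = ev u ?h" using h by (simp add: rees_kernel_iff)
  also have "ev u ?h = (\<Sum>m\<le>?N. ev u (T.cmp m ?h))"
    by (simp flip: rhom_sum[OF rhom_ev] add: T.sum_cmp)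
  finally have "0 = X.cmp (n + d * j) (\<Sum>m\<le>?N. ev u (T.cmp m ?h))" by simp
  also have "\<dots> = (\<Sum>m\<le>?N. if m = n then ev u (T.cmp n ?h) else 0)"
    unfolding X.cmp_sum by (rule sum.cong) (auto simp: X.cmp_homog[OF hom])
  also have "\<dots> = ev u (T.cmp n ?h)" by simp
  finally show ?thesis
    by (simp add: rees_kernel_homog_iff[OF homog_cmp_t[OF X.homog_cmp]])
qed

text \<open>
  \<open>binary_forms X Y x y j\<close> consists of the pairs \<open>(f(X, Y), f(x, y))\<close> for the binary forms
  \<open>f\<close> of degree \<open>j\<close>, in Horner form.
\<close>

primrec binary_forms ::
    "'k::comm_ring_1 txpol \<Rightarrow> 'k txpol \<Rightarrow> 'k tpol \<Rightarrow> 'k tpol \<Rightarrow> nat \<Rightarrow> ('k txpol \<times> 'k tpol) set"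
  where
    "binary_forms X Y x y 0 = {(Cst c, c) | c. True}"
  | "binary_forms X Y x y (Suc j) =
      {(Cst c * Y ^ Suc j + X * f, c * y ^ Suc j + x * g) | c f g. (f, g) \<in> binary_forms X Y x y j}"

lemma binary_formsI:
  "(f, g) \<in> binary_forms X Y x y j \<Longrightarrow> f' = Cst c * Y ^ Suc j + X * f \<Longrightarrow>
    g' = c * y ^ Suc j + x * g \<Longrightarrow> (f', g') \<in> binary_forms X Y x y (Suc j)"
  by auto

lemma binary_forms_add:
  "(f, g) \<in> binary_forms X Y x y j \<Longrightarrow> (f', g') \<in> binary_forms X Y x y j \<Longrightarrow>
    (f + f', g + g') \<in> binary_forms X Y x y j"
proof (induction j arbitrary: f g f' g')
  case 0
  then show ?case by (auto simp: Cst_simps)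
next
  case (Suc j)
  then obtain c f1 g1 c' f1' g1' where
    *: "(f1, g1) \<in> binary_forms X Y x y j" "(f1', g1') \<in> binary_forms X Y x y j"
    "f = Cst c * Y ^ Suc j + X * f1" "g = c * y ^ Suc j + x * g1"
    "f' = Cst c' * Y ^ Suc j + X * f1'" "g' = c' * y ^ Suc j + x * g1'"
    by auto
  show ?case
    by (rule binary_formsI[OF Suc.IH[OF *(1,2)], of _ "c + c'"])
      (simp_all add: *(3-) Cst_simps algebra_simps)
qed

lemma binary_forms_scale:
  "(f, g) \<in> binary_forms X Y x y j \<Longrightarrow> (Cst c * f, c * g) \<in> binary_forms X Y x y j"
proof (induction j arbitrary: f g)
  case 0
  then show ?case by (auto simp: Cst_simps)
next
  case (Suc j)
  then obtain c' f1 g1 where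
    *: "(f1, g1) \<in> binary_forms X Y x y j"
    "f = Cst c' * Y ^ Suc j + X * f1" "g = c' * y ^ Suc j + x * g1"
    by auto
  show ?case
    by (rule binary_formsI[OF Suc.IH[OF *(1)], of _ "c * c'"])
      (simp_all add: *(2-) Cst_simps algebra_simps)
qed

lemma binary_forms_0: "(0, 0) \<in> binary_forms X Y x y j"
proof (induction j)
  case 0
  show ?case by (simp add: Cst_simps)
next
  case (Suc j)
  show ?case by (rule binary_formsI[OF Suc, of _ 0]) (simp_all add: Cst_simps)
qed

lemma binary_forms_mult_X:
  "(f, g) \<in> binary_forms X Y x y j \<Longrightarrow> (X * f, x * g) \<in> binary_forms X Y x y (Suc j)"
  by (rule binary_formsI[of _ _ _ _ _ _ _ _ 0]) (simp_all add: Cst_simps)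

lemma binary_forms_Y: "(Cst c * Y ^ j, c * y ^ j) \<in> binary_forms X Y x y j"
proof (cases j)
  case (Suc i)
  show ?thesis unfolding Suc
    by (rule binary_formsI[OF binary_forms_0, of _ c]) simp_all
qed simp

lemma binary_forms_mult_Y:
  "(f, g) \<in> binary_forms X Y x y j \<Longrightarrow> (Y * f, y * g) \<in> binary_forms X Y x y (Suc j)"
proof (induction j arbitrary: f g)
  case 0
  then obtain c where "f = Cst c" "g = c" by auto
  then show ?case using binary_forms_Y[of c Y 1 y X x] by (simp add: mult.commute)
next
  case (Suc j)
  then obtain c f1 g1 where
    *: "(f1, g1) \<in> binary_forms X Y x y j"
    "f = Cst c * Y ^ Suc j + X * f1" "g = c * y ^ Suc j + x * g1"
    by auto
  show ?case
    by (rule binary_formsI[OF Suc.IH[OF *(1)], of _ c]) (simp_all add: *(2-) algebra_simps)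
qed

lemma binary_forms_mult_linear:
  assumes "(f, g) \<in> binary_forms X Y x y j"
  shows "((Cst a * X + Cst b * Y) * f, (a * x + b * y) * g) \<in> binary_forms X Y x y (Suc j)"
proof -
  have "(Cst a * (X * f) + Cst b * (Y * f), a * (x * g) + b * (y * g)) \<in> binary_forms X Y x y (Suc j)"
    by (intro binary_forms_add binary_forms_scale binary_forms_mult_X binary_forms_mult_Y assms)
  then show ?thesis by (simp add: algebra_simps)
qed

text \<open>The binary form obtained from \<open>h\<close> is never named; its two specializations
  are tracked together through products and sums of linear forms.\<close>

lemma binary_forms_substitution:
  fixes h :: "'k::comm_ring_1 txpol"
  assumes h: "X.homog j h"
  shows "(subst (\<lambda>i. Cst (\<alpha> i) * X + Cst (\<beta> i) * Y) h, ev (\<lambda>i. \<alpha> i * x + \<beta> i * y) h)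
    \<in> binary_forms X Y x y j"
proof -
  let ?S = "\<lambda>i. Cst (\<alpha> i) * X + Cst (\<beta> i) * Y" and ?s = "\<lambda>i. \<alpha> i * x + \<beta> i * y"
  have pow: "(?S i ^ e * f, ?s i ^ e * g) \<in> binary_forms X Y x y (e + k)"
    if "(f, g) \<in> binary_forms X Y x y k" for i e f g k
  proof (induction e)
    case 0
    show ?case using that by simp
  next
    case (Suc e)
    then show ?case using binary_forms_mult_linear by (simp add: mult.assoc)
  qed
  have prod: "(\<Prod>i\<in>A. ?S i ^ e i, \<Prod>i\<in>A. ?s i ^ e i) \<in> binary_forms X Y x y (\<Sum>i\<in>A. e i)"
    if "finite A" for A and e :: "4 \<Rightarrow> nat"
    using that
  proof induction
    case empty
    show ?case by (auto simp: Cst_simps intro!: exI[of _ 1])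
  next
    case (insert i A)
    then show ?case using pow by simp
  qed
  have "(\<Sum>m\<in>A. Cst (Poly_Mapping.lookup h m) * (\<Prod>i\<in>UNIV. ?S i ^ Poly_Mapping.lookup m i),
      \<Sum>m\<in>A. Poly_Mapping.lookup h m * (\<Prod>i\<in>UNIV. ?s i ^ Poly_Mapping.lookup m i)) \<in> binary_forms X Y x y j"
    if "finite A" "A \<subseteq> Poly_Mapping.keys h" for A
    using that
  proof induction
    case empty
    show ?case using binary_forms_0 by simp
  next
    case (insert m A)
    have "mon_degree m = j"
      using h insert.prems by (simp add: homogeneous_def flip: homogeneous_iff)
    then have "(\<Prod>i\<in>UNIV. ?S i ^ Poly_Mapping.lookup m i, \<Prod>i\<in>UNIV. ?s i ^ Poly_Mapping.lookup m i)
        \<in> binary_forms X Y x y j"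
      using prod[of UNIV "Poly_Mapping.lookup m"] by (simp add: mon_degree_def)
    then show ?case
      using insert by (simp add: binary_forms_add binary_forms_scale)
  qed
  then show ?thesis by (simp add: mpol_eval_def)
qed

text \<open>For a regular pair, the only equation between \<open>x\<close> and \<open>y\<close> is
  the Koszul one. Locally the leading coefficient in \<open>Y\<close> is a multiple of
  \<open>x\<close>; trading x Y for y X modulo \<open>Q\<close> makes the whole form a multiple of
  \<open>X\<close>, and the cofactor has one degree less.\<close>

lemma binary_forms_vanishing:
  fixes Q :: "'k::field txpol set"
  assumes Q: "ideal.subspace Q" "Cst x * Y - Cst y * X \<in> Q" and x: "x \<noteq> 0"
    and reg: "\<And>r s. r * y = s * x \<Longrightarrow> \<exists>g z. ev a g \<noteq> 0 \<and> g * r = z * x"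
  shows "(f, 0) \<in> binary_forms X Y x y j \<Longrightarrow> \<exists>G. ev a G \<noteq> 0 \<and> Cst G * f \<in> Q"
proof (induction j arbitrary: f)
  case 0
  then show ?case
    by (intro exI[of _ 1]) (auto simp: Cst_simps ideal.subspace_0[OF Q(1)] ev_simps)
next
  case (Suc j)
  have reg_power: "\<exists>g z. ev a g \<noteq> 0 \<and> g * r = z * x" if "r * y ^ n = s * x" for n r s
    using that
  proof (induction n arbitrary: r s)
    case 0
    then show ?case by (intro exI[of _ 1] exI[of _ s]) (simp add: ev_simps)
  next
    case (Suc n)
    then have "(r * y ^ n) * y = s * x" by (simp add: mult_ac)
    then obtain g z where g: "ev a g \<noteq> 0" "g * (r * y ^ n) = z * x" using reg by blast
    then have "(g * r) * y ^ n = z * x" by (simp add: mult.assoc)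
    then obtain g' z' where g': "ev a g' \<noteq> 0" "g' * (g * r) = z' * x" using Suc.IH by blast
    then have "(g' * g) * r = z' * x" by (simp add: mult.assoc)
    moreover have "ev a (g' * g) \<noteq> 0" using g g' by (simp add: ev_simps)
    ultimately show ?case by blast
  qed
  from Suc.prems obtain c f1 g1 where fg: "(f1, g1) \<in> binary_forms X Y x y j"
    "f = Cst c * Y ^ Suc j + X * f1" "0 = c * y ^ Suc j + x * g1" by auto
  have "c * y ^ Suc j = (- g1) * x" using fg(3) by (simp add: eq_neg_iff_add_eq_0 mult.commute)
  then obtain h z where h: "ev a h \<noteq> 0" "h * c = z * x" using reg_power by blast
  let ?f = "Cst (z * y) * Y ^ j + Cst h * f1"
  \<comment> \<open>After multiplication by \<open>x\<close>, the value of the new form is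
    \<open>h\<close> times that of the old one; cancelling \<open>x\<close> shows that it vanishes
    too.\<close>
  have "x * (z * y * w + h * g1) = h * (c * (y * w) + x * g1)" for w
    using h(2) by algebra
  from this[of "y ^ j"] have zero: "z * y * y ^ j + h * g1 = 0" using x fg(3) by simp
  have "(?f, z * y * y ^ j + h * g1) \<in> binary_forms X Y x y j"
    by (intro binary_forms_add binary_forms_scale binary_forms_Y fg(1))
  then obtain G where G: "ev a G \<noteq> 0" "Cst G * ?f \<in> Q" unfolding zero using Suc.IH by blast
  have hc: "Cst h * Cst c = (Cst z * Cst x :: 'k txpol)" using h(2) by (simp flip: Cst_simps)
  have "Cst (G * h) * f = Cst G * (Cst h * Cst c * Y ^ Suc j + Cst h * X * f1)"
    by (simp add: fg(2) Cst_simps algebra_simps)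
  also have "\<dots> = (Cst G * Cst z * Y ^ j) * (Cst x * Y - Cst y * X) + X * (Cst G * ?f)"
    unfolding hc by (simp add: Cst_simps algebra_simps)
  also have "\<dots> \<in> Q"
    using ideal.subspace_add[OF Q(1) ideal.subspace_scale[OF Q(1) Q(2)] ideal.subspace_scale[OF Q(1) G(2)]] .
  finally have "Cst (G * h) * f \<in> Q" .
  moreover have "ev a (G * h) \<noteq> 0" using G h by (simp add: ev_simps)
  ultimately show ?case by blast
qed

section \<open>Local generation of the kernel by syzygies\<close>

context mu_basis_setup
begin

definition I3 :: "'k txpol set"
  where "I3 = ideal.span (range p)"

lemma subspace_I3: "ideal.subspace I3"
  unfolding I3_def by (rule ideal.subspace_span)

lemma T_graded_I3: "T.graded I3"
  unfolding I3_def using thomog_p by (auto intro!: T.graded_span)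

lemma syzygy_in_I3: "(\<Sum>i\<in>UNIV. a i * u i) = 0 \<Longrightarrow> linform a \<in> I3"
proof -
  assume "(\<Sum>i\<in>UNIV. a i * u i) = 0"
  then obtain w where "\<And>i. a i = (\<Sum>r\<in>UNIV. w r * P r i)" using syzygy_combination by blast
  then have "linform a = (\<Sum>r\<in>UNIV. Cst (w r) * p r)" by (simp only: combination_p)
  then show ?thesis
    by (auto simp: I3_def intro!: ideal.span_sum ideal.span_scale intro: ideal.span_base)
qed

lemma koszul_in_I3: "Cst (u i) * Var j - Cst (u j) * Var i \<in> I3"
  using koszul_syzygy[of _ u i j, OF refl] syzygy_in_I3
  unfolding linform_when[symmetric] syzygies_alt by auto

lemma subst_scale_homog: "X.homog j h \<Longrightarrow> subst (\<lambda>i. L * Var i) h = h * L ^ j"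
  by (simp add: subst_scale X.homog_def poly_monom)

text \<open>By the Koszul syzygies, u_i X_k and u_k X_i agree modulo \<open>I3\<close>. Scaling all
  variables by u_i thus amounts to substituting u_k X_i for X_k, which is the image of
  \<open>h\<close> under \<open>hmap\<close> with Z replaced by X_i, hence 0.\<close>

lemma kernel_local_off_zeros:
  assumes h: "h \<in> rees_kernel u" "X.homog j h"
  shows "Cst (u i ^ j) * h \<in> I3"
proof -
  have 1: "subst (\<lambda>k. Cst (u i) * Var k) h - subst (\<lambda>k. Cst (u k) * Var i) h \<in> I3"
    by (rule rhom_cong_mod[OF subspace_I3 rhom_subst rhom_subst])
      (simp_all add: subst_simps koszul_in_I3 ideal.subspace_0[OF subspace_I3])
  have "subst (\<lambda>k. Cst (u k) * Var i) h = poly (map_poly Cst (hmap u h)) (Var i)"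
    by (rule rhom_eq[OF rhom_subst rhom_comp[OF rhom_hmap rhom_comp[OF rhom_map_poly[OF rhom_Cst] rhom_poly]]])
      (simp_all add: subst_simps hmap_Cst hmap_Var map_poly_const[OF rhom_Cst]
        map_poly_monom[OF rhom_Cst] poly_monom)
  also have "\<dots> = 0" using h(1) by (simp add: rees_kernel_def)
  finally have "h * Cst (u i) ^ j \<in> I3"
    using 1 by (simp only: subst_scale_homog[OF h(2)] diff_0_right)
  then show ?thesis by (simp add: Cst_simps mult.commute)
qed

text \<open>Up to the factor \<open>G\<close>, every X_i is modulo \<open>I3\<close> a combination
  of two linear forms \<open>?X\<close> and \<open>?Y\<close> that \<open>hmap\<close> sends to x Z
  and y Z. So \<open>h\<close> becomes a binary form in them that vanishes at (x, y).\<close>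

lemma kernel_local_at_zeros:
  assumes h: "h \<in> rees_kernel u" "X.homog j h" and a: "a \<in> proj_zeros (ideal.span (range u))"
  shows "\<exists>g. ev a g \<noteq> 0 \<and> Cst g * h \<in> I3"
proof -
  obtain G \<alpha> \<beta> x y xs ys where G: "ev a G \<noteq> 0" "\<And>i. G * u i = \<alpha> i * x + \<beta> i * y"
    and xy: "x = (\<Sum>i\<in>UNIV. xs i * u i)" "y = (\<Sum>i\<in>UNIV. ys i * u i)" "x \<noteq> 0"
    and reg: "\<And>r s. r * y = s * x \<Longrightarrow> \<exists>g z. ev a g \<noteq> 0 \<and> g * r = z * x"
    by (rule lci_local[OF lci u_homogeneous a]) (rule that)
  let ?X = "linform xs" and ?Y = "linform ys"
  let ?S = "\<lambda>i. Cst (\<alpha> i) * ?X + Cst (\<beta> i) * ?Y"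
  have S: "Cst G * Var i - ?S i \<in> I3" for i
  proof -
    have var: "linform (\<lambda>j. (G when j = i)) = Cst G * Var i"
      using linform_when[of G i 0 i] by (simp add: Cst_simps)
    have "(\<Sum>j\<in>UNIV. ((G when j = i) + ((- \<alpha> i) * xs j + (- \<beta> i) * ys j)) * u j) =
        (\<Sum>j\<in>UNIV. (if j = i then G * u i else 0)) - (\<alpha> i * x + \<beta> i * y)"
      unfolding xy(1,2) sum_distrib_left sum.distrib[symmetric] sum_subtractf[symmetric]
      by (rule sum.cong) (auto simp: algebra_simps)
    then have "linform (\<lambda>j. (G when j = i) + ((- \<alpha> i) * xs j + (- \<beta> i) * ys j)) \<in> I3"
      by (intro syzygy_in_I3) (simp add: G(2))
    then show ?thesis
      by (simp only: linform_add[symmetric] linform_scale[symmetric] var)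
        (simp add: Cst_simps algebra_simps)
  qed
  have "subst (\<lambda>i. Cst G * Var i) h - subst ?S h \<in> I3"
    by (rule rhom_cong_mod[OF subspace_I3 rhom_subst rhom_subst])
      (simp_all only: subst_Cst diff_self ideal.subspace_0[OF subspace_I3] mpol_eval_Var[OF rhom_Cst] S)
  then have 1: "h * Cst G ^ j - subst ?S h \<in> I3" by (simp only: subst_scale_homog[OF h(2)])
  have "(\<Sum>i\<in>UNIV. (x * ys i + (- y) * xs i) * u i) =
      x * (\<Sum>i\<in>UNIV. ys i * u i) - y * (\<Sum>i\<in>UNIV. xs i * u i)"
    by (simp add: sum_distrib_left sum_subtractf[symmetric] algebra_simps)
  then have "(\<Sum>i\<in>UNIV. (x * ys i + (- y) * xs i) * u i) = 0"
    by (simp only: xy(1,2)[symmetric]) (simp add: mult.commute)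
  then have "linform (\<lambda>i. x * ys i + (- y) * xs i) \<in> I3"
    by (rule syzygy_in_I3)
  then have 2: "Cst x * ?Y - Cst y * ?X \<in> I3"
    by (simp only: linform_add[symmetric] linform_scale[symmetric]) (simp add: Cst_simps)
  \<comment> \<open>As the arguments are \<open>G * u i\<close>, this is the image of
    \<open>h\<close> with Z set to \<open>G\<close>.\<close>
  have "ev (\<lambda>i. \<alpha> i * x + \<beta> i * y) h = poly (hmap u h) G"
    by (rule rhom_eq[OF rhom_ev rhom_comp[OF rhom_hmap rhom_poly]])
      (simp_all add: ev_simps hmap_Cst hmap_Var poly_monom mult.commute[of _ G] G(2))
  also have "\<dots> = 0" using h(1) by (simp add: rees_kernel_def)
  finally have form: "(subst ?S h, 0) \<in> binary_forms ?X ?Y x y j"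
    using binary_forms_substitution[OF h(2), of \<alpha> ?X \<beta> ?Y x y] by simp
  have "\<exists>H. ev a H \<noteq> 0 \<and> Cst H * subst ?S h \<in> I3"
    by (rule binary_forms_vanishing[OF subspace_I3 2 xy(3) _ form]) (rule reg)
  then obtain H where H: "ev a H \<noteq> 0" "Cst H * subst ?S h \<in> I3" by blast
  have "Cst (H * G ^ j) * h = Cst H * (h * Cst G ^ j - subst ?S h) + Cst H * subst ?S h"
    by (simp add: Cst_simps algebra_simps)
  also have "\<dots> \<in> I3"
    by (rule ideal.subspace_add[OF subspace_I3 ideal.subspace_scale[OF subspace_I3 1] H(2)])
  finally have "Cst (H * G ^ j) * h \<in> I3" .
  moreover have "ev a (H * G ^ j) \<noteq> 0" using H G by (simp add: ev_simps)
  ultimately show ?thesis by blast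
qed

lemma kernel_torsion:
  assumes h: "h \<in> rees_kernel u" "X.homog j h" "T.homog n h"
  obtains N where "\<And>k. tvar k ^ N * h \<in> I3"
proof -
  have loc: "\<exists>g. ev a g \<noteq> 0 \<and> Cst g * h \<in> I3" if a: "a \<noteq> (\<lambda>_. 0)" for a
  proof (cases "a \<in> proj_zeros (ideal.span (range u))")
    case True
    then show ?thesis by (rule kernel_local_at_zeros[OF h(1,2)])
  next
    case False
    then obtain c where "ev a (\<Sum>i\<in>UNIV. c i * u i) \<noteq> 0"
      using a by (auto simp: proj_zeros_def ideal_span_range)
    then have "(\<Sum>i\<in>UNIV. ev a (c i) * ev a (u i)) \<noteq> 0" by (simp add: ev_simps)
    then obtain i where "ev a (c i) * ev a (u i) \<noteq> 0"
      by (rule sum.not_neutral_contains_not_neutral)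
    then have "ev a (u i) \<noteq> 0" by simp
    then have "ev a (u i ^ j) \<noteq> 0" by (simp add: ev_simps)
    then show ?thesis using kernel_local_off_zeros[OF h(1,2)] by blast
  qed
  show thesis
    by (rule projective_nullstellensatz[OF T_graded_I3 h(3) loc]) (use that in blast)+
qed

end

section \<open>The forms \<open>F\<^sub>j\<close>\<close>

locale rees_generators = mu_basis_setup u p \<mu> d L1 L2
  for u :: "4 \<Rightarrow> 'k::alg_closed_field tpol"
    and p :: "3 \<Rightarrow> 'k txpol" and \<mu> :: "3 \<Rightarrow> nat" and d :: nat
    and L1 L2 :: "3 \<Rightarrow> 'k txpol" +
  fixes F :: "nat \<Rightarrow> 'k txpol"
  assumes d: "d \<ge> 3"
    and mu_3: "\<mu> 3 = d - 2"
    and F: "F_construction d (p 3) (signed_minor L1 L2) F"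
begin

abbreviation M :: "3 \<Rightarrow> 'k txpol"
  where "M \<equiv> signed_minor L1 L2"

lemmas M_simps = signed_minor_def[of L1 L2 1, simplified] signed_minor_def[of L1 L2 2, simplified]
  signed_minor_def[of L1 L2 3, simplified]

lemma F_top: "F (d - 2) = p 3"
  using F by (simp add: F_construction_def)

lemma thomog_p3: "T.homog (d - 2) (p 3)"
  using thomog_p[of 3] by (simp add: mu_3)

lemma F_step:
  assumes "Suc j \<le> d - 2"
  obtains A B C where
    "bihomogeneous j (1 + 2 * (d - 2 - Suc j)) A" "bihomogeneous j (1 + 2 * (d - 2 - Suc j)) B"
    "bihomogeneous j (1 + 2 * (d - 2 - Suc j)) C"
    "F (Suc j) = A * tvar 1 + B * tvar 2 + C * tvar 3" "F j = A * M 1 + B * M 2 + C * M 3"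
proof -
  have "Suc j \<in> {1..d - 2}" using assms by simp
  then show thesis using F that unfolding F_construction_def by (metis diff_Suc_1)
qed

lemma homog_L: "X.homog 1 (L1 j)" "X.homog 1 (L2 j)" "T.homog 0 (L1 j)" "T.homog 0 (L2 j)"
  using L1(1)[of j] L2(1)[of j] by (simp_all add: bihomogeneous_iff)

lemma homog_M: "X.homog (1 + 1) (M k)" and thomog_M: "T.homog 0 (M k)"
proof -
  have "X.homog (1 + 1) (L1 i * L2 j)" for i j by (rule X.homog_mult[OF homog_L(1,2)])
  then show "X.homog (1 + 1) (M k)" unfolding signed_minor_def by (simp add: X.homog_diff)
  have "T.homog (0 + 0) (L1 i * L2 j)" for i j by (rule T.homog_mult[OF homog_L(3,4)])
  then show "T.homog 0 (M k)" unfolding signed_minor_def by (simp add: T.homog_diff)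
qed

lemma F_homog:
  assumes "j \<le> d - 2"
  shows "T.homog j (F j) \<and> X.homog (1 + 2 * (d - 2 - j)) (F j)"
proof (cases "j = d - 2")
  case True
  then show ?thesis using homog_p[of 3] thomog_p3 by (simp add: F_top)
next
  case False
  then have "Suc j \<le> d - 2" using assms by simp
  then obtain A B C where
    h: "bihomogeneous j (1 + 2 * (d - 2 - Suc j)) A" "bihomogeneous j (1 + 2 * (d - 2 - Suc j)) B"
    "bihomogeneous j (1 + 2 * (d - 2 - Suc j)) C" and Fj: "F j = A * M 1 + B * M 2 + C * M 3"
    by (rule F_step)
  have e: "1 + 2 * (d - 2 - j) = (1 + 2 * (d - 2 - Suc j)) + (1 + 1)" using \<open>Suc j \<le> d - 2\<close> by simp
  have "X.homog (1 + 2 * (d - 2 - j)) (E * M k)" "T.homog (j + 0) (E * M k)"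
    if "bihomogeneous j (1 + 2 * (d - 2 - Suc j)) E" for E k
    using that unfolding e bihomogeneous_iff
    by (intro X.homog_mult T.homog_mult homog_M thomog_M; simp)+
  then show ?thesis using h unfolding Fj by (simp add: X.homog_add T.homog_add)
qed

text \<open>The expansion of the vector triple product t \<times> (L1 \<times> L2), in which the
  scalar products of t with the rows are \<open>p 1\<close> and \<open>p 2\<close>.\<close>

lemma M_proportional: "tvar j * M k - tvar k * M j \<in> J"
proof -
  have "tvar 1 * M 2 - tvar 2 * M 1 = L1 3 * p 2 - L2 3 * p 1"
    "tvar 1 * M 3 - tvar 3 * M 1 = L2 2 * p 1 - L1 2 * p 2"
    "tvar 2 * M 3 - tvar 3 * M 2 = L1 1 * p 2 - L2 1 * p 1"
    unfolding M_simps L1(2) L2(2) by (simp_all add: algebra_simps)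
  then have *: "tvar 1 * M 2 - tvar 2 * M 1 \<in> J" "tvar 1 * M 3 - tvar 3 * M 1 \<in> J"
    "tvar 2 * M 3 - tvar 3 * M 2 \<in> J"
    using p_in_J by (auto intro!: J_closed(3,4))
  have "- (tvar 1 * M 2 - tvar 2 * M 1) \<in> J" "- (tvar 1 * M 3 - tvar 3 * M 1) \<in> J"
    "- (tvar 2 * M 3 - tvar 3 * M 2) \<in> J"
    by (intro J_closed(6) *)+
  then show ?thesis
    using * exhaust_3[of j] exhaust_3[of k] by (auto simp: J_closed(1))
qed

lemma F_proportional:
  assumes "Suc j \<le> d - 2"
  shows "tvar k * F j - M k * F (Suc j) \<in> J"
proof -
  obtain A B C where Fj: "F (Suc j) = A * tvar 1 + B * tvar 2 + C * tvar 3" "F j = A * M 1 + B * M 2 + C * M 3"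
    by (rule F_step[OF assms])
  have "tvar k * F j - M k * F (Suc j) = A * (tvar k * M 1 - tvar 1 * M k)
      + B * (tvar k * M 2 - tvar 2 * M k) + C * (tvar k * M 3 - tvar 3 * M k)"
    unfolding Fj by (simp add: algebra_simps)
  then show ?thesis by (simp only:) (intro J_closed(2,4) M_proportional)
qed

lemma F_proportional_power:
  "j + n \<le> d - 2 \<Longrightarrow> tvar k ^ n * F j - M k ^ n * F (j + n) \<in> J"
proof (induction n)
  case 0
  show ?case by (simp add: J_closed)
next
  case (Suc n)
  have "tvar k ^ Suc n * F j - M k ^ Suc n * F (j + Suc n) =
      tvar k * (tvar k ^ n * F j - M k ^ n * F (j + n)) +
      M k ^ n * (tvar k * F (j + n) - M k * F (Suc (j + n)))"
    by (simp add: algebra_simps)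
  also have "\<dots> \<in> J"
    using Suc by (intro J_closed(2,4) F_proportional) simp_all
  finally show ?case .
qed

text \<open>The generators of \<open>J\<close> have degree 1 in t.\<close>

lemma thomog_0_in_J: "T.homog 0 f \<Longrightarrow> f \<in> J \<Longrightarrow> f = 0"
proof -
  assume f: "T.homog 0 f" "f \<in> J"
  then obtain a b where ab: "f = p 1 * a + p 2 * b" unfolding in_J by (metis mult.commute)
  have 1: "T.homog 1 (p 1)" "T.homog 1 (p 2)"
    using thomog_p[of 1] thomog_p[of 2] by (simp_all add: mu_1 mu_2)
  have "f = T.cmp 0 f" using f(1) by (simp add: T.cmp_self)
  also have "\<dots> = 0"
    by (simp add: ab T.cmp_add T.cmp_homog_mult[OF 1(1)] T.cmp_homog_mult[OF 1(2)])
  finally show ?thesis .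
qed

text \<open>If all minors vanished, the rows would be proportional with factors \<open>p 1\<close>
  and \<open>p 2\<close>; coprimality would then put the entries \<open>L2 k\<close>, which are free
  of t, into \<open>J\<close>.\<close>

lemma M_nonzero: "\<exists>k. M k \<noteq> 0"
proof (rule ccontr)
  assume "\<not> ?thesis"
  then have M: "M 1 = 0" "M 2 = 0" "M 3 = 0" by auto
  have "L2 k * p 1 = L1 k * p 2" for k
  proof -
    have "L2 1 * p 1 - L1 1 * p 2 = tvar 3 * M 2 - tvar 2 * M 3"
      "L2 2 * p 1 - L1 2 * p 2 = tvar 1 * M 3 - tvar 3 * M 1"
      "L2 3 * p 1 - L1 3 * p 2 = tvar 2 * M 1 - tvar 1 * M 2"
      unfolding M_simps L1(2) L2(2) by (simp_all add: algebra_simps)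
    then show ?thesis using M exhaust_3[of k] by auto
  qed
  then have "p 2 dvd L2 k" for k by (rule coprime_p1_p2)
  then have "L2 k \<in> J" for k
    using p_in_J(2) J_closed(5) by (metis dvdE)
  then have "L2 k = 0" for k by (rule thomog_0_in_J[OF homog_L(4)])
  then show False using L2(2) p_neq_0[of 2] by simp
qed

text \<open>In degree one in X only the X-free parts of the coefficients count, which reduces ideal
  relations to relations over K[t].\<close>

lemma linear_in_span:
  assumes f: "X.homog 1 f" "f = a * p r + b * p s"
  shows "\<exists>a' b'. f = Cst a' * p r + Cst b' * p s"
proof -
  have "f = X.cmp 1 (p r * a + p s * b)" using f by (simp add: X.cmp_self mult.commute)
  also have "\<dots> = p r * X.cmp 0 a + p s * X.cmp 0 b"
    using X.cmp_homog_mult[OF homog_p, of 1] by (simp add: X.cmp_add)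
  finally have "f = p r * X.cmp 0 a + p s * X.cmp 0 b" .
  moreover obtain a' b' where "X.cmp 0 a = Cst a'" "X.cmp 0 b = Cst b'"
    using X_homog_0_Cst[OF X.homog_cmp] by metis
  ultimately have "f = Cst a' * p r + Cst b' * p s" by (simp add: mult.commute)
  then show ?thesis by blast
qed

lemma p_not_combination:
  assumes "r \<noteq> s" "r \<noteq> t" "s \<noteq> t"
  shows "p r \<noteq> a * p s + b * p t"
proof
  assume "p r = a * p s + b * p t"
  from linear_in_span[OF homog_p this] obtain a' b' where eq: "p r = Cst a' * p s + Cst b' * p t" by blast
  define w where "w x = (if x = r then - 1 else if x = s then a' else if x = t then b' else 0)" for x
  have "(\<Sum>x\<in>UNIV. Cst (w x) * p x) = (\<Sum>x\<in>{r, s, t}. Cst (w x) * p x)"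
    by (rule sum.mono_neutral_right) (auto simp: w_def Cst_simps)
  also have "\<dots> = 0" using assms eq by (simp add: w_def Cst_simps)
  finally have "w r = 0" by (rule independent_p)
  then show False by (simp add: w_def)
qed

lemma p3_notin_J: "p 3 \<notin> J"
  unfolding in_J using p_not_combination[of 3 1 2] by auto

text \<open>Climbing to the top index, a power of t_k times \<open>F j\<close> is congruent to a
  power of \<open>M k\<close> times \<open>p 3\<close>, and the prime ideal \<open>J\<close>
  contains neither of these two factors.\<close>

lemma F_notin_J:
  assumes "j \<le> d - 2"
  shows "F j \<notin> J"
proof
  assume j: "F j \<in> J"
  obtain k where k: "M k \<noteq> 0" using M_nonzero by blast
  have Mk: "M k \<notin> J" using thomog_0_in_J[OF thomog_M] k by blast
  have pow: "M k ^ n * p 3 \<notin> J" for n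
  proof (induction n)
    case 0
    show ?case using p3_notin_J by simp
  next
    case (Suc n)
    then show ?case using prime_J[of "M k" "M k ^ n * p 3"] Mk by (auto simp: mult.assoc)
  qed
  let ?n = "d - 2 - j"
  have "tvar k ^ ?n * F j - M k ^ ?n * F (j + ?n) \<in> J"
    using assms by (intro F_proportional_power) simp
  moreover have "j + ?n = d - 2" using assms by simp
  ultimately have "tvar k ^ ?n * F j - M k ^ ?n * p 3 \<in> J" by (simp only: F_top)
  then have "tvar k ^ ?n * F j - (tvar k ^ ?n * F j - M k ^ ?n * p 3) \<in> J"
    by (rule J_closed(3)[OF J_closed(4)[OF j]])
  then show False using pow[of ?n] by simp
qed

section \<open>Reduction of kernel elements to a multiple of a single F_j modulo J\<close>

lemma t_cohomology:
  assumes "\<And>j k. tvar j * c k - tvar k * c j \<in> J"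
  obtains f e where "T.homog 0 f" "\<And>k. c k - (f * M k + e * tvar k) \<in> J"
proof -
  obtain a3 b3 a1 b1 a2 b2 where
    eq: "tvar 1 * c 2 - tvar 2 * c 1 = a3 * p 1 + b3 * p 2" "tvar 2 * c 3 - tvar 3 * c 2 = a1 * p 1 + b1 * p 2"
    "tvar 3 * c 1 - tvar 1 * c 3 = a2 * p 1 + b2 * p 2"
    using assms unfolding in_J by meson
  obtain f e x1 y1 x2 y2 x3 y3 where f: "T.homog 0 f" and
    c: "c 1 = f * M 1 + e * tvar 1 + (x1 * p 1 + y1 * p 2)"
    "c 2 = f * M 2 + e * tvar 2 + (x2 * p 1 + y2 * p 2)"
    "c 3 = f * M 3 + e * tvar 3 + (x3 * p 1 + y3 * p 2)"
    using K.first_cohomology[OF t_decomposition eq] unfolding M_simps by blast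
  have "c k - (f * M k + e * tvar k) \<in> J" for k
    using exhaust_3[of k]
  proof (elim disjE)
    assume "k = 1"
    then show ?thesis using c(1) unfolding in_J by auto
  next
    assume "k = 2"
    then show ?thesis using c(2) unfolding in_J by auto
  next
    assume "k = 3"
    then show ?thesis using c(3) unfolding in_J by auto
  qed
  then show thesis using that f by blast
qed

text \<open>Start of the descent. Below degree \<open>d - 2\<close> in t, \<open>p 3\<close> cannot
  contribute, so \<open>w\<close> already lies in \<open>J\<close> and the factor 0 serves.\<close>

lemma I3_reduction:
  assumes w: "w \<in> I3" "T.homog i w"
  shows "\<exists>c. w - c * F (min i (d - 2)) \<in> J"
proof -
  obtain c where "w = (\<Sum>r\<in>UNIV. c r * p r)" using w(1) unfolding I3_def ideal_span_range by blast
  then have "w = c 1 * p 1 + c 2 * p 2 + p 3 * c 3" by (simp add: sum_3 mult.commute)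
  moreover have "c 1 * p 1 + c 2 * p 2 \<in> J" unfolding in_J by blast
  ultimately have "w - p 3 * c 3 \<in> J" by simp
  then have "T.cmp i (w - p 3 * c 3) \<in> J" by (rule T.graded_cmp[OF T_graded_J])
  then have *: "w - (if d - 2 \<le> i then p 3 * T.cmp (i - (d - 2)) (c 3) else 0) \<in> J"
    by (simp add: T.cmp_diff T.cmp_self[OF w(2)] T.cmp_homog_mult[OF thomog_p3])
  show ?thesis
  proof (cases "d - 2 \<le> i")
    case True
    then show ?thesis using * by (intro exI[of _ "T.cmp (i - (d - 2)) (c 3)"]) (simp add: F_top mult.commute)
  next
    case False
    then show ?thesis using * by (intro exI[of _ 0]) simp
  qed
qed

text \<open>Of the two terms supplied by \<open>t_cohomology\<close> the degree in t keeps only one: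
  the term with \<open>f\<close> while i < d - 2, the term with \<open>e\<close> from d - 2 on. This
  is why a single \<open>F\<close> suffices.\<close>

lemma reduction_step:
  assumes h: "T.homog i h" and step: "\<And>k. \<exists>c. tvar k * h - c * F (min (Suc i) (d - 2)) \<in> J"
  shows "\<exists>c. h - c * F (min i (d - 2)) \<in> J"
proof -
  define m where "m = min (Suc i) (d - 2)"
  have Fm: "F m \<notin> J" by (rule F_notin_J) (simp add: m_def)
  have cross: "tvar j * c k - tvar k * c j \<in> J" if "\<And>k. tvar k * h - c k * F m \<in> J" for c j k
  proof -
    have "(tvar j * c k - tvar k * c j) * F m =
        tvar k * (tvar j * h - c j * F m) - tvar j * (tvar k * h - c k * F m)"
      by (simp add: algebra_simps)
    also have "\<dots> \<in> J" by (intro J_closed(3,4) that)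
    finally show ?thesis using prime_J Fm by blast
  qed
  from step obtain c where c: "\<And>k. tvar k * h - c k * F m \<in> J" unfolding m_def by metis
  show ?thesis
  proof (cases "Suc i \<le> d - 2")
    case True
    then have m: "m = Suc i" by (simp add: m_def)
    obtain f e where f: "T.homog 0 f" and fe: "\<And>k. c k - (f * M k + e * tvar k) \<in> J"
      using t_cohomology[OF cross[OF c]] by blast
    have "tvar k * (h - (f * F i + e * F (Suc i))) \<in> J" for k
    proof -
      have "tvar k * (h - (f * F i + e * F (Suc i))) = (tvar k * h - c k * F (Suc i))
          + (c k - (f * M k + e * tvar k)) * F (Suc i) - f * (tvar k * F i - M k * F (Suc i))"
        by (simp add: algebra_simps)
      also have "\<dots> \<in> J"
        by (rule J_closed(3)[OF J_closed(2)[OF c[of k, unfolded m] J_closed(5)[OF fe]]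
              J_closed(4)[OF F_proportional[OF True]]])
      finally show ?thesis .
    qed
    then have "h - (F i * f + F (Suc i) * e) \<in> J" using saturated_J by (simp add: mult.commute)
    \<comment> \<open>\<open>F (Suc i)\<close> has degree i + 1 in t and drops out of the component
      \<open>i\<close>.\<close>
    then have "T.cmp i (h - (F i * f + F (Suc i) * e)) \<in> J" by (rule T.graded_cmp[OF T_graded_J])
    moreover have "T.homog i (F i)" "T.homog (Suc i) (F (Suc i))" using F_homog True by auto
    ultimately have "h - F i * T.cmp 0 f \<in> J"
      by (simp add: T.cmp_diff T.cmp_add T.cmp_self[OF h] T.cmp_homog_mult)
    then show ?thesis using True by (intro exI[of _ "T.cmp 0 f"]) (simp add: mult.commute)
  next
    case False
    then have m: "m = d - 2" and di: "d - 2 \<le> i" by (simp_all add: m_def)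
    define n where "n = i - (d - 2)"
    have Fm: "F m = p 3" by (simp add: m F_top)
    \<comment> \<open>\<open>F m\<close> is now \<open>p 3\<close>, of degree \<open>d - 2\<close>
      in t, so only the component of \<open>c k\<close> in degree i + 1 - (d - 2) matters.\<close>
    define c' where "c' k = T.cmp (Suc n) (c k)" for k
    have c': "tvar k * h - c' k * F m \<in> J" for k
    proof -
      have th: "T.homog (Suc i) (tvar k * h)" using T.homog_mult[OF thomog_tvar h] by simp
      have "tvar k * h - p 3 * c k \<in> J" using c[of k] by (simp add: Fm mult.commute)
      then have "T.cmp (Suc i) (tvar k * h - p 3 * c k) \<in> J" by (rule T.graded_cmp[OF T_graded_J])
      then have "tvar k * h - p 3 * T.cmp (Suc i - (d - 2)) (c k) \<in> J"
        using di by (simp add: T.cmp_diff T.cmp_self[OF th] T.cmp_homog_mult[OF thomog_p3])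
      moreover have "Suc i - (d - 2) = Suc n" using di by (simp add: n_def)
      ultimately show ?thesis by (simp add: c'_def Fm mult.commute)
    qed
    obtain f e where f: "T.homog 0 f" and fe: "\<And>k. c' k - (f * M k + e * tvar k) \<in> J"
      using t_cohomology[OF cross[OF c']] by blast
    have e: "c' k - tvar k * T.cmp n e \<in> J" for k
    proof -
      have fM: "T.homog 0 (f * M k)" using T.homog_mult[OF f thomog_M] by simp
      have "c' k - (f * M k + tvar k * e) \<in> J" using fe[of k] by (simp add: mult.commute)
      \<comment> \<open>\<open>f * M k\<close> is free of t and has no component in the positive
        degree \<open>Suc n\<close>.\<close>
      then have "T.cmp (Suc n) (c' k - (f * M k + tvar k * e)) \<in> J"
        by (rule T.graded_cmp[OF T_graded_J])
      then show ?thesis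
        by (simp add: T.cmp_diff T.cmp_add c'_def T.cmp_self[OF T.homog_cmp] T.cmp_homog[OF fM]
            T.cmp_homog_mult[OF thomog_tvar])
    qed
    have "tvar k * (h - T.cmp n e * F m) \<in> J" for k
    proof -
      have "tvar k * (h - T.cmp n e * F m) =
          (tvar k * h - c' k * F m) + (c' k - tvar k * T.cmp n e) * F m"
        by (simp add: algebra_simps)
      also have "\<dots> \<in> J" by (rule J_closed(2)[OF c' J_closed(5)[OF e]])
      finally show ?thesis .
    qed
    then have "h - T.cmp n e * F m \<in> J" by (rule saturated_J)
    then show ?thesis using di by (auto simp: m min_absorb2)
  qed
qed

lemma reduction:
  assumes h: "T.homog i h" and N: "\<And>k. tvar k ^ N * h \<in> I3"
  shows "\<exists>c. h - c * F (min i (d - 2)) \<in> J"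
proof -
  \<comment> \<open>The degree is quantified inside, because each multiplication by a t variable
    raises it.\<close>
  let ?Z = "\<lambda>h. \<forall>i. T.homog i h \<longrightarrow> (\<exists>c. h - c * F (min i (d - 2)) \<in> J)"
  have "?Z h"
  proof (rule power_descent[where v = tvar and N = N and Z = ?Z])
    fix g k
    have "g * tvar k ^ N * h \<in> I3"
      using ideal.subspace_scale[OF subspace_I3 N] by (simp only: mult.assoc)
    then show "?Z (g * tvar k ^ N * h)" using I3_reduction by blast
  next
    fix h assume Z: "\<And>k. ?Z (tvar k * h)"
    show "?Z h"
    proof (intro allI impI)
      fix i assume h: "T.homog i h"
      have "T.homog (Suc i) (tvar k * h)" for k using T.homog_mult[OF thomog_tvar h] by simp
      then show "\<exists>c. h - c * F (min i (d - 2)) \<in> J"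
        using Z by (intro reduction_step[OF h]) blast
    qed
  qed
  then show ?thesis using h by blast
qed

section \<open>Generation of the kernel and minimality\<close>

definition gens :: "'k txpol set"
  where "gens = {p 1, p 2} \<union> F ` {0..d - 2}"

lemma p_in_kernel: "p r \<in> rees_kernel u"
proof -
  have "ev u (p r) = 0" by (simp add: p_eq ev_simps P_syzygy)
  then show ?thesis using rees_kernel_homog_iff[OF homog_p] by blast
qed

lemma J_in_kernel: "J \<subseteq> rees_kernel u"
  unfolding J_def using p_in_kernel by (intro ideal.span_minimal subspace_rees_kernel) auto

text \<open>Downward from \<open>p 3\<close>: \<open>tvar 1 * F j\<close> is modulo \<open>J\<close>
  a multiple of \<open>F (Suc j)\<close>, and \<open>tvar 1\<close> cancels because
  \<open>hmap\<close> maps into a domain.\<close>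

lemma F_in_kernel: "j \<le> d - 2 \<Longrightarrow> F j \<in> rees_kernel u"
proof (induction j rule: inc_induct)
  case base
  show ?case by (simp add: F_top p_in_kernel)
next
  case (step j)
  note K = subspace_rees_kernel[of u]
  have "tvar 1 * F j - M 1 * F (Suc j) \<in> rees_kernel u"
    using F_proportional[of j 1] step J_in_kernel by auto
  moreover have "M 1 * F (Suc j) \<in> rees_kernel u"
    by (rule ideal.subspace_scale[OF K step.IH])
  ultimately have "(tvar 1 * F j - M 1 * F (Suc j)) + M 1 * F (Suc j) \<in> rees_kernel u"
    by (rule ideal.subspace_add[OF K])
  then have "tvar 1 * F j \<in> rees_kernel u" by simp
  then show ?case by (rule rees_kernel_cancel) simp
qed

lemma span_gens: "ideal.span gens = rees_kernel u"
proof
  show "ideal.span gens \<subseteq> rees_kernel u"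
    using p_in_kernel F_in_kernel
    by (intro ideal.span_minimal subspace_rees_kernel) (auto simp: gens_def)
  have J: "J \<subseteq> ideal.span gens"
    unfolding J_def by (rule ideal.span_mono) (auto simp: gens_def)
  show "rees_kernel u \<subseteq> ideal.span gens"
  proof
    fix h assume h: "h \<in> rees_kernel u"
    have hom_u: "X.homog d (u i)" for i using u_homogeneous by (simp add: homogeneous_iff)
    have "T.cmp n (X.cmp j h) \<in> ideal.span gens" for n j
    proof -
      let ?h = "T.cmp n (X.cmp j h)"
      have "?h \<in> rees_kernel u" by (rule rees_kernel_cmp[OF hom_u h])
      then obtain N where "\<And>k. tvar k ^ N * ?h \<in> I3"
        by (rule kernel_torsion[OF _ homog_cmp_t[OF X.homog_cmp] T.homog_cmp]) (rule that)
      then obtain c where "?h - c * F (min n (d - 2)) \<in> J"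
        using reduction[OF T.homog_cmp] by blast
      moreover have "c * F (min n (d - 2)) \<in> ideal.span gens"
        by (intro ideal.span_scale ideal.span_base) (simp add: gens_def)
      ultimately have "(?h - c * F (min n (d - 2))) + c * F (min n (d - 2)) \<in> ideal.span gens"
        using J by (intro ideal.span_add) auto
      then show ?thesis by simp
    qed
    then have "X.cmp j h \<in> ideal.span gens" for j
      by (rule T.gradedI_cmp[OF ideal.subspace_span])
    then show "h \<in> ideal.span gens"
      by (rule X.gradedI_cmp[OF ideal.subspace_span])
  qed
qed

text \<open>Any other \<open>F i\<close> exceeds the bidegree of \<open>F j\<close> in t if i > j
  and in X if i < j. So in this bidegree the remaining generators produce only elements of
  \<open>J\<close>.\<close>

lemma F_indispensable:
  assumes j: "j \<le> d - 2"
  shows "F j \<notin> ideal.span (gens - {F j})"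
proof
  let ?e = "1 + 2 * (d - 2 - j)"
  have "X.cmp ?e (T.cmp j f) \<in> J" if "f \<in> ideal.span (gens - {F j})" for f
    using that
  proof (induction f rule: ideal.span_induct_alt)
    case base
    show ?case by (simp add: J_closed)
  next
    case (step c x y)
    have "X.cmp ?e (T.cmp j (c * x)) \<in> J"
    proof (cases "x \<in> {p 1, p 2}")
      case True
      then have "c * x \<in> J" using p_in_J by (auto intro: J_closed(4))
      then show ?thesis by (intro X.graded_cmp[OF X_graded_J] T.graded_cmp[OF T_graded_J])
    next
      case False
      then obtain i where i: "x = F i" "i \<le> d - 2" using step by (auto simp: gens_def)
      then have "i \<noteq> j" using step by auto
      have Fi: "T.homog i (F i)" "X.homog (1 + 2 * (d - 2 - i)) (F i)" using F_homog[OF i(2)] by auto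
      have "X.cmp ?e (T.cmp j (F i * c)) = 0"
      proof (cases "i \<le> j")
        case True
        then have "?e < 1 + 2 * (d - 2 - i)" using i j \<open>i \<noteq> j\<close> by simp
        then show ?thesis using True
          by (simp add: T.cmp_homog_mult[OF Fi(1)] X.cmp_homog_mult[OF Fi(2)])
      qed (simp add: T.cmp_homog_mult[OF Fi(1)])
      then show ?thesis by (simp add: i mult.commute[of c] J_closed)
    qed
    then show ?case using step by (simp add: T.cmp_add X.cmp_add J_closed)
  qed
  moreover assume "F j \<in> ideal.span (gens - {F j})"
  ultimately have "X.cmp ?e (T.cmp j (F j)) \<in> J" by blast
  then have "F j \<in> J" using F_homog[OF j] by (simp add: T.cmp_self X.cmp_self)
  then show False using F_notin_J[OF j] by blast
qed

text \<open>Every \<open>F i\<close> below the top index has degree at least 3 in X, so in degree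
  one only \<open>p s\<close> and \<open>p 3\<close> contribute, and a relation there contradicts
  the independence of the mu-basis.\<close>

lemma p_indispensable:
  assumes rs: "r = 1 \<and> s = 2 \<or> r = 2 \<and> s = (1::3)"
  shows "p r \<notin> ideal.span (gens - {p r})"
proof
  have "\<exists>a b. X.cmp 1 f = a * p s + b * p 3" if "f \<in> ideal.span (gens - {p r})" for f
    using that
  proof (induction f rule: ideal.span_induct_alt)
    case base
    show ?case by (intro exI[of _ 0]) simp
  next
    case (step c x y)
    have "\<exists>a b. X.cmp 1 (c * x) = a * p s + b * p 3"
    proof -
      have lin: "X.cmp 1 (c * p t) = X.cmp 0 c * p t" for t
        using X.cmp_homog_mult[OF homog_p[of t], of 1 c] by (simp add: mult.commute)
      consider "x = p s" | "x = p 3" | i where "x = F i" "i < d - 2"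
        using step(1) rs F_top by (auto simp: gens_def le_less)
      then show ?thesis
      proof cases
        case 1
        have "X.cmp 1 (c * x) = X.cmp 0 c * p s + 0 * p 3" unfolding 1 lin by simp
        then show ?thesis by blast
      next
        case 2
        have "X.cmp 1 (c * x) = 0 * p s + X.cmp 0 c * p 3" unfolding 2 lin by simp
        then show ?thesis by blast
      next
        case (3 i)
        then have "X.homog (1 + 2 * (d - 2 - i)) (F i)" using F_homog by simp
        from X.cmp_homog_mult[OF this, of 1 c] 3 have "X.cmp 1 (c * x) = 0 * p s + 0 * p 3"
          by (simp add: mult.commute)
        then show ?thesis by blast
      qed
    qed
    then obtain a b a' b' where "X.cmp 1 (c * x) = a * p s + b * p 3" "X.cmp 1 y = a' * p s + b' * p 3"
      using step by blast
    then have "X.cmp 1 (c * x + y) = (a + a') * p s + (b + b') * p 3"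
      by (simp add: X.cmp_add algebra_simps)
    then show ?case by blast
  qed
  moreover assume "p r \<in> ideal.span (gens - {p r})"
  ultimately obtain a b where "p r = a * p s + b * p 3"
    using X.cmp_self[OF homog_p] by metis
  moreover have "r \<noteq> s" "r \<noteq> 3" "s \<noteq> 3" using rs by auto
  ultimately show False using p_not_combination by blast
qed

lemma minimal_generators_gens: "minimal_generators gens (rees_kernel u)"
  unfolding minimal_generators_def
proof (intro conjI ballI)
  show "ideal.span gens = rees_kernel u" by (rule span_gens)
  fix s assume "s \<in> gens"
  then consider "s = p 1" | "s = p 2" | j where "s = F j" "j \<le> d - 2" by (auto simp: gens_def)
  then show "s \<notin> ideal.span (gens - {s})"
    by cases (use p_indispensable[of 1 2] p_indispensable[of 2 1] F_indispensable in auto)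
qed

end

theorem theorem4p9:
  fixes d :: nat
    and u :: "4 \<Rightarrow> 'k::alg_closed_field tpol"
    and p :: "3 \<Rightarrow> 'k txpol"
    and \<mu> :: "3 \<Rightarrow> nat"
    and L1 L2 :: "3 \<Rightarrow> 'k txpol"
    and F :: "nat \<Rightarrow> 'k txpol"
  assumes d: "d \<ge> 3"
    and u_nonzero: "\<And>i. u i \<noteq> 0"
    and u_homogeneous: "\<And>i. homogeneous d (u i)"
    and u_gcd: "\<And>g. (\<And>i. g dvd u i) \<Longrightarrow> g dvd 1"
    and saturated: "saturated_wrt (ideal.span {Var 1, Var 2, Var 3}) (ideal.span (range u))"
    and lci: "local_complete_intersection (ideal.span (range u))"
    and basis: "mu_basis u p \<mu>"
    and degrees: "\<mu> 1 = 1" "\<mu> 2 = 1" "\<mu> 3 = d - 2"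
    and L1: "\<And>j. bihomogeneous 0 1 (L1 j)" "p 1 = L1 1 * tvar 1 + L1 2 * tvar 2 + L1 3 * tvar 3"
    and L2: "\<And>j. bihomogeneous 0 1 (L2 j)" "p 2 = L2 1 * tvar 1 + L2 2 * tvar 2 + L2 3 * tvar 3"
    and F: "F_construction d (p 3) (signed_minor L1 L2) F"
  shows "minimal_generators ({p 1, p 2} \<union> F ` {0..d - 2}) (rees_kernel u)"
proof -
  interpret rees_generators u p \<mu> d L1 L2 F
    by unfold_locales (fact assms)+
  show ?thesis using minimal_generators_gens by (simp only: gens_def)
qed

end
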